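(* The isotropy irreducible Berger space $\mathrm{Sp}(2)/\mathrm{Sp}(1)_{irr}\approx \mathrm{SO}(5)/\mathrm{SO}(3)_{irr}$, equipped with its homogeneous Einstein metric, is linearly unstable.
   Context: The Berger space is the $7$-dimensional homogeneous space $\mathrm{SO}(5)/\mathrm{SO}(3)_{irr}$, where $\mathrm{SO}(3)$ is embedded in $\mathrm{SO}(5)$ by its irreducible $5$-dimensional (orthogonal) representation; equivalently $\mathrm{Sp}(2)/\mathrm{Sp}(1)_{irr}$, where $\mathrm{Sp}(1)$ is embedded in $\mathrm{Sp}(2)$ by its irreducible complex $4$-dimensional (symplectic) representation. It is isotropy irreducible, and its homogeneous Einstein metric is, up to a positive constant factor, the invariant metric induced by $-B$, where $B$ is the Killing form of $\mathfrak{sp}(2)$ restricted to the $B$-orthogonal complement $\mathfrak{m}$ of $\mathfrak{sp}(1)$. A symmetric $2$-tensor $h$ is transverse traceless (TT) if $\mathrm{tr}_g h=0$ and $\delta_g h=0$ (divergence-free). For an Einstein metric $g$ with $\mathrm{Ric}_g=E\,g$ on a compact manifold, $g$ is linearly unstable if there is a non-trivial TT symmetric $2$-tensor $h$ with $$\langle \nabla^*\nabla h-2\mathring{R}h,h\rangle_{L^2(M,g)}=\langle(\Delta_L-2E)h,h\rangle_{L^2(M,g)}<0,$$ where $\Delta_L$ is the positive Lichnerowicz Laplacian, $\mathring{R}h$ is the action of the curvature tensor on symmetric $2$-tensors, and $\nabla^*\nabla$ is the (positive) rough Laplacian. *)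

theory Defs
  imports "HOL-Analysis.Analysis"
begin

section \<open>Smooth functions on open subsets of Euclidean space\<close>

definition pd :: "'n::finite \<Rightarrow> (real^'n \<Rightarrow> 'b::real_normed_vector) \<Rightarrow> real^'n \<Rightarrow> 'b" where
  "pd i f x = frechet_derivative f (at x) (axis i 1)"

primrec Ck_on :: "nat \<Rightarrow> (real^'n::finite) set \<Rightarrow> (real^'n \<Rightarrow> 'b::real_normed_vector) \<Rightarrow> bool" where
  "Ck_on 0 U f \<longleftrightarrow> continuous_on U f"
| "Ck_on (Suc k) U f \<longleftrightarrow> (\<forall>x\<in>U. f differentiable (at x)) \<and> (\<forall>i. Ck_on k U (pd i f))"

definition smooth_on :: "(real^'n::finite) set \<Rightarrow> (real^'n \<Rightarrow> 'b::real_normed_vector) \<Rightarrow> bool" where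
  "smooth_on U f \<longleftrightarrow> (\<forall>k. Ck_on k U f)"


section \<open>Riemannian geometry in local coordinates\<close>

text \<open>
  In this section the function \<open>g\<close> is the coefficient matrix of a Riemannian metric on an open
  subset of coordinate space, and \<open>h\<close> that of a symmetric 2-tensor.
\<close>

type_synonym 'n coeffs = "real^'n \<Rightarrow> real^'n^'n"

definition christoffel :: "'n::finite coeffs \<Rightarrow> 'n \<Rightarrow> 'n \<Rightarrow> 'n \<Rightarrow> real^'n \<Rightarrow> real" where
  "christoffel g k i j x =
     (\<Sum>l\<in>UNIV. matrix_inv (g x) $ k $ l *
        (pd i (\<lambda>y. g y $ j $ l) x + pd j (\<lambda>y. g y $ i $ l) x - pd l (\<lambda>y. g y $ i $ j) x)) / 2"

text \<open>\<open>riem g l k i j\<close> is the component \<open>R\<^sup>l\<^sub>k\<^sub>i\<^sub>j\<close> with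
  \<open>R(\<partial>\<^sub>i,\<partial>\<^sub>j)\<partial>\<^sub>k = \<Sum>\<^sub>l R\<^sup>l\<^sub>k\<^sub>i\<^sub>j \<partial>\<^sub>l\<close> and
  \<open>R(X,Y) = [\<nabla>\<^sub>X,\<nabla>\<^sub>Y] - \<nabla>\<^bsub>[X,Y]\<^esub>\<close>.\<close>

definition riem :: "'n::finite coeffs \<Rightarrow> 'n \<Rightarrow> 'n \<Rightarrow> 'n \<Rightarrow> 'n \<Rightarrow> real^'n \<Rightarrow> real" where
  "riem g l k i j x =
     pd i (christoffel g l j k) x - pd j (christoffel g l i k) x
     + (\<Sum>m\<in>UNIV. christoffel g l i m x * christoffel g m j k x
                 - christoffel g l j m x * christoffel g m i k x)"

definition ricci :: "'n::finite coeffs \<Rightarrow> 'n coeffs" where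
  "ricci g x = (\<chi> j k. \<Sum>i\<in>UNIV. riem g i k i j x)"

text \<open>\<open>cov2 g h k i j = (\<nabla>\<^sub>k h)\<^sub>i\<^sub>j\<close>, and likewise \<open>cov3\<close> for a 3-tensor.\<close>

definition cov2 :: "'n::finite coeffs \<Rightarrow> 'n coeffs \<Rightarrow> 'n \<Rightarrow> 'n \<Rightarrow> 'n \<Rightarrow> real^'n \<Rightarrow> real" where
  "cov2 g h k i j x =
     pd k (\<lambda>y. h y $ i $ j) x
     - (\<Sum>l\<in>UNIV. christoffel g l k i x * h x $ l $ j)
     - (\<Sum>l\<in>UNIV. christoffel g l k j x * h x $ i $ l)"

definition cov3 :: "'n::finite coeffs \<Rightarrow> ('n \<Rightarrow> 'n \<Rightarrow> 'n \<Rightarrow> real^'n \<Rightarrow> real) \<Rightarrow>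
    'n \<Rightarrow> 'n \<Rightarrow> 'n \<Rightarrow> 'n \<Rightarrow> real^'n \<Rightarrow> real" where
  "cov3 g T m k i j x =
     pd m (T k i j) x
     - (\<Sum>l\<in>UNIV. christoffel g l m k x * T l i j x)
     - (\<Sum>l\<in>UNIV. christoffel g l m i x * T k l j x)
     - (\<Sum>l\<in>UNIV. christoffel g l m j x * T k i l x)"

definition rough_laplacian :: "'n::finite coeffs \<Rightarrow> 'n coeffs \<Rightarrow> 'n coeffs" where
  "rough_laplacian g h x =
     (\<chi> i j. - (\<Sum>m\<in>UNIV. \<Sum>k\<in>UNIV. matrix_inv (g x) $ m $ k * cov3 g (cov2 g h) m k i j x))"

text \<open>\<open>(R\<^sup>\<circ>h)(X,Y) = \<Sum>\<^sub>a h(R(e\<^sub>a,X)Y, e\<^sub>a)\<close> for an orthonormal frame \<open>e\<^sub>a\<close>; the sign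
  convention is the one in which the curvature action sends \<open>g\<close> to its Ricci tensor.\<close>

definition curv_action :: "'n::finite coeffs \<Rightarrow> 'n coeffs \<Rightarrow> 'n coeffs" where
  "curv_action g h x =
     (\<chi> i j. \<Sum>a\<in>UNIV. \<Sum>b\<in>UNIV. \<Sum>l\<in>UNIV.
        matrix_inv (g x) $ a $ b * riem g l j a i x * h x $ l $ b)"

definition tr_metric :: "'n::finite coeffs \<Rightarrow> 'n coeffs \<Rightarrow> real^'n \<Rightarrow> real" where
  "tr_metric g h x = (\<Sum>i\<in>UNIV. \<Sum>j\<in>UNIV. matrix_inv (g x) $ i $ j * h x $ i $ j)"

definition divergence :: "'n::finite coeffs \<Rightarrow> 'n coeffs \<Rightarrow> real^'n \<Rightarrow> real^'n" where
  "divergence g h x =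
     (\<chi> j. - (\<Sum>i\<in>UNIV. \<Sum>k\<in>UNIV. matrix_inv (g x) $ i $ k * cov2 g h i k j x))"

definition inner_metric :: "'n::finite coeffs \<Rightarrow> 'n coeffs \<Rightarrow> 'n coeffs \<Rightarrow> real^'n \<Rightarrow> real" where
  "inner_metric g h k x =
     (\<Sum>i\<in>UNIV. \<Sum>j\<in>UNIV. \<Sum>a\<in>UNIV. \<Sum>b\<in>UNIV.
        matrix_inv (g x) $ i $ a * matrix_inv (g x) $ j $ b * h x $ i $ j * k x $ a $ b)"


section \<open>Tensor fields and linear instability on a Riemannian manifold\<close>

text \<open>
  A manifold with carrier \<open>M\<close> is given by its maximal smooth atlas \<open>A\<close>.  A chart is recorded by
  its inverse: a pair \<open>(V, \<psi>)\<close> with \<open>V\<close> open in coordinate space and \<open>\<psi>\<close> a parametrisation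
  of an open subset of \<open>M\<close>, whose values outside \<open>V\<close> are irrelevant.  A 2-tensor field is
  the family of its coefficient matrices in all charts.
\<close>

type_synonym ('a, 'n) chart = "(real^'n) set \<times> (real^'n \<Rightarrow> 'a)"

type_synonym ('a, 'n) tensor2 = "('a, 'n) chart \<Rightarrow> 'n coeffs"

definition transition :: "('a, 'n::finite) chart \<Rightarrow> ('a, 'n) chart \<Rightarrow> real^'n \<Rightarrow> real^'n" where
  "transition c d x = inv_into (fst d) (snd d) (snd c x)"

definition smooth_sym_tensor2 :: "('a, 'n::finite) chart set \<Rightarrow> ('a, 'n) tensor2 \<Rightarrow> bool" where
  "smooth_sym_tensor2 A h \<longleftrightarrow>
     (\<forall>c\<in>A. smooth_on (fst c) (h c) \<and> (\<forall>x\<in>fst c. transpose (h c x) = h c x)) \<and>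
     (\<forall>c\<in>A. \<forall>d\<in>A. \<forall>x\<in>fst c. \<forall>y\<in>fst d. snd c x = snd d y \<longrightarrow>
        (\<forall>i j. h c x $ i $ j =
           (\<Sum>a\<in>UNIV. \<Sum>b\<in>UNIV. h d y $ a $ b * pd i (transition c d) x $ a * pd j (transition c d) x $ b)))"

definition einstein :: "('a, 'n::finite) chart set \<Rightarrow> ('a, 'n) tensor2 \<Rightarrow> real \<Rightarrow> bool" where
  "einstein A g E \<longleftrightarrow> (\<forall>c\<in>A. \<forall>x\<in>fst c. ricci (g c) x = E *\<^sub>R g c x)"

definition tt_tensor :: "('a, 'n::finite) chart set \<Rightarrow> ('a, 'n) tensor2 \<Rightarrow> ('a, 'n) tensor2 \<Rightarrow> bool" where
  "tt_tensor A g h \<longleftrightarrow> smooth_sym_tensor2 A h \<and>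
     (\<forall>c\<in>A. \<forall>x\<in>fst c. tr_metric (g c) (h c) x = 0 \<and> divergence (g c) (h c) x = 0)"

text \<open>The function on \<open>M\<close> whose coordinate expression in each chart \<open>c\<close> is \<open>f c\<close>.\<close>

definition glue :: "('a, 'n::finite) chart set \<Rightarrow> (('a, 'n) chart \<Rightarrow> real^'n \<Rightarrow> real) \<Rightarrow> 'a \<Rightarrow> real" where
  "glue A f p = (THE r. \<exists>c\<in>A. \<exists>x\<in>fst c. snd c x = p \<and> r = f c x)"

text \<open>These conditions determine \<open>\<mu>\<close> uniquely, since \<open>M\<close> is covered by countably many charts.\<close>

definition riemannian_measure ::
    "'a set \<Rightarrow> ('a, 'n::finite) chart set \<Rightarrow> ('a, 'n) tensor2 \<Rightarrow> 'a measure \<Rightarrow> bool" where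
  "riemannian_measure M A g \<mu> \<longleftrightarrow>
     space \<mu> = M \<and>
     sets \<mu> = sigma_sets M {snd c ` S | c S. c \<in> A \<and> S \<in> sets borel \<and> S \<subseteq> fst c} \<and>
     (\<forall>c\<in>A. \<forall>S\<in>sets borel. S \<subseteq> fst c \<longrightarrow>
        emeasure \<mu> (snd c ` S) = (\<integral>\<^sup>+x\<in>S. ennreal (sqrt (det (g c x))) \<partial>lborel))"

text \<open>For a compact Riemannian manifold \<open>(M, g)\<close> with maximal atlas \<open>A\<close>.  A negative Bochner
  integral is in particular the integral of an integrable function.\<close>

definition linearly_unstable ::
    "'a set \<Rightarrow> ('a, 'n::finite) chart set \<Rightarrow> ('a, 'n) tensor2 \<Rightarrow> bool" where
  "linearly_unstable M A g \<longleftrightarrow>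
     (\<exists>E. einstein A g E) \<and>
     (\<exists>\<mu> h. riemannian_measure M A g \<mu> \<and>
        tt_tensor A g h \<and> (\<exists>c\<in>A. \<exists>x\<in>fst c. h c x \<noteq> 0) \<and>
        (\<integral>p. glue A (\<lambda>c. inner_metric (g c)
                 (\<lambda>x. rough_laplacian (g c) (h c) x - 2 *\<^sub>R curv_action (g c) (h c) x) (h c)) p \<partial>\<mu>) < 0)"


section \<open>The irreducible embedding of SO(3) in SO(5)\<close>

text \<open>
  SO(3) acts by conjugation on the 5-dimensional space of traceless symmetric \<open>3 \<times> 3\<close> matrices.
  This is its irreducible 5-dimensional representation.  The matrices \<open>sym_basis a\<close> form an
  orthonormal basis for the invariant inner product \<open>tr(ST)\<close>, and \<open>so3_irr Q\<close> is
  the matrix of conjugation by \<open>Q\<close> in that basis.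
\<close>

definition sym_unit :: "'n::finite \<Rightarrow> 'n \<Rightarrow> real^'n^'n" where
  "sym_unit i j = (\<chi> a b. (if a = i \<and> b = j then 1 else 0) + (if a = j \<and> b = i then 1 else 0))"

definition sym_basis :: "5 \<Rightarrow> real^3^3" where
  "sym_basis a =
     (if a = 1 then (1 / sqrt 2) *\<^sub>R sym_unit 1 2
      else if a = 2 then (1 / sqrt 2) *\<^sub>R sym_unit 1 3
      else if a = 3 then (1 / sqrt 2) *\<^sub>R sym_unit 2 3
      else if a = 4 then (1 / (2 * sqrt 2)) *\<^sub>R (sym_unit 1 1 - sym_unit 2 2)
      else (1 / (2 * sqrt 6)) *\<^sub>R (sym_unit 1 1 + sym_unit 2 2 - 2 *\<^sub>R sym_unit 3 3))"

definition so3_irr :: "real^3^3 \<Rightarrow> real^5^5" where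
  "so3_irr Q = (\<chi> a b. trace (sym_basis a ** (Q ** sym_basis b ** transpose Q)))"

definition SO3_irr :: "(real^5^5) set" where
  "SO3_irr = so3_irr ` {Q. rotation_matrix Q}"


subsection \<open>The homomorphism is orthogonal and irreducible\<close>

lemma UNIV_5: "(UNIV :: 5 set) = {1, 2, 3, 4, 5}"
proof -
  have "card {1, 2, 3, 4, 5 :: 5} = CARD(5)" by simp
  then show ?thesis by (metis card_subset_eq finite subset_UNIV)
qed

lemma sum_5: "sum f (UNIV :: 5 set) = f 1 + f 2 + f 3 + f 4 + f 5"
  unfolding UNIV_5 by (simp add: add.assoc)

lemma forall_5: "(\<forall>a :: 5. P a) \<longleftrightarrow> P 1 \<and> P 2 \<and> P 3 \<and> P 4 \<and> P 5"
  using UNIV_5 by (metis UNIV_I empty_iff insert_iff)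

definition traceless_sym :: "real^3^3 \<Rightarrow> bool" where
  "traceless_sym M \<longleftrightarrow> transpose M = M \<and> trace M = 0"

definition sym_coords :: "real^3^3 \<Rightarrow> real^5" where
  "sym_coords M = (\<chi> a. trace (sym_basis a ** M))"

definition sym_of :: "real^5 \<Rightarrow> real^3^3" where
  "sym_of w = (\<Sum>a\<in>UNIV. w $ a *\<^sub>R sym_basis a)"

lemma traceless_sym_basis: "traceless_sym (sym_basis a)"
  by (auto simp: traceless_sym_def sym_basis_def sym_unit_def trace_def transpose_def
      vec_eq_iff sum_3 forall_3)

lemma sym_basis_orthonormal: "trace (sym_basis a ** sym_basis b) = (if a = b then 1 else 0)"
proof -
  have "\<forall>a b. trace (sym_basis a ** sym_basis b) = (if a = b then 1 else 0)"
    unfolding forall_5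
    by (simp add: sym_basis_def sym_unit_def trace_def matrix_matrix_mult_def sum_3)
  then show ?thesis by blast
qed

lemma sym_of_sym_coords:
  assumes "traceless_sym M"
  shows "sym_of (sym_coords M) = M"
proof -
  have M: "M $ 2 $ 1 = M $ 1 $ 2" "M $ 3 $ 1 = M $ 1 $ 3" "M $ 3 $ 2 = M $ 2 $ 3"
    "M $ 3 $ 3 = - M $ 1 $ 1 - M $ 2 $ 2"
    using assms by (auto simp: traceless_sym_def trace_def sum_3 transpose_def vec_eq_iff)
  define k l where "k = 1 / sqrt 2" and "l = 1 / sqrt 6"
  have kl: "k * (k * x) = x / 2" "l * (l * x) = x / 6" for x
    by (simp_all add: k_def l_def)
  have half: "1 / (2 * sqrt 2) = k / 2" "1 / (2 * sqrt 6) = l / 2"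
    by (simp_all add: k_def l_def)
  show ?thesis
    unfolding sym_of_def sym_coords_def sym_basis_def half k_def[symmetric]
    by (simp add: sym_unit_def trace_def matrix_matrix_mult_def sum_5 sum_3 vec_eq_iff forall_3 M)
      (simp add: kl algebra_simps)
qed

lemma matrix_mul_sum_right: "P ** (\<Sum>a\<in>UNIV. f a) = (\<Sum>a\<in>(UNIV::5 set). P ** f a)"
  for P :: "real^3^3"
  by (simp add: sum_5 matrix_add_ldistrib)

lemma matrix_mul_sum_left: "(\<Sum>a\<in>UNIV. f a) ** P = (\<Sum>a\<in>(UNIV::5 set). f a ** P)"
  for P :: "real^3^3"
  by (simp add: sum_5 matrix_matrix_mult_def vec_eq_iff distrib_right sum.distrib)

lemma trace_sum: "trace (\<Sum>a\<in>UNIV. f a) = (\<Sum>a\<in>(UNIV::5 set). trace (f a :: real^3^3))"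
  by (simp add: sum_5 trace_add)

lemma trace_scaleR: "trace (c *\<^sub>R (P :: real^3^3)) = c * trace P"
  by (simp add: trace_def sum_distrib_left)

lemma matrix_mul_scaleR: "(c *\<^sub>R P) ** Q = c *\<^sub>R (P ** Q)" "P ** (c *\<^sub>R Q) = c *\<^sub>R (P ** Q)"
  for P Q :: "real^3^3"
  by (simp_all add: matrix_matrix_mult_def vec_eq_iff sum_distrib_left mult_ac)

lemma sym_coords_sym_of: "sym_coords (sym_of w) = w"
  by (simp add: vec_eq_iff sym_coords_def sym_of_def matrix_mul_sum_right trace_sum
      trace_scaleR matrix_mul_scaleR sym_basis_orthonormal if_distrib cong: if_cong)

lemma so3_irr_mult_vec: "so3_irr Q *v w = sym_coords (Q ** sym_of w ** transpose Q)"
  by (simp add: vec_eq_iff so3_irr_def sym_coords_def sym_of_def matrix_vector_mult_def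
      matrix_mul_sum_right matrix_mul_sum_left trace_sum trace_scaleR matrix_mul_scaleR
      mult.commute)

lemma traceless_sym_of: "traceless_sym (sym_of w)"
  using traceless_sym_basis
  by (simp add: traceless_sym_def sym_of_def sum_5 trace_add trace_scaleR transpose_def vec_eq_iff)

lemma traceless_sym_conj:
  assumes "rotation_matrix Q" "traceless_sym M"
  shows "traceless_sym (Q ** M ** transpose Q)"
proof -
  have "trace (Q ** M ** transpose Q) = trace (transpose Q ** Q ** M)"
    by (metis trace_mul_sym matrix_mul_assoc)
  then show ?thesis
    using assms by (simp add: traceless_sym_def rotation_matrix_def orthogonal_matrix
        matrix_transpose_mul matrix_mul_assoc)
qed

lemma so3_irr_mult:
  assumes "rotation_matrix Q"
  shows "so3_irr (P ** Q) = so3_irr P ** so3_irr Q"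
proof -
  have "so3_irr (P ** Q) *v w = (so3_irr P ** so3_irr Q) *v w" for w
  proof -
    have "sym_of (so3_irr Q *v w) = Q ** sym_of w ** transpose Q"
      by (simp add: so3_irr_mult_vec sym_of_sym_coords traceless_sym_conj assms traceless_sym_of)
    then show ?thesis
      by (simp add: so3_irr_mult_vec[of P] so3_irr_mult_vec[of "P ** Q"] matrix_transpose_mul
          matrix_mul_assoc flip: matrix_vector_mul_assoc)
  qed
  then show ?thesis by (simp add: matrix_eq)
qed

lemma so3_irr_transpose: "so3_irr (transpose Q) = transpose (so3_irr Q)"
proof -
  have "trace (sym_basis a ** (transpose Q ** sym_basis b ** Q)) =
        trace (sym_basis b ** (Q ** sym_basis a ** transpose Q))" for a b
    using trace_mul_sym[of "sym_basis a ** transpose Q" "sym_basis b ** Q"]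
    by (simp add: matrix_mul_assoc)
  then show ?thesis
    by (simp add: so3_irr_def vec_eq_iff) (simp add: transpose_def)
qed

lemma so3_irr_mat_1: "so3_irr (mat 1) = mat 1"
  using so3_irr_mult_vec[of "mat 1"] by (simp add: matrix_eq sym_coords_sym_of)

lemma orthogonal_so3_irr: "rotation_matrix Q \<Longrightarrow> orthogonal_matrix (so3_irr Q)"
  by (simp add: orthogonal_matrix rotation_matrix_def so3_irr_mat_1
      flip: so3_irr_transpose so3_irr_mult)

lemma sym_coords_add: "sym_coords (M + N) = sym_coords M + sym_coords N"
  by (simp add: sym_coords_def vec_eq_iff matrix_add_ldistrib trace_add)

lemma sym_coords_scaleR: "sym_coords (c *\<^sub>R M) = c *\<^sub>R sym_coords M"
  by (simp add: sym_coords_def vec_eq_iff trace_scaleR matrix_mul_scaleR)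

lemma traceless_sym_add: "traceless_sym M \<Longrightarrow> traceless_sym N \<Longrightarrow> traceless_sym (M + N)"
  by (simp add: traceless_sym_def trace_add transpose_def vec_eq_iff)

lemma traceless_sym_scaleR: "traceless_sym M \<Longrightarrow> traceless_sym (c *\<^sub>R M)"
  by (simp add: traceless_sym_def trace_scaleR transpose_def vec_eq_iff)

definition mx :: "real \<Rightarrow> real \<Rightarrow> real \<Rightarrow> real \<Rightarrow> real \<Rightarrow> real \<Rightarrow> real \<Rightarrow> real \<Rightarrow> real \<Rightarrow> real^3^3" where
  "mx a b c d e f g h i = vector [vector [a, b, c], vector [d, e, f], vector [g, h, i]]"

lemma mx_eq: "mx a b c d e f g h i = mx a' b' c' d' e' f' g' h' i' \<longleftrightarrow>
    a = a' \<and> b = b' \<and> c = c' \<and> d = d' \<and> e = e' \<and> f = f' \<and> g = g' \<and> h = h' \<and> i = i'"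
  by (simp add: mx_def vec_eq_iff forall_3)

lemma mx_add: "mx a b c d e f g h i + mx a' b' c' d' e' f' g' h' i' =
    mx (a+a') (b+b') (c+c') (d+d') (e+e') (f+f') (g+g') (h+h') (i+i')"
  by (simp add: mx_def vec_eq_iff forall_3)

lemma mx_scale: "r *\<^sub>R mx a b c d e f g h i =
    mx (r*a) (r*b) (r*c) (r*d) (r*e) (r*f) (r*g) (r*h) (r*i)"
  by (simp add: mx_def vec_eq_iff forall_3)

lemma mx_all: "M = mx (M$1$1) (M$1$2) (M$1$3) (M$2$1) (M$2$2) (M$2$3) (M$3$1) (M$3$2) (M$3$3)"
  by (simp add: mx_def vec_eq_iff forall_3)

lemma mx_mult: "mx a b c d e f g h i ** mx a' b' c' d' e' f' g' h' i' =
    mx (a*a'+b*d'+c*g') (a*b'+b*e'+c*h') (a*c'+b*f'+c*i')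
       (d*a'+e*d'+f*g') (d*b'+e*e'+f*h') (d*c'+e*f'+f*i')
       (g*a'+h*d'+i*g') (g*b'+h*e'+i*h') (g*c'+h*f'+i*i')"
  by (simp add: mx_def matrix_matrix_mult_def vec_eq_iff sum_3 forall_3)

lemma mx_transpose: "transpose (mx a b c d e f g h i) = mx a d g b e h c f i"
  by (simp add: mx_def transpose_def vec_eq_iff forall_3)

lemma mx_mat_1: "mat 1 = mx 1 0 0 0 1 0 0 0 1"
  by (simp add: mx_def mat_def vec_eq_iff forall_3)

lemma mx_rotation: "rotation_matrix (mx a b c d e f g h i) \<longleftrightarrow>
    mx a d g b e h c f i ** mx a b c d e f g h i = mx 1 0 0 0 1 0 0 0 1 \<and>
    a * e * i + b * f * g + c * d * h - a * f * h - b * d * i - c * e * g = 1"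
  unfolding rotation_matrix_def orthogonal_matrix mx_transpose mx_mat_1 by (simp add: mx_def det_3)

lemma sym_basis_mx:
  "sym_basis 1 = (1 / sqrt 2) *\<^sub>R mx 0 1 0 1 0 0 0 0 0"
  "sym_basis 2 = (1 / sqrt 2) *\<^sub>R mx 0 0 1 0 0 0 1 0 0"
  "sym_basis 3 = (1 / sqrt 2) *\<^sub>R mx 0 0 0 0 0 1 0 1 0"
  "sym_basis 4 = (1 / sqrt 2) *\<^sub>R mx 1 0 0 0 (-1) 0 0 0 0"
  "sym_basis 5 = (1 / sqrt 6) *\<^sub>R (mx 1 0 0 0 (-1) 0 0 0 0 + 2 *\<^sub>R mx 0 0 0 0 1 0 0 0 (-1))"
  by (simp_all add: sym_basis_def sym_unit_def mx_def vec_eq_iff forall_3)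

lemma sym_zero_quadratic:
  fixes M :: "real^'n^'n"
  assumes "transpose M = M" and *: "\<And>x. x \<bullet> (M *v x) = 0"
  shows "M = 0"
proof -
  have "x \<bullet> (M *v y) = 0" for x y
  proof -
    have "(x + y) \<bullet> (M *v (x + y)) = x \<bullet> (M *v x) + y \<bullet> (M *v y) + x \<bullet> (M *v y) + y \<bullet> (M *v x)"
      by (simp add: matrix_vector_right_distrib inner_add)
    moreover have "y \<bullet> (M *v x) = x \<bullet> (M *v y)"
      using assms(1) dot_lmul_matrix[of y M x] vector_transpose_matrix[of y M]
      by (simp add: inner_commute)
    ultimately show ?thesis using * by simp
  qed
  then have "M *v y = 0" for y using inner_eq_zero_iff by blast
  then show ?thesis by (simp add: matrix_eq)
qed

lemma conj_entry:
  fixes P M :: "real^3^3"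
  shows "(transpose P ** M ** P) $ k $ k = (P *v axis k 1) \<bullet> (M *v (P *v axis k 1))"
proof -
  have "(P *v axis k 1) \<bullet> (M *v (P *v axis k 1)) = axis k 1 \<bullet> ((transpose P ** M ** P) *v axis k 1)"
    using dot_lmul_matrix[of "axis k 1" "transpose P" "M *v (P *v axis k 1)"]
    by (simp add: matrix_vector_mul_assoc matrix_mul_assoc del: dot_lmul_matrix)
  then show ?thesis
    by (simp add: inner_axis' matrix_vector_mult_basis column_def)
qed

lemma so3_irr_irreducible:
  assumes W: "subspace W" "W \<noteq> {0}"
    and W_invariant: "\<And>Q w. rotation_matrix Q \<Longrightarrow> w \<in> W \<Longrightarrow> so3_irr Q *v w \<in> W"
  shows "W = UNIV"
proof -
  define In where "In M \<longleftrightarrow> traceless_sym M \<and> sym_coords M \<in> W" for M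
  have In_add: "In (M + N)" if "In M" "In N" for M N
    using that W(1) by (simp add: In_def traceless_sym_add sym_coords_add subspace_add)
  have In_scale: "In (c *\<^sub>R M)" if "In M" for c M
    using that W(1) by (simp add: In_def traceless_sym_scaleR sym_coords_scaleR subspace_scale)
  have In_conj: "In (Q ** M ** transpose Q)" if "In M" "rotation_matrix Q" for Q M
  proof -
    have "so3_irr Q *v sym_coords M = sym_coords (Q ** M ** transpose Q)"
      using that by (simp add: so3_irr_mult_vec sym_of_sym_coords In_def)
    then show ?thesis using that W_invariant[of Q "sym_coords M"] by (simp add: In_def traceless_sym_conj)
  qed
  note conj = In_conj[of "mx _ _ _ _ _ _ _ _ _" "mx _ _ _ _ _ _ _ _ _",
      unfolded mx_rotation mx_mult mx_transpose mx_eq]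

  text \<open>A nonzero invariant subspace contains a matrix with nonzero upper left entry.\<close>
  obtain w where w: "w \<in> W" "w \<noteq> 0" using W subspace_0 by blast
  define M where "M = sym_of w"
  have M: "In M" using w by (simp add: In_def M_def traceless_sym_of sym_coords_sym_of)
  have "M \<noteq> 0"
    using w(2) sym_coords_sym_of[of w] sym_coords_scaleR[of 0 0] by (auto simp: M_def)
  then obtain x where x: "x \<bullet> (M *v x) \<noteq> 0"
    using sym_zero_quadratic[of M] M by (auto simp: In_def traceless_sym_def)
  define u where "u = x /\<^sub>R norm x"
  have "x \<noteq> 0" using x by auto
  then have u: "norm u = 1" "u \<bullet> (M *v u) \<noteq> 0"
    using x by (simp_all add: u_def matrix_vector_mult_scaleR)
  obtain P :: "real^3^3" where P: "rotation_matrix P" "P *v axis 1 1 = u"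
    using rotation_matrix_exists_basis[of u 1] u(1) by auto
  define N where "N = transpose P ** M ** P"
  have "rotation_matrix (transpose P)"
    using P(1) by (simp add: rotation_matrix_def orthogonal_matrix_transpose)
  then have N: "In N" using In_conj[OF M, of "transpose P"] by (simp add: N_def)
  have N11: "N $ 1 $ 1 \<noteq> 0" using u(2) by (simp add: N_def conj_entry P(2))

  text \<open>Averaging over the diagonal rotations yields a nonzero diagonal matrix.\<close>
  define a b c where "a = N $ 1 $ 1" and "b = N $ 2 $ 2" and "c = N $ 3 $ 3"
  obtain p q r s t v where N_eq: "N = mx a p q r b s t v c"
    using mx_all[of N] unfolding a_def b_def c_def by blast
  have abc: "a + b + c = 0"
    using N by (simp add: In_def traceless_sym_def trace_def sum_3 a_def b_def c_def)
  have N': "In (mx a p q r b s t v c)" using N N_eq by simp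
  have "In (mx a (-p) (-q) (-r) b s (-t) v c)"
    using conj[OF N', of 1 0 0 0 "-1" 0 0 0 "-1"] by simp
  from In_add[OF N' this] have N'': "In (mx (2*a) 0 0 0 (2*b) (2 * s) 0 (2 * v) (2*c))"
    by (simp add: mx_add)
  have "In (mx (2*a) 0 0 0 (2*b) (-2 * s) 0 (-2 * v) (2*c))"
    using conj[OF N'', of "-1" 0 0 0 1 0 0 0 "-1"] by simp
  from In_scale[OF In_add[OF N'' this], of "1/4"] have D: "In (mx a 0 0 0 b 0 0 0 c)"
    by (simp add: mx_add mx_scale)

  text \<open>Differences of permuted diagonal matrices yield \<open>diag(1, -1, 0)\<close>, and a rotation
    by 45 degrees then yields the off-diagonal basis matrices.\<close>
  have cyc: "In (mx i g h c a b f d e)" if "In (mx a b c d e f g h i)" for a b c d e f g h i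
    using conj[OF that, of 0 1 0 0 0 1 1 0 0] by simp
  have diff: "In (mx (x - y) 0 0 0 (y - x) 0 0 0 0)" if D': "In (mx x 0 0 0 y 0 0 0 z)" for x y z
  proof -
    have "In (mx y 0 0 0 x 0 0 0 z)"
      using conj[OF D', of 0 1 0 "-1" 0 0 0 0 1] by simp
    from In_add[OF D' In_scale[OF this, of "-1"]] show ?thesis by (simp add: mx_add mx_scale)
  qed
  have unit: "In (mx 1 0 0 0 (-1) 0 0 0 0)" if "In (mx x 0 0 0 y 0 0 0 z)" "x \<noteq> y" for x y z
  proof -
    have "(y - x) / (x - y) = -1" using that(2) by (simp add: divide_simps)
    then show ?thesis
      using In_scale[OF diff[OF that(1)], of "1 / (x - y)"] that(2) by (simp add: mx_scale)
  qed
  have E1: "In (mx 1 0 0 0 (-1) 0 0 0 0)"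
  proof (cases "a = b")
    case False then show ?thesis using unit D by blast
  next
    case True
    then have "c \<noteq> a" using abc N11 by (auto simp: a_def)
    then show ?thesis using unit cyc[OF D] by blast
  qed
  have E2: "In (mx 0 0 0 0 1 0 0 0 (-1))" using cyc[OF E1] by simp
  define k where "k = 1 / sqrt 2"
  have k: "k * k = 1 / 2" by (simp add: k_def)
  have O1: "In (mx 0 1 0 1 0 0 0 0 0)"
    using conj[OF E1, of k k 0 "-k" k 0 0 0 1] by (simp add: k)
  have O2: "In (mx 0 0 0 0 0 1 0 1 0)" using cyc[OF O1] by simp
  have O3: "In (mx 0 0 1 0 0 0 1 0 0)" using cyc[OF O2] by simp
  have "\<forall>i. In (sym_basis i)"
    unfolding forall_5 sym_basis_mx by (intro conjI In_scale In_add E1 E2 O1 O2 O3)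
  then have "In (sym_of v)" for v
    unfolding sym_of_def sum_5 by (intro In_add In_scale) auto
  then have "z \<in> W" for z by (metis In_def sym_coords_sym_of)
  then show ?thesis by blast
qed


section \<open>The Berger space as a smooth manifold with its Einstein metric\<close>

definition SO5 :: "(real^5^5) set" where
  "SO5 = {P. rotation_matrix P}"

definition left_coset :: "real^5^5 \<Rightarrow> (real^5^5) set" where
  "left_coset P = (\<lambda>Q. P ** Q) ` SO3_irr"

definition berger_space :: "(real^5^5) set set" where
  "berger_space = left_coset ` SO5"

definition so5 :: "(real^5^5) set" where
  "so5 = {X. transpose X = - X}"

text \<open>The Lie algebra of the subgroup \<open>SO3_irr\<close>, as the tangent space at the identity.\<close>

definition so3_irr_alg :: "(real^5^5) set" where
  "so3_irr_alg = {X. \<exists>\<gamma>. (\<forall>t. \<gamma> t \<in> SO3_irr) \<and> \<gamma> 0 = mat 1 \<and>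
                    (\<gamma> has_vector_derivative X) (at (0::real))}"

definition bracket :: "real^5^5 \<Rightarrow> real^5^5 \<Rightarrow> real^5^5" where
  "bracket X Y = X ** Y - Y ** X"

text \<open>
  The trace of \<open>ad X \<circ> ad Y\<close> on \<open>so5\<close>.  The matrices \<open>skew_unit a b\<close> with \<open>a < b\<close> form a
  basis, with respect to which \<open>Z\<close> has the coordinates \<open>Z $ a $ b\<close>; summing over all pairs
  \<open>a, b\<close> counts each basis vector twice.
\<close>

definition skew_unit :: "5 \<Rightarrow> 5 \<Rightarrow> real^5^5" where
  "skew_unit a b = (\<chi> i j. (if i = a \<and> j = b then 1 else 0) - (if i = b \<and> j = a then 1 else 0))"

definition killing :: "real^5^5 \<Rightarrow> real^5^5 \<Rightarrow> real" where
  "killing X Y = (\<Sum>a\<in>UNIV. \<Sum>b\<in>UNIV. bracket X (bracket Y (skew_unit a b)) $ a $ b) / 2"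

definition compl_m :: "(real^5^5) set" where
  "compl_m = {X \<in> so5. \<forall>Y\<in>so3_irr_alg. killing X Y = 0}"

definition proj_m :: "real^5^5 \<Rightarrow> real^5^5" where
  "proj_m X = (THE Y. Y \<in> compl_m \<and> X - Y \<in> so3_irr_alg)"

text \<open>A smooth map \<open>\<psi>\<close> into the quotient is one that lifts locally to a smooth map into SO(5).\<close>

definition local_lift :: "((real^5^5) set, 7) chart \<Rightarrow> real^7 \<Rightarrow> (real^7 \<Rightarrow> real^5^5) \<Rightarrow> bool" where
  "local_lift c x \<sigma> \<longleftrightarrow>
     (\<exists>W. open W \<and> x \<in> W \<and> W \<subseteq> fst c \<and> smooth_on W \<sigma> \<and>
        (\<forall>y\<in>W. \<sigma> y \<in> SO5 \<and> left_coset (\<sigma> y) = snd c y))"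

text \<open>The tangent space at the coset of \<open>P\<close> is identified with \<open>compl_m\<close> by the differential
  of \<open>X \<mapsto> P exp(X)\<close> modulo SO(3).  Under this identification, the vector
  \<open>tangent_m \<sigma> x v\<close> is the image of \<open>v\<close> under the differential at \<open>x\<close> of the map
  that \<open>\<sigma>\<close> lifts.\<close>

definition tangent_m :: "(real^7 \<Rightarrow> real^5^5) \<Rightarrow> real^7 \<Rightarrow> real^7 \<Rightarrow> real^5^5" where
  "tangent_m \<sigma> x v = proj_m (transpose (\<sigma> x) ** frechet_derivative \<sigma> (at x) v)"

text \<open>The maximal atlas: injective smooth immersions of open subsets of 7-dimensional coordinate
  space into the 7-dimensional quotient.\<close>

definition berger_atlas :: "((real^5^5) set, 7) chart set" where
  "berger_atlas =
     {c. open (fst c) \<and> inj_on (snd c) (fst c) \<and>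
         (\<forall>x\<in>fst c. \<exists>\<sigma>. local_lift c x \<sigma> \<and> inj (tangent_m \<sigma> x))}"

text \<open>The SO(5)-invariant metric induced by minus the Killing form.  It does not depend on the
  choice of the lift, because the Killing form is invariant under conjugation by SO(3).\<close>

definition berger_metric :: "((real^5^5) set, 7) tensor2" where
  "berger_metric c x =
     (let \<sigma> = SOME \<sigma>. local_lift c x \<sigma>
      in \<chi> i j. - killing (tangent_m \<sigma> x (axis i 1)) (tangent_m \<sigma> x (axis j 1)))"

end

theory Submission
  imports Defs
begin

text \<open>
  The destabilizing directions come from the 5-dimensional representation: an SO(3)-equivariant
  map \<open>H\<close> from \<open>R\<^sup>5\<close> to the traceless symmetric 2-tensors on \<open>m\<close> turns every vector \<open>u\<close> into the
  tensor field on the quotient that is \<open>H (P\<^sup>T u)\<close> at the coset of \<open>P\<close>.  For the metric \<open>s\<close> times the one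
  induced by minus the Killing form, this field is divergence-free, \<open>\<nabla>\<^sup>*\<nabla> - 2 R\<close> acts on it as the scalar
  \<open>- 4 / (15 s)\<close>, and its pointwise norm is constant.  The curvature computations are carried out in an
  orthogonal frame of \<open>m\<close> pulled back along a local lift to SO(5), where the Levi-Civita connection has the
  constant coefficients of an algebraic map on the Lie algebra.

  Independence of the lift comes from the orbit of the invariant cubic form, which embeds the quotient
  into a Euclidean space; the metric and the tensor field are algebraic in the first derivatives of this
  embedding.
\<close>

section \<open>Matrix algebra\<close>

text \<open>Let V_k be the irreducible SO(3)-representation of dimension 2k+1. Then m = V_3 and R^5
  = V_2, and Sym^2 m = V_0 + V_2 + V_4 + V_6 contains V_2 exactly once. So \<open>H\<close> is
  unique up to scale and invariant operators on symmetric 2-tensors act on the fields by scalars;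
  trace and divergence vanish because V_2 has no nonzero equivariant map to V_0 or V_3. Only the
  scalars carry information: for s = 1 the rough Laplacian gives 19/60 and the curvature action
  7/24, and 19/60 - 2 * 7/24 < 0. All of this is verified by explicit matrices in a weight basis of
  m. The analytic obstacle is that the atlas is maximal and the metric is defined by an arbitrarily
  chosen lift, so the tensors have to be controlled in charts known only to lift locally. The cubic
  form helps because its stabilizer in so(5) is exactly so(3), and because R^5 tensor R^5 = V_0 +
  ... + V_4 contains m once: contracting the derivative of the orbit map with the orbit map returns
  the m-part of a tangent vector. Instability also asks for a measure that is correct in every
  chart; it is glued from finitely many translated charts.\<close>

lemma bounded_bilinear_matrix_mult:
  "bounded_bilinear ((**) :: real^'n^'m \<Rightarrow> real^'p^'n \<Rightarrow> real^'p^'m)"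
  by (intro bilinear_conv_bounded_bilinear[THEN iffD1])
    (auto simp: bilinear_def linear_iff matrix_matrix_mult_def vec_eq_iff algebra_simps
      sum.distrib sum_distrib_left)

lemma bounded_bilinear_matrix_vector_mult:
  "bounded_bilinear ((*v) :: real^'n^'m \<Rightarrow> real^'n \<Rightarrow> real^'m)"
  by (intro bilinear_conv_bounded_bilinear[THEN iffD1])
    (auto simp: bilinear_def linear_iff matrix_vector_mult_def vec_eq_iff algebra_simps
      sum.distrib sum_distrib_left)

interpretation matmul: bounded_bilinear "(**) :: real^'n^'m \<Rightarrow> real^'p^'n \<Rightarrow> real^'p^'m"
  by (rule bounded_bilinear_matrix_mult)

interpretation matvec: bounded_bilinear "(*v) :: real^'n^'m \<Rightarrow> real^'n \<Rightarrow> real^'m"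
  by (rule bounded_bilinear_matrix_vector_mult)

lemma bounded_linear_transpose: "bounded_linear (transpose :: real^'n^'m \<Rightarrow> real^'m^'n)"
  by (intro linear_conv_bounded_linear[THEN iffD1])
    (auto simp: linear_iff transpose_def vec_eq_iff)

lemma transpose_add: "transpose (A + B) = transpose A + transpose (B :: real^'n^'m)"
  and transpose_diff: "transpose (A - B) = transpose A - transpose (B :: real^'n^'m)"
  and transpose_minus: "transpose (- A) = - transpose (A :: real^'n^'m)"
  and transpose_scaleR: "transpose (c *\<^sub>R A) = c *\<^sub>R transpose (A :: real^'n^'m)"
  and transpose_zero: "transpose 0 = (0 :: real^'m^'n)"
  by (simp_all add: transpose_def vec_eq_iff)

lemma transpose_sum: "transpose (\<Sum>i\<in>I. f i) = (\<Sum>i\<in>I. transpose (f i :: real^'n^'m))"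
  by (simp add: transpose_def vec_eq_iff)

lemmas transpose_simps = transpose_add transpose_diff transpose_minus transpose_scaleR transpose_zero

lemmas matmul_simps = matmul.add_left matmul.add_right matmul.diff_left matmul.diff_right
  matmul.minus_left matmul.minus_right matmul.scaleR_left matmul.scaleR_right
  matmul.zero_left matmul.zero_right

lemma inner_matrix: "(A :: real^'n^'m) \<bullet> B = (\<Sum>i\<in>UNIV. \<Sum>j\<in>UNIV. A $ i $ j * B $ i $ j)"
  by (simp add: inner_vec_def)

lemma inner_transpose: "transpose (A :: real^'n^'m) \<bullet> transpose B = A \<bullet> B"
  unfolding inner_matrix by (subst sum.swap) (simp add: transpose_def)

lemma inner_matmul_left: "((X :: real^'n^'m) ** A) \<bullet> B = A \<bullet> (transpose X ** B)"
proof -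
  have "(X ** A) \<bullet> B = (\<Sum>i\<in>UNIV. \<Sum>j\<in>UNIV. \<Sum>k\<in>UNIV. X$i$k * A$k$j * B$i$j)"
    by (simp add: inner_matrix matrix_matrix_mult_def sum_distrib_right)
  also have "\<dots> = (\<Sum>j\<in>UNIV. \<Sum>k\<in>UNIV. \<Sum>i\<in>UNIV. X$i$k * A$k$j * B$i$j)"
    by (subst sum.swap, intro sum.cong refl sum.swap)
  also have "\<dots> = (\<Sum>k\<in>UNIV. \<Sum>j\<in>UNIV. \<Sum>i\<in>UNIV. X$i$k * A$k$j * B$i$j)"
    by (rule sum.swap)
  also have "\<dots> = A \<bullet> (transpose X ** B)"
    by (simp add: inner_matrix matrix_matrix_mult_def transpose_def sum_distrib_left mult_ac)
  finally show ?thesis .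
qed

lemma inner_matmul_right: "((A :: real^'n^'m) ** X) \<bullet> B = A \<bullet> (B ** transpose X)"
proof -
  have "(A ** X) \<bullet> B = (transpose X ** transpose A) \<bullet> transpose B"
    by (simp flip: inner_transpose[of "A ** X" B] add: matrix_transpose_mul)
  also have "\<dots> = A \<bullet> (B ** transpose X)"
    by (simp flip: inner_transpose[of A "B ** transpose X"] add: inner_matmul_left matrix_transpose_mul)
  finally show ?thesis .
qed

section \<open>Partial derivatives and smoothness\<close>

lemma pd_eqI: "(f has_derivative f') (at x) \<Longrightarrow> pd i f x = f' (axis i 1)"
  by (simp add: pd_def frechet_derivative_at[symmetric])

lemma frechet_derivative_eq_pd:
  fixes f :: "real^'n::finite \<Rightarrow> 'b::real_normed_vector"
  assumes "f differentiable (at x)"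
  shows "frechet_derivative f (at x) v = (\<Sum>i\<in>UNIV. v $ i *\<^sub>R pd i f x)"
proof -
  interpret bounded_linear "frechet_derivative f (at x)"
    using assms frechet_derivative_works has_derivative_bounded_linear by blast
  have "v = (\<Sum>i\<in>UNIV. v $ i *\<^sub>R axis i 1)"
    using basis_expansion[of v] by (simp add: scalar_mult_eq_scaleR)
  then have "frechet_derivative f (at x) v = frechet_derivative f (at x) (\<Sum>i\<in>UNIV. v $ i *\<^sub>R axis i 1)"
    by simp
  then show ?thesis by (simp add: sum scaleR pd_def)
qed

lemma has_derivative_pd:
  fixes f :: "real^'n::finite \<Rightarrow> 'b::real_normed_vector"
  assumes "f differentiable (at x)"
  shows "(f has_derivative (\<lambda>v. \<Sum>i\<in>UNIV. v $ i *\<^sub>R pd i f x)) (at x)"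
proof -
  have "frechet_derivative f (at x) = (\<lambda>v. \<Sum>i\<in>UNIV. v $ i *\<^sub>R pd i f x)"
    using frechet_derivative_eq_pd[OF assms] by blast
  then show ?thesis using assms by (metis frechet_derivative_works)
qed

text \<open>\<open>frechet_derivative\<close> is a choice among all derivatives, so it depends only
  on which maps are derivatives. The equality therefore holds even where the functions are not
  differentiable.\<close>

lemma pd_cong:
  assumes "open U" "x \<in> U" "\<And>y. y \<in> U \<Longrightarrow> f y = g y"
  shows "pd i f x = pd i g x"
proof -
  have "(f has_derivative D) (at x) \<longleftrightarrow> (g has_derivative D) (at x)" for D
    using assms has_derivative_transform_within_open[of _ D x UNIV U] by metis
  then show ?thesis by (simp add: pd_def frechet_derivative_def)
qed

lemma differentiable_cong_open:
  assumes "open U" "x \<in> U" "\<And>y. y \<in> U \<Longrightarrow> f y = g y"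
  shows "f differentiable (at x) \<longleftrightarrow> g differentiable (at x)"
  using assms has_derivative_transform_within_open[of _ _ x UNIV U]
  unfolding differentiable_def by metis

lemma pd_const [simp]: "pd i (\<lambda>x. c) x = 0"
  by (rule pd_eqI) simp

lemma pd_bounded_linear:
  assumes "bounded_linear L" "f differentiable (at x)"
  shows "pd i (\<lambda>x. L (f x)) x = L (pd i f x)"
  using pd_eqI[OF bounded_linear.has_derivative[OF assms(1) frechet_derivative_works[THEN iffD1, OF assms(2)]]]
  by (simp add: pd_def)

lemma pd_add:
  assumes "f differentiable (at x)" "g differentiable (at x)"
  shows "pd i (\<lambda>x. f x + g x) x = pd i f x + pd i g x"
  using pd_eqI[OF has_derivative_add[OF assms[unfolded frechet_derivative_works]]]
  by (simp add: pd_def)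

lemma pd_sum:
  assumes "finite A" "\<And>a. a \<in> A \<Longrightarrow> f a differentiable (at x)"
  shows "pd i (\<lambda>x. \<Sum>a\<in>A. f a x) x = (\<Sum>a\<in>A. pd i (f a) x)"
proof -
  have "((\<lambda>x. \<Sum>a\<in>A. f a x) has_derivative (\<lambda>v. \<Sum>a\<in>A. frechet_derivative (f a) (at x) v)) (at x)"
    using assms by (intro has_derivative_sum) (auto simp: frechet_derivative_works)
  then show ?thesis by (simp add: pd_eqI) (simp add: pd_def)
qed

lemma pd_bilinear:
  assumes "bounded_bilinear b" "f differentiable (at x)" "g differentiable (at x)"
  shows "pd i (\<lambda>x. b (f x) (g x)) x = b (f x) (pd i g x) + b (pd i f x) (g x)"
  using pd_eqI[OF bounded_bilinear.FDERIV[OF assms(1) assms(2,3)[unfolded frechet_derivative_works]]]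
  by (simp add: pd_def)

lemma differentiable_bilinear:
  assumes "bounded_bilinear b" "f differentiable (at x)" "g differentiable (at x)"
  shows "(\<lambda>x. b (f x) (g x)) differentiable (at x)"
  using bounded_bilinear.FDERIV[OF assms(1) assms(2,3)[unfolded frechet_derivative_works]]
  by (auto simp: differentiable_def)

lemma differentiable_bounded_linear:
  assumes "bounded_linear L" "f differentiable (at x)"
  shows "(\<lambda>x. L (f x)) differentiable (at x)"
  using bounded_linear.has_derivative[OF assms(1) frechet_derivative_works[THEN iffD1, OF assms(2)]]
  by (auto simp: differentiable_def)

lemma pd_vec_nth: "f differentiable (at x) \<Longrightarrow> pd i (\<lambda>y. f y $ a) x = pd i f x $ a"
  by (rule pd_bounded_linear[OF bounded_linear_vec_nth])

lemma differentiable_vec_nth: "f differentiable (at x) \<Longrightarrow> (\<lambda>y. f y $ a) differentiable (at x)"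
  by (rule differentiable_bounded_linear[OF bounded_linear_vec_nth])

lemma pd_matrix_nth:
  "f differentiable (at x) \<Longrightarrow> pd i (\<lambda>y. f y $ a $ b) x = pd i f x $ a $ b"
  by (simp add: pd_vec_nth differentiable_vec_nth)

lemmas pd_matmul = pd_bilinear[OF bounded_bilinear_matrix_mult]
lemmas differentiable_matmul = differentiable_bilinear[OF bounded_bilinear_matrix_mult]

lemma bounded_linear_axis: "bounded_linear (axis i :: 'b::real_normed_vector \<Rightarrow> 'b^'n)"
  by (intro bounded_linear_intro[of _ 1])
    (auto simp: axis_def vec_eq_iff norm_vec_def L2_set_def if_distrib[of norm] if_distrib[of "\<lambda>x. x^2"] cong: if_cong)

lemma vec_eq_sum_axis: "v = (\<Sum>i\<in>UNIV. axis i (v $ i))"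
  by (simp add: vec_eq_iff axis_def sum_component if_distrib if_distribR cong: if_cong)

lemma differentiable_componentwise_vec:
  fixes f :: "real^'n::finite \<Rightarrow> 'b::real_normed_vector^'m"
  assumes "\<And>i. (\<lambda>x. f x $ i) differentiable (at x)"
  shows "f differentiable (at x)"
proof -
  have "(\<lambda>x. \<Sum>i\<in>UNIV. axis i (f x $ i)) differentiable (at x)"
    using assms by (intro differentiable_sum ballI differentiable_bounded_linear[OF bounded_linear_axis]) auto
  then show ?thesis by (simp flip: vec_eq_sum_axis)
qed

lemma Ck_on_cong:
  assumes "open U" "\<And>x. x \<in> U \<Longrightarrow> f x = g x" "Ck_on k U f"
  shows "Ck_on k U g"
  using assms(2,3)
proof (induction k arbitrary: f g)
  case 0
  then show ?case by (simp cong: continuous_on_cong)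
next
  case (Suc k)
  have "pd i f x = pd i g x" if "x \<in> U" for i x
    using pd_cong[OF assms(1) that] Suc.prems by auto
  moreover have "g differentiable (at x)" if "x \<in> U" for x
    using Suc.prems that differentiable_cong_open[OF assms(1) that, of f g] by simp
  ultimately show ?case
    using Suc.prems(2) by (simp del: split_paired_All) (blast intro: Suc.IH)
qed

lemma Ck_on_subset: "Ck_on k U f \<Longrightarrow> V \<subseteq> U \<Longrightarrow> Ck_on k V f"
  by (induction k arbitrary: f) (auto intro: continuous_on_subset)

lemma Ck_on_local:
  assumes "\<And>x. x \<in> U \<Longrightarrow> \<exists>W. open W \<and> x \<in> W \<and> Ck_on k W f"
  shows "Ck_on k U f"
  using assms
proof (induction k arbitrary: f)
  case 0
  then show ?case
    by (metis Ck_on.simps(1) continuous_at_imp_continuous_on continuous_on_eq_continuous_at)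
next
  case (Suc k)
  then show ?case by (simp only: Ck_on.simps) (metis (no_types, lifting) Suc.IH)
qed

lemma differentiable_imp_continuous_on_at:
  "(\<And>x. x \<in> U \<Longrightarrow> f differentiable (at x)) \<Longrightarrow> continuous_on U f"
  by (auto intro!: continuous_at_imp_continuous_on differentiable_imp_continuous_within)

lemma Ck_on_SucD: "Ck_on (Suc k) U f \<Longrightarrow> Ck_on k U f"
  by (induction k arbitrary: f) (auto intro: differentiable_imp_continuous_on_at)

lemma Ck_on_const: "Ck_on k U (\<lambda>x. c)"
proof (induction k arbitrary: c)
  case (Suc k)
  have "pd i (\<lambda>x::real^'a. c) = (\<lambda>x. 0)" for i by auto
  then show ?case using Suc by simp
qed simp

lemma Ck_on_bounded_linear:
  assumes "open U" "bounded_linear L" "Ck_on k U f"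
  shows "Ck_on k U (\<lambda>x. L (f x))"
  using assms(3)
proof (induction k arbitrary: f)
  case 0
  then show ?case using assms(2) by (auto intro: bounded_linear.continuous_on)
next
  case (Suc k)
  have d: "f differentiable (at x)" if "x \<in> U" for x using Suc.prems that by simp
  have "Ck_on k U (\<lambda>x. L (pd i f x))" for i using Suc by simp
  then have "Ck_on k U (pd i (\<lambda>x. L (f x)))" for i
    by (rule Ck_on_cong[OF assms(1), rotated]) (simp add: d pd_bounded_linear[OF assms(2)])
  then show ?case using d by (simp add: differentiable_bounded_linear[OF assms(2)])
qed

lemma Ck_on_add:
  assumes "open U" "Ck_on k U f" "Ck_on k U g"
  shows "Ck_on k U (\<lambda>x. f x + g x)"
  using assms(2,3)
proof (induction k arbitrary: f g)
  case 0
  then show ?case by (auto intro: continuous_on_add)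
next
  case (Suc k)
  have d: "f differentiable (at x)" "g differentiable (at x)" if "x \<in> U" for x
    using Suc.prems that by simp_all
  have "Ck_on k U (\<lambda>x. pd i f x + pd i g x)" for i using Suc by simp
  then have "Ck_on k U (pd i (\<lambda>x. f x + g x))" for i
    by (rule Ck_on_cong[OF assms(1), rotated]) (simp add: d pd_add)
  then show ?case using d by simp
qed

lemma Ck_on_bilinear:
  assumes "open U" "bounded_bilinear b" "Ck_on k U f" "Ck_on k U g"
  shows "Ck_on k U (\<lambda>x. b (f x) (g x))"
  using assms(3,4)
proof (induction k arbitrary: f g)
  case 0
  then show ?case using assms(2) by (auto intro: bounded_bilinear.continuous_on)
next
  case (Suc k)
  have "Ck_on k U (\<lambda>x. b (f x) (pd i g x) + b (pd i f x) (g x))" for i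
    using Suc.prems Ck_on_SucD[OF Suc.prems(1)] Ck_on_SucD[OF Suc.prems(2)]
    by (intro Ck_on_add[OF assms(1)] Suc.IH) auto
  moreover have d: "f differentiable (at x)" "g differentiable (at x)" if "x \<in> U" for x
    using Suc.prems that by simp_all
  moreover have "pd i (\<lambda>x. b (f x) (g x)) x = b (f x) (pd i g x) + b (pd i f x) (g x)"
    if "x \<in> U" for i x
    using d[OF that] by (rule pd_bilinear[OF assms(2)])
  ultimately have "Ck_on k U (pd i (\<lambda>x. b (f x) (g x)))" for i
    by (metis (no_types, lifting) Ck_on_cong[OF assms(1)])
  then show ?case using d by (simp add: differentiable_bilinear[OF assms(2)])
qed

lemma smooth_on_const [simp]: "smooth_on U (\<lambda>x. c)"
  by (simp add: smooth_on_def Ck_on_const)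

lemma smooth_on_cong: "open U \<Longrightarrow> (\<And>x. x \<in> U \<Longrightarrow> f x = g x) \<Longrightarrow> smooth_on U f \<Longrightarrow> smooth_on U g"
  unfolding smooth_on_def using Ck_on_cong by blast

lemma smooth_on_subset: "smooth_on U f \<Longrightarrow> V \<subseteq> U \<Longrightarrow> smooth_on V f"
  unfolding smooth_on_def using Ck_on_subset by blast

lemma smooth_on_local:
  "(\<And>x. x \<in> U \<Longrightarrow> \<exists>W. open W \<and> x \<in> W \<and> smooth_on W f) \<Longrightarrow> smooth_on U f"
  unfolding smooth_on_def using Ck_on_local by metis

lemma smooth_on_bounded_linear:
  "open U \<Longrightarrow> bounded_linear L \<Longrightarrow> smooth_on U f \<Longrightarrow> smooth_on U (\<lambda>x. L (f x))"
  unfolding smooth_on_def using Ck_on_bounded_linear by blast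

lemma smooth_on_add:
  "open U \<Longrightarrow> smooth_on U f \<Longrightarrow> smooth_on U g \<Longrightarrow> smooth_on U (\<lambda>x. f x + g x)"
  unfolding smooth_on_def using Ck_on_add by blast

lemma smooth_on_bilinear:
  "open U \<Longrightarrow> bounded_bilinear b \<Longrightarrow> smooth_on U f \<Longrightarrow> smooth_on U g \<Longrightarrow>
    smooth_on U (\<lambda>x. b (f x) (g x))"
  unfolding smooth_on_def using Ck_on_bilinear by blast

lemmas smooth_on_matmul = smooth_on_bilinear[OF _ bounded_bilinear_matrix_mult]

lemma smooth_on_sum:
  assumes "open U" "\<And>a. a \<in> A \<Longrightarrow> smooth_on U (f a)"
  shows "smooth_on U (\<lambda>x. \<Sum>a\<in>A. f a x)"
  using assms(2) by (induction A rule: infinite_finite_induct) (auto intro: smooth_on_add[OF assms(1)])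

lemma smooth_on_vec_nth: "open U \<Longrightarrow> smooth_on U f \<Longrightarrow> smooth_on U (\<lambda>x. f x $ i)"
  by (rule smooth_on_bounded_linear[OF _ bounded_linear_vec_nth])

lemma smooth_on_vec:
  fixes f :: "real^'n::finite \<Rightarrow> 'b::real_normed_vector^'m"
  assumes "open U" "\<And>i. smooth_on U (\<lambda>x. f x $ i)"
  shows "smooth_on U f"
proof -
  have "smooth_on U (\<lambda>x. \<Sum>i\<in>UNIV. axis i (f x $ i))"
    using assms by (intro smooth_on_sum smooth_on_bounded_linear[OF _ bounded_linear_axis])
  then show ?thesis by (simp flip: vec_eq_sum_axis)
qed

lemma smooth_on_differentiable: "smooth_on U f \<Longrightarrow> x \<in> U \<Longrightarrow> f differentiable (at x)"
  unfolding smooth_on_def by (metis Ck_on.simps(2))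

lemma smooth_on_pd: "smooth_on U f \<Longrightarrow> smooth_on U (pd i f)"
  unfolding smooth_on_def by (metis Ck_on.simps(2))

lemma smooth_on_continuous_on: "smooth_on U f \<Longrightarrow> continuous_on U f"
  unfolding smooth_on_def by (metis Ck_on.simps(1))

text \<open>Each function is a derivative of the other up to a scalar, so one induction has to treat
  both. They provide the smoothness of the explicit chart \<open>base\<close>.\<close>

lemma Ck_on_sin_cos:
  "Ck_on k U (\<lambda>x. sin (x $ j)) \<and> Ck_on k U (\<lambda>x. cos (x $ j))" if "open U" for U :: "(real^'n) set"
proof (induction k)
  case 0
  show ?case by (auto intro!: continuous_intros)
next
  case (Suc k)
  have s: "((\<lambda>x::real^'n. sin (x $ j)) has_derivative (\<lambda>v. cos (x $ j) * (v $ j))) (at x)" for x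
    by (auto intro!: derivative_eq_intros bounded_linear_imp_has_derivative[OF bounded_linear_vec_nth])
  have c: "((\<lambda>x::real^'n. cos (x $ j)) has_derivative (\<lambda>v. - sin (x $ j) * (v $ j))) (at x)" for x
    by (auto intro!: derivative_eq_intros bounded_linear_imp_has_derivative[OF bounded_linear_vec_nth])
  have "pd i (\<lambda>x::real^'n. sin (x $ j)) = (\<lambda>x. (axis i 1 $ j) *\<^sub>R cos (x $ j))"
    "pd i (\<lambda>x::real^'n. cos (x $ j)) = (\<lambda>x. - (axis i 1 $ j) *\<^sub>R sin (x $ j))" for i
    using pd_eqI[OF s] pd_eqI[OF c] by (auto simp: mult.commute)
  moreover have "Ck_on k U (\<lambda>x. r *\<^sub>R sin (x $ j))" "Ck_on k U (\<lambda>x. r *\<^sub>R cos (x $ j))" for r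
    using Suc by (auto intro!: Ck_on_bounded_linear[OF that bounded_linear_scaleR_right] simp del: real_scaleR_def)
  moreover have "(\<lambda>x::real^'n. sin (x $ j)) differentiable (at x)" "(\<lambda>x::real^'n. cos (x $ j)) differentiable (at x)" for x
    using s c by (blast intro: differentiableI)+
  ultimately show ?case
    by (simp only: Ck_on.simps) blast
qed

lemma smooth_on_sin_nth: "open U \<Longrightarrow> smooth_on U (\<lambda>x. sin (x $ j))"
  and smooth_on_cos_nth: "open U \<Longrightarrow> smooth_on U (\<lambda>x. cos (x $ j))"
  unfolding smooth_on_def using Ck_on_sin_cos by blast+

subsection \<open>Symmetry of second partial derivatives\<close>

lemma pd_line:
  fixes f :: "real^'n::finite \<Rightarrow> real"
  assumes "f differentiable (at (p + t *\<^sub>R axis i 1))"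
  shows "((\<lambda>s. f (p + s *\<^sub>R axis i 1)) has_real_derivative pd i f (p + t *\<^sub>R axis i 1)) (at t)"
proof -
  have "((\<lambda>s. f (p + s *\<^sub>R axis i 1)) has_derivative
      (\<lambda>h. frechet_derivative f (at (p + t *\<^sub>R axis i 1)) (h *\<^sub>R axis i 1))) (at t)"
    using assms by (intro has_derivative_compose[where g=f and f="\<lambda>s. p + s *\<^sub>R axis i 1"])
      (auto intro!: derivative_eq_intros simp: frechet_derivative_works)
  moreover have "frechet_derivative f (at (p + t *\<^sub>R axis i 1)) (h *\<^sub>R axis i 1) = h * pd i f (p + t *\<^sub>R axis i 1)" for h
    using assms by (simp add: linear_frechet_derivative linear_scale pd_def)
  ultimately show ?thesis
    by (simp add: has_field_derivative_def mult.commute[of _ "pd _ _ _"])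
qed

text \<open>The mean value theorem is applied twice, in direction \<open>i\<close> to the difference
  of two parallel segments and then in direction \<open>j\<close> to the partial derivative that
  results. The second difference on the left is symmetric in \<open>i\<close> and \<open>j\<close>,
  the right-hand side is not visibly so.\<close>

lemma second_difference:
  fixes f :: "real^'n::finite \<Rightarrow> real"
  assumes C: "Ck_on 2 U f" and h: "h > 0"
    and box: "\<And>s t. 0 \<le> s \<Longrightarrow> s \<le> h \<Longrightarrow> 0 \<le> t \<Longrightarrow> t \<le> h \<Longrightarrow> x + s *\<^sub>R axis i 1 + t *\<^sub>R axis j 1 \<in> U"
  obtains s t where "0 \<le> s" "s \<le> h" "0 \<le> t" "t \<le> h"
    "f (x + h *\<^sub>R axis i 1 + h *\<^sub>R axis j 1) - f (x + h *\<^sub>R axis i 1) - f (x + h *\<^sub>R axis j 1) + f x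
      = h * h * pd j (pd i f) (x + s *\<^sub>R axis i 1 + t *\<^sub>R axis j 1)"
proof -
  have d0: "f differentiable (at y)" and d1: "pd i f differentiable (at y)" if "y \<in> U" for y
    using C that by (auto simp: numeral_2_eq_2)
  define u where "u s = f ((x + h *\<^sub>R axis j 1) + s *\<^sub>R axis i 1) - f (x + s *\<^sub>R axis i 1)" for s
  have "(u has_real_derivative (pd i f ((x + h *\<^sub>R axis j 1) + s *\<^sub>R axis i 1) - pd i f (x + s *\<^sub>R axis i 1))) (at s)"
    if "0 \<le> s" "s \<le> h" for s
    unfolding u_def
    by (intro DERIV_diff pd_line d0) (use box[of s h] box[of s 0] that h in \<open>auto simp: algebra_simps\<close>)
  then obtain s where s: "0 < s" "s < h"
    "u h - u 0 = (h - 0) * (pd i f ((x + h *\<^sub>R axis j 1) + s *\<^sub>R axis i 1) - pd i f (x + s *\<^sub>R axis i 1))"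
    using MVT2[OF h, of u "\<lambda>s. pd i f ((x + h *\<^sub>R axis j 1) + s *\<^sub>R axis i 1) - pd i f (x + s *\<^sub>R axis i 1)"] by blast
  define v where "v t = pd i f ((x + s *\<^sub>R axis i 1) + t *\<^sub>R axis j 1)" for t
  have "(v has_real_derivative pd j (pd i f) ((x + s *\<^sub>R axis i 1) + t *\<^sub>R axis j 1)) (at t)"
    if "0 \<le> t" "t \<le> h" for t
    unfolding v_def
    by (intro pd_line d1) (use box[of s t] that s in \<open>auto simp: algebra_simps\<close>)
  then obtain t where t: "0 < t" "t < h"
    "v h - v 0 = (h - 0) * pd j (pd i f) ((x + s *\<^sub>R axis i 1) + t *\<^sub>R axis j 1)"
    using MVT2[OF h, of v "\<lambda>t. pd j (pd i f) ((x + s *\<^sub>R axis i 1) + t *\<^sub>R axis j 1)"] by blast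
  have "u h - u 0 = h * (v h - v 0)" using s(3) by (simp add: v_def algebra_simps)
  with t have "u h - u 0 = h * h * pd j (pd i f) (x + s *\<^sub>R axis i 1 + t *\<^sub>R axis j 1)" by simp
  moreover have "u h - u 0 = f (x + h *\<^sub>R axis i 1 + h *\<^sub>R axis j 1) - f (x + h *\<^sub>R axis i 1)
     - f (x + h *\<^sub>R axis j 1) + f x"
    by (simp add: u_def add.assoc add.commute[of "h *\<^sub>R axis j 1"])
  ultimately show ?thesis using that[of s t] s t by simp
qed

text \<open>By \<open>second_difference\<close> both mixed derivatives, at points close to
  \<open>x\<close>, equal the same difference quotient; continuity carries this to
  \<open>x\<close>.\<close>

lemma pd_pd_commute_real:
  fixes f :: "real^'n::finite \<Rightarrow> real"
  assumes "open U" "x \<in> U" and C: "Ck_on 2 U f"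
  shows "pd j (pd i f) x = pd i (pd j f) x"
proof (rule ccontr)
  assume ne: "pd j (pd i f) x \<noteq> pd i (pd j f) x"
  \<comment> \<open>Half of the supposed gap: two values within this distance of the two mixed
    derivatives cannot coincide.\<close>
  define \<epsilon> where "\<epsilon> = \<bar>pd j (pd i f) x - pd i (pd j f) x\<bar> / 2"
  have \<epsilon>: "\<epsilon> > 0" using ne by (simp add: \<epsilon>_def)
  have cont: "isCont (pd b (pd a f)) x" for a b
    using C assms(1,2) by (auto simp: numeral_2_eq_2 continuous_on_eq_continuous_at)
  obtain d1 where d1: "d1 > 0" "\<And>y. dist y x < d1 \<Longrightarrow> dist (pd j (pd i f) y) (pd j (pd i f) x) < \<epsilon>"
    using cont[of j i] \<epsilon> unfolding continuous_at_eps_delta by blast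
  obtain d2 where d2: "d2 > 0" "\<And>y. dist y x < d2 \<Longrightarrow> dist (pd i (pd j f) y) (pd i (pd j f) x) < \<epsilon>"
    using cont[of i j] \<epsilon> unfolding continuous_at_eps_delta by blast
  obtain d3 where d3: "d3 > 0" "ball x d3 \<subseteq> U"
    using assms(1,2) openE by blast
  \<comment> \<open>All points of the box lie within 2h of \<open>x\<close>, and a third of the
    smallest radius keeps 2h below each radius.\<close>
  define h where "h = min d1 (min d2 d3) / 3"
  have h: "h > 0" "2 * h < d1" "2 * h < d2" "2 * h < d3"
    using d1(1) d2(1) d3(1) by (auto simp: h_def)
  have near: "dist (x + s *\<^sub>R axis a 1 + t *\<^sub>R axis b 1) x \<le> 2 * h"
    if "0 \<le> s" "s \<le> h" "0 \<le> t" "t \<le> h" for s t and a b :: 'n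
  proof -
    have "dist (x + s *\<^sub>R axis a 1 + t *\<^sub>R axis b 1) x = norm (s *\<^sub>R axis a 1 + t *\<^sub>R axis b 1 :: real^'n)"
      by (simp add: dist_norm add.assoc)
    also have "\<dots> \<le> norm (s *\<^sub>R axis a 1 :: real^'n) + norm (t *\<^sub>R axis b 1 :: real^'n)"
      by (rule norm_triangle_ineq)
    also have "\<dots> \<le> 2 * h" using that by (simp add: norm_axis_1)
    finally show ?thesis .
  qed
  have box: "x + s *\<^sub>R axis a 1 + t *\<^sub>R axis b 1 \<in> U"
    if "0 \<le> s" "s \<le> h" "0 \<le> t" "t \<le> h" for s t and a b :: 'n
    using near[OF that, of a b] h d3(2) by (force simp: dist_commute)
  obtain s t where 1: "0 \<le> s" "s \<le> h" "0 \<le> t" "t \<le> h"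
    "f (x + h *\<^sub>R axis i 1 + h *\<^sub>R axis j 1) - f (x + h *\<^sub>R axis i 1) - f (x + h *\<^sub>R axis j 1) + f x
      = h * h * pd j (pd i f) (x + s *\<^sub>R axis i 1 + t *\<^sub>R axis j 1)"
    using second_difference[OF C h(1) box] by blast
  obtain s' t' where 2: "0 \<le> s'" "s' \<le> h" "0 \<le> t'" "t' \<le> h"
    "f (x + h *\<^sub>R axis j 1 + h *\<^sub>R axis i 1) - f (x + h *\<^sub>R axis j 1) - f (x + h *\<^sub>R axis i 1) + f x
      = h * h * pd i (pd j f) (x + s' *\<^sub>R axis j 1 + t' *\<^sub>R axis i 1)"
    using second_difference[OF C h(1) box] by blast
  have "h * h * pd j (pd i f) (x + s *\<^sub>R axis i 1 + t *\<^sub>R axis j 1) =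
    h * h * pd i (pd j f) (x + s' *\<^sub>R axis j 1 + t' *\<^sub>R axis i 1)"
    using 1(5) 2(5)[unfolded add.assoc add.commute[of "h *\<^sub>R axis j 1" "h *\<^sub>R axis i 1"]]
    unfolding add.assoc by linarith
  then have "pd j (pd i f) (x + s *\<^sub>R axis i 1 + t *\<^sub>R axis j 1) =
    pd i (pd j f) (x + s' *\<^sub>R axis j 1 + t' *\<^sub>R axis i 1)" using h(1) by simp
  moreover have "dist (pd j (pd i f) (x + s *\<^sub>R axis i 1 + t *\<^sub>R axis j 1)) (pd j (pd i f) x) < \<epsilon>"
    using near[OF 1(1-4), of i j] h by (intro d1(2)) auto
  moreover have "dist (pd i (pd j f) (x + s' *\<^sub>R axis j 1 + t' *\<^sub>R axis i 1)) (pd i (pd j f) x) < \<epsilon>"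
    using near[OF 2(1-4), of j i] h by (intro d2(2)) auto
  ultimately show False by (simp add: \<epsilon>_def dist_real_def) argo
qed

lemma pd_pd_commute:
  fixes f :: "real^'n::finite \<Rightarrow> 'b::euclidean_space"
  assumes U: "open U" "x \<in> U" and f: "smooth_on U f"
  shows "pd j (pd i f) x = pd i (pd j f) x"
proof (rule euclidean_eqI)
  fix b :: 'b assume "b \<in> Basis"
  have bl: "bounded_linear (\<lambda>y::'b. y \<bullet> b)" by (rule bounded_linear_inner_left)
  have "pd j (pd i f) x \<bullet> b = pd j (pd i (\<lambda>y. f y \<bullet> b)) x" for i j
  proof -
    have "pd j (pd i (\<lambda>y. f y \<bullet> b)) x = pd j (\<lambda>y. pd i f y \<bullet> b) x"
      using U f by (intro pd_cong[OF U]) (auto intro!: pd_bounded_linear[OF bl] smooth_on_differentiable)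
    also have "\<dots> = pd j (pd i f) x \<bullet> b"
      using U f by (intro pd_bounded_linear[OF bl] smooth_on_differentiable smooth_on_pd)
    finally show ?thesis by simp
  qed
  then show "pd j (pd i f) x \<bullet> b = pd i (pd j f) x \<bullet> b"
    using pd_pd_commute_real[OF U, of "\<lambda>y. f y \<bullet> b" j i] smooth_on_bounded_linear[OF U(1) bl f]
    by (simp add: smooth_on_def)
qed

section \<open>Moving frames\<close>

lemma differentiable_prod_real:
  fixes f :: "'i \<Rightarrow> 'a::real_normed_vector \<Rightarrow> real"
  assumes "finite A" "\<And>i. i \<in> A \<Longrightarrow> f i differentiable (at x)"
  shows "(\<lambda>x. \<Prod>i\<in>A. f i x) differentiable (at x)"
  using assms by (induction A rule: finite_induct) (auto intro!: differentiable_mult)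

lemma differentiable_det:
  fixes A :: "real^'m::finite \<Rightarrow> real^'n^'n"
  assumes "A differentiable (at x)"
  shows "(\<lambda>y. det (A y)) differentiable (at x)"
  unfolding det_def
  by (intro differentiable_sum ballI differentiable_mult differentiable_const
      differentiable_prod_real differentiable_vec_nth assms) (auto simp: finite_permutations)

lemma matrix_inv_mult:
  assumes "invertible (A :: real^'n^'m)"
  shows matrix_inv_left: "matrix_inv A ** A = mat 1" and matrix_inv_right: "A ** matrix_inv A = mat 1"
  using someI_ex[OF assms[unfolded invertible_def]] by (simp_all add: matrix_inv_def)

lemma matmul_nth: "(A ** B) $ i $ j = (\<Sum>k\<in>UNIV. A $ i $ k * B $ k $ j)"
  by (simp add: matrix_matrix_mult_def)

lemma transpose_nth: "transpose A $ i $ j = A $ j $ i"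
  by (simp add: transpose_def)

lemma sum_swap_inner:
  fixes f :: "'i::finite \<Rightarrow> 'j::finite \<Rightarrow> 'k::finite \<Rightarrow> 'b::comm_monoid_add"
  shows "(\<Sum>i\<in>UNIV. \<Sum>j\<in>UNIV. \<Sum>k\<in>UNIV. f i j k) = (\<Sum>i\<in>UNIV. \<Sum>k\<in>UNIV. \<Sum>j\<in>UNIV. f i j k)"
  by (intro sum.cong refl, rule sum.swap)

lemma sum_rotate3:
  fixes f :: "'i::finite \<Rightarrow> 'j::finite \<Rightarrow> 'k::finite \<Rightarrow> 'b::comm_monoid_add"
  shows "(\<Sum>i\<in>UNIV. \<Sum>j\<in>UNIV. \<Sum>k\<in>UNIV. f i j k) = (\<Sum>j\<in>UNIV. \<Sum>k\<in>UNIV. \<Sum>i\<in>UNIV. f i j k)"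
  using sum.swap[of "\<lambda>i j. \<Sum>k\<in>UNIV. f i j k"] sum_swap_inner[of "\<lambda>j i k. f i j k"] by simp

lemma sum_swap4:
  fixes f :: "'i::finite \<Rightarrow> 'j::finite \<Rightarrow> 'k::finite \<Rightarrow> 'l::finite \<Rightarrow> 'b::comm_monoid_add"
  shows "(\<Sum>i\<in>UNIV. \<Sum>j\<in>UNIV. \<Sum>c\<in>UNIV. \<Sum>d\<in>UNIV. f i j c d) =
    (\<Sum>c\<in>UNIV. \<Sum>d\<in>UNIV. \<Sum>i\<in>UNIV. \<Sum>j\<in>UNIV. f i j c d)"
proof -
  have "(\<Sum>i\<in>UNIV. \<Sum>j\<in>UNIV. \<Sum>c\<in>UNIV. \<Sum>d\<in>UNIV. f i j c d) =
      (\<Sum>i\<in>UNIV. \<Sum>c\<in>UNIV. \<Sum>j\<in>UNIV. \<Sum>d\<in>UNIV. f i j c d)"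
    by (intro sum.cong refl, rule sum.swap)
  also have "\<dots> = (\<Sum>c\<in>UNIV. \<Sum>i\<in>UNIV. \<Sum>j\<in>UNIV. \<Sum>d\<in>UNIV. f i j c d)"
    by (rule sum.swap)
  also have "\<dots> = (\<Sum>c\<in>UNIV. \<Sum>i\<in>UNIV. \<Sum>d\<in>UNIV. \<Sum>j\<in>UNIV. f i j c d)"
    by (intro sum.cong refl, rule sum.swap)
  also have "\<dots> = (\<Sum>c\<in>UNIV. \<Sum>d\<in>UNIV. \<Sum>i\<in>UNIV. \<Sum>j\<in>UNIV. f i j c d)"
    by (intro sum.cong refl, rule sum.swap)
  finally show ?thesis .
qed

text \<open>Cramer's rule: an entry of the inverse is a quotient of determinants, where
  \<open>B\<close> has its column \<open>k\<close> replaced by a unit vector.\<close>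

lemma differentiable_matrix_inv:
  fixes A :: "real^'m::finite \<Rightarrow> real^'n^'n"
  assumes A: "A differentiable (at x)" and U: "open U" "x \<in> U" "\<And>y. y \<in> U \<Longrightarrow> invertible (A y)"
  shows "(\<lambda>y. matrix_inv (A y)) differentiable (at x)"
proof (intro differentiable_componentwise_vec)
  fix k l :: 'n
  define B where "B y = (\<chi> i j. if j = k then axis l 1 $ i else A y $ i $ j)" for y
  have "matrix_inv (A y) $ k $ l = det (B y) / det (A y)" if "y \<in> U" for y
  proof -
    have "det (A y) \<noteq> 0" using U(3)[OF that] invertible_det_nz by blast
    moreover have "A y *v (matrix_inv (A y) *v axis l 1) = axis l 1"
      using U(3)[OF that] by (simp add: matrix_vector_mul_assoc matrix_inv_right)
    ultimately have "matrix_inv (A y) *v axis l 1 =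
        (\<chi> k. det (\<chi> i j. if j = k then axis l 1 $ i else A y $ i $ j) / det (A y))"
      using cramer by blast
    then have "(matrix_inv (A y) *v axis l 1) $ k = det (B y) / det (A y)"
      by (simp add: B_def)
    then show ?thesis by (simp add: matrix_vector_mult_basis column_def)
  qed
  moreover have "B differentiable (at x)"
    unfolding B_def
  proof (intro differentiable_componentwise_vec)
    fix i j show "(\<lambda>y. (\<chi> i j. if j = k then axis l 1 $ i else A y $ i $ j) $ i $ j) differentiable (at x)"
      by (cases "j = k") (auto intro!: differentiable_vec_nth A)
  qed
  then have "(\<lambda>y. det (B y) / det (A y)) differentiable (at x)"
    using A U invertible_det_nz by (intro differentiable_divide differentiable_det) blast+
  ultimately show "(\<lambda>y. matrix_inv (A y) $ k $ l) differentiable (at x)"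
    using differentiable_cong_open[OF U(1,2), of "\<lambda>y. matrix_inv (A y) $ k $ l" "\<lambda>y. det (B y) / det (A y)"]
    by simp
qed

definition diag :: "('n \<Rightarrow> real) \<Rightarrow> real^'n^'n" where
  "diag q = (\<chi> a b. if a = b then q a else 0)"

lemma diag_mult_nth: "(diag q ** A) $ a $ b = q a * A $ a $ b"
  by (simp add: diag_def matrix_matrix_mult_def if_distrib if_distribR cong: if_cong)

lemma mult_diag_nth: "(A ** diag q) $ a $ b = A $ a $ b * q b"
  by (simp add: diag_def matrix_matrix_mult_def if_distrib if_distribR cong: if_cong)

lemma congruence_nth:
  "(transpose A ** B ** C) $ i $ j = (\<Sum>a\<in>UNIV. \<Sum>b\<in>UNIV. A $ a $ i * C $ b $ j * B $ a $ b)"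
  for A B C :: "real^'n^'n"
  unfolding matrix_matrix_mult_def transpose_def
  by (subst sum.swap) (simp add: sum_distrib_right sum_distrib_left mult_ac)

lemma congruence_diag_nth:
  "(transpose A ** diag q ** C) $ i $ j = (\<Sum>a\<in>UNIV. q a * A $ a $ i * C $ a $ j)"
proof -
  have "(transpose A ** diag q ** C) $ i $ j = (\<Sum>a\<in>UNIV. transpose A $ i $ a * (diag q ** C) $ a $ j)"
    by (simp only: matrix_mul_assoc[symmetric] matmul_nth[of "transpose A"])
  then show ?thesis by (simp add: diag_mult_nth transpose_nth mult_ac)
qed

text \<open>The rows of \<open>e\<close> are a coframe in which the metric has the constant diagonal matrix \<open>q\<close>, and
  \<open>om i\<close> is the matrix of the Levi-Civita connection in the direction \<open>\<partial>\<^sub>i\<close>.\<close>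

locale moving_frame =
  fixes U :: "(real^'n::finite) set" and q :: "'n \<Rightarrow> real" and e :: "real^'n \<Rightarrow> real^'n^'n"
    and om :: "'n \<Rightarrow> real^'n \<Rightarrow> real^'n^'n" and g :: "'n coeffs"
  assumes open_U: "open U" and q_nonzero: "q a \<noteq> 0"
    and smooth_e: "smooth_on U e" and smooth_om: "smooth_on U (om i)"
    and invertible_e: "x \<in> U \<Longrightarrow> invertible (e x)"
    and g_eq: "x \<in> U \<Longrightarrow> g x = transpose (e x) ** diag q ** e x"
    and om_skew: "x \<in> U \<Longrightarrow> transpose (om i x) ** diag q = - (diag q ** om i x)"
    and torsion_free: "x \<in> U \<Longrightarrow> (pd i e x + om i x ** e x) $ a $ j = (pd j e x + om j x ** e x) $ a $ i"
begin

section \<open>The Levi-Civita connection and its curvature in the frame\<close>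

definition Gam :: "'n \<Rightarrow> real^'n \<Rightarrow> real^'n^'n" where
  "Gam i x = (\<chi> k j. christoffel g k i j x)"

text \<open>The curvature form d om + om wedge om, evaluated on the coordinate fields
  \<open>i\<close> and \<open>j\<close>.\<close>

definition Om :: "'n \<Rightarrow> 'n \<Rightarrow> real^'n \<Rightarrow> real^'n^'n" where
  "Om i j x = pd i (om j) x - pd j (om i) x + om i x ** om j x - om j x ** om i x"

lemmas d_e = smooth_on_differentiable[OF smooth_e]
lemmas d_om = smooth_on_differentiable[OF smooth_om]

lemma pd_congruence:
  assumes "x \<in> U" "H differentiable (at x)"
  shows "pd i (\<lambda>y. transpose (e y) ** H y ** e y) x =
    transpose (pd i e x) ** H x ** e x + transpose (e x) ** pd i H x ** e x + transpose (e x) ** H x ** pd i e x"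
    "(\<lambda>y. transpose (e y) ** H y ** e y) differentiable (at x)"
proof -
  note dt = differentiable_bounded_linear[OF bounded_linear_transpose d_e[OF assms(1)]]
  note dH = differentiable_matmul[OF dt assms(2)]
  show "(\<lambda>y. transpose (e y) ** H y ** e y) differentiable (at x)"
    by (rule differentiable_matmul[OF dH d_e[OF assms(1)]])
  show "pd i (\<lambda>y. transpose (e y) ** H y ** e y) x =
    transpose (pd i e x) ** H x ** e x + transpose (e x) ** pd i H x ** e x + transpose (e x) ** H x ** pd i e x"
    using pd_matmul[OF dH d_e[OF assms(1)]] pd_matmul[OF dt assms(2)]
      pd_bounded_linear[OF bounded_linear_transpose d_e[OF assms(1)]]
    by (simp add: matmul_simps)
qed

lemma pd_tensor:
  assumes "x \<in> U" "H differentiable (at x)" "\<And>y. y \<in> U \<Longrightarrow> h y = transpose (e y) ** H y ** e y"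
  shows "pd i h x = transpose (pd i e x) ** H x ** e x + transpose (e x) ** pd i H x ** e x
      + transpose (e x) ** H x ** pd i e x"
    "h differentiable (at x)"
  using pd_cong[OF open_U assms(1), of h, OF assms(3)]
    differentiable_cong_open[OF open_U assms(1), of h, OF assms(3)] pd_congruence[OF assms(1,2)]
  by simp_all

lemma g_nondegenerate:
  assumes "x \<in> U" shows "invertible (g x)"
proof -
  have "invertible (diag q)"
    unfolding invertible_def
  proof (intro exI conjI)
    show "diag q ** diag (\<lambda>a. inverse (q a)) = mat 1" "diag (\<lambda>a. inverse (q a)) ** diag q = mat 1"
      using q_nonzero by (simp_all add: vec_eq_iff diag_mult_nth mult_diag_nth) (auto simp: diag_def mat_def q_nonzero)
  qed
  then show ?thesis
    using invertible_e[OF assms] by (simp add: g_eq[OF assms] invertible_mult transpose_invertible)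
qed

lemma frame_matrix_inv:
  assumes "x \<in> U"
  shows "e x ** (matrix_inv (g x) ** (transpose (e x) ** diag q)) = mat 1"
proof -
  have "(matrix_inv (g x) ** (transpose (e x) ** diag q)) ** e x = mat 1"
    using matrix_inv_left[OF g_nondegenerate[OF assms]] g_eq[OF assms] by (simp flip: matrix_mul_assoc)
  then show ?thesis using matrix_left_right_inverse by blast
qed

lemma frame_inverse_metric:
  assumes "x \<in> U"
  shows "(\<Sum>i\<in>UNIV. \<Sum>j\<in>UNIV. matrix_inv (g x) $ i $ j * (e x $ c $ i * e x $ d $ j)) = (if c = d then 1 / q c else 0)"
proof -
  have "(e x ** (matrix_inv (g x) ** transpose (e x))) ** diag q = mat 1"
    using frame_matrix_inv[OF assms] by (simp add: matrix_mul_assoc)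
  then have "(e x ** (matrix_inv (g x) ** transpose (e x))) $ c $ d * q d = mat 1 $ c $ d"
    by (metis mult_diag_nth)
  then have "(e x ** (matrix_inv (g x) ** transpose (e x))) $ c $ d = (if c = d then 1 / q c else 0)"
    using q_nonzero[of d] by (auto simp: mat_def field_simps)
  then show ?thesis
    by (simp add: matrix_matrix_mult_def transpose_def sum_distrib_left mult_ac)
qed

text \<open>The coframe is orthogonal, so contraction with the inverse metric becomes a weighted
  diagonal sum. A general value space lets the same lemma contract numbers and matrix-valued
  coefficients.\<close>

lemma contract:
  fixes W :: "'n \<Rightarrow> 'n \<Rightarrow> 'b::real_vector"
  assumes "x \<in> U"
  shows "(\<Sum>i\<in>UNIV. \<Sum>j\<in>UNIV. matrix_inv (g x) $ i $ j *\<^sub>R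
      (\<Sum>c\<in>UNIV. \<Sum>d\<in>UNIV. (e x $ c $ i * e x $ d $ j) *\<^sub>R W c d)) = (\<Sum>c\<in>UNIV. (1 / q c) *\<^sub>R W c c)"
proof -
  have "(\<Sum>i\<in>UNIV. \<Sum>j\<in>UNIV. matrix_inv (g x) $ i $ j *\<^sub>R
      (\<Sum>c\<in>UNIV. \<Sum>d\<in>UNIV. (e x $ c $ i * e x $ d $ j) *\<^sub>R W c d)) =
    (\<Sum>i\<in>UNIV. \<Sum>j\<in>UNIV. \<Sum>c\<in>UNIV. \<Sum>d\<in>UNIV. (matrix_inv (g x) $ i $ j * (e x $ c $ i * e x $ d $ j)) *\<^sub>R W c d)"
    by (simp add: scaleR_sum_right)
  also have "\<dots> = (\<Sum>c\<in>UNIV. \<Sum>d\<in>UNIV. \<Sum>i\<in>UNIV. \<Sum>j\<in>UNIV. (matrix_inv (g x) $ i $ j * (e x $ c $ i * e x $ d $ j)) *\<^sub>R W c d)"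
    by (rule sum_swap4)
  also have "\<dots> = (\<Sum>c\<in>UNIV. \<Sum>d\<in>UNIV. (if c = d then 1 / q c else 0) *\<^sub>R W c d)"
    by (simp add: frame_inverse_metric[OF assms, symmetric] scaleR_sum_left)
  also have "\<dots> = (\<Sum>c\<in>UNIV. (1 / q c) *\<^sub>R W c c)"
    by (simp add: if_distrib if_distribR cong: if_cong)
  finally show ?thesis .
qed

text \<open>Uniqueness of the Levi-Civita connection: \<open>om\<close> is metric by
  \<open>om_skew\<close> and torsion-free by \<open>torsion_free\<close>, so the Koszul formula
  forces the Christoffel symbols. Skewness cancels the connection terms in the derivative of the
  metric, which allows replacing the derivative of \<open>e\<close> by \<open>N\<close>.\<close>

lemma frame_Gam:
  assumes "x \<in> U"
  shows "e x ** Gam i x = pd i e x + om i x ** e x"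
proof -
  define N where "N i = pd i e x + om i x ** e x" for i
  have N_sym: "N i $ a $ j = N j $ a $ i" for i j a
    using torsion_free[OF assms] by (simp add: N_def)
  have pd_g: "pd i g x = transpose (N i) ** diag q ** e x + transpose (e x) ** diag q ** N i" for i
  proof -
    have "pd i g x = transpose (pd i e x) ** diag q ** e x + transpose (e x) ** diag q ** pd i e x"
      using pd_tensor(1)[OF assms, of "\<lambda>_. diag q" g i] g_eq by (simp add: matmul_simps)
    moreover have "transpose (om i x ** e x) ** diag q ** e x + transpose (e x) ** diag q ** (om i x ** e x) = 0"
      using om_skew[OF assms, of i]
      by (simp add: matrix_transpose_mul) (simp add: matrix_mul_assoc[symmetric] matmul_simps
          matrix_mul_assoc[of "transpose (om i x)" "diag q"])
    ultimately show ?thesis by (simp add: N_def transpose_simps matmul_simps)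
  qed
  have dg: "g differentiable (at x)"
    using pd_tensor(2)[OF assms, of "\<lambda>_. diag q" g] g_eq by simp
  have pd_g_nth: "pd i g x $ j $ l = (\<Sum>a\<in>UNIV. q a * N i $ a $ j * e x $ a $ l + q a * e x $ a $ j * N i $ a $ l)" for i j l
    by (simp add: pd_g congruence_diag_nth sum.distrib)
  \<comment> \<open>Each derivative of the metric has two terms in \<open>N\<close>. By symmetry of
    \<open>N\<close>, four of the six cancel in pairs and the other two coincide.\<close>
  have "pd i g x $ j $ l + pd j g x $ i $ l - pd l g x $ i $ j = 2 * (transpose (e x) ** diag q ** N i) $ l $ j" for j l
    by (simp add: pd_g_nth congruence_diag_nth sum_distrib_left flip: sum.distrib sum_subtractf)
      (auto intro!: sum.cong simp: N_sym[of i _ l] N_sym[of j _ l] N_sym[of j _ i])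
  then have "Gam i x $ k $ j = (matrix_inv (g x) ** (transpose (e x) ** diag q ** N i)) $ k $ j" for k j
    by (simp add: Gam_def christoffel_def pd_matrix_nth[OF dg] matrix_matrix_mult_def[of "matrix_inv _"] sum_divide_distrib)
  then have "Gam i x = matrix_inv (g x) ** (transpose (e x) ** diag q ** N i)"
    by (simp add: vec_eq_iff)
  then have "e x ** Gam i x = (e x ** (matrix_inv (g x) ** (transpose (e x) ** diag q))) ** N i"
    by (simp add: matrix_mul_assoc)
  then show ?thesis by (simp add: frame_matrix_inv[OF assms] N_def)
qed

lemma pd_e: "x \<in> U \<Longrightarrow> pd i e x = e x ** Gam i x - om i x ** e x"
  by (simp add: frame_Gam)

text \<open>Solving \<open>frame_Gam\<close> for the Christoffel matrix writes it through the
  inverse of \<open>e\<close>, whose differentiability is known; the Riemann tensor needs this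
  derivative.\<close>

lemma Gam_differentiable:
  assumes "x \<in> U"
  shows "Gam i differentiable (at x)"
proof -
  have "Gam i y = matrix_inv (e y) ** (pd i e y + om i y ** e y)" if "y \<in> U" for y
    using matrix_inv_left[OF invertible_e[OF that]] by (simp add: matrix_mul_assoc flip: frame_Gam[OF that])
  moreover have "(\<lambda>y. matrix_inv (e y) ** (pd i e y + om i y ** e y)) differentiable (at x)"
    by (intro differentiable_matmul differentiable_add differentiable_matrix_inv[OF _ open_U assms]
        smooth_on_differentiable[OF _ assms] smooth_on_pd smooth_e smooth_om invertible_e)
  ultimately show ?thesis using differentiable_cong_open[OF open_U assms, of "Gam i"] by simp
qed

lemma riem_eq:
  assumes "x \<in> U"
  shows "riem g l k i j x = (pd i (Gam j) x - pd j (Gam i) x + Gam i x ** Gam j x - Gam j x ** Gam i x) $ l $ k"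
proof -
  have "christoffel g l j k = (\<lambda>y. Gam j y $ l $ k)" for l j k
    by (simp add: Gam_def)
  then show ?thesis
    by (simp add: riem_def pd_matrix_nth[OF Gam_differentiable[OF assms]] matrix_matrix_mult_def sum_subtractf)
qed

text \<open>Differentiating \<open>frame_Gam\<close> and antisymmetrizing in \<open>i\<close> and
  \<open>j\<close> removes the second derivatives of \<open>e\<close>. What remains is the tensorial
  behaviour of curvature under a change of frame.\<close>

lemma frame_riem:
  assumes "x \<in> U"
  shows "e x ** (\<chi> l k. riem g l k i j x) = Om i j x ** e x"
proof -
  note dG = Gam_differentiable[OF assms] and de = d_e[OF assms] and dom = d_om[OF assms]
  have pd_N: "pd i (pd j e) x + (om j x ** pd i e x + pd i (om j) x ** e x)
    = e x ** pd i (Gam j) x + pd i e x ** Gam j x" for i j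
  proof -
    have "pd i (\<lambda>y. pd j e y + om j y ** e y) x = pd i (\<lambda>y. e y ** Gam j y) x"
      by (rule pd_cong[OF open_U assms]) (simp add: frame_Gam)
    moreover have "pd i (\<lambda>y. pd j e y + om j y ** e y) x
        = pd i (pd j e) x + (om j x ** pd i e x + pd i (om j) x ** e x)"
      using pd_add[OF smooth_on_differentiable[OF smooth_on_pd[OF smooth_e] assms] differentiable_matmul[OF dom de]]
      by (simp add: pd_matmul de dom)
    ultimately show ?thesis using pd_matmul[OF de dG] by simp
  qed
  have sym: "pd i (pd j e) x = pd j (pd i e) x"
    by (rule pd_pd_commute[OF open_U assms smooth_e])
  have "(\<chi> l k. riem g l k i j x) = pd i (Gam j) x - pd j (Gam i) x + Gam i x ** Gam j x - Gam j x ** Gam i x"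
    by (simp add: vec_eq_iff riem_eq[OF assms])
  then have "e x ** (\<chi> l k. riem g l k i j x)
    = e x ** pd i (Gam j) x - e x ** pd j (Gam i) x + e x ** Gam i x ** Gam j x - e x ** Gam j x ** Gam i x"
    by (simp add: matmul_simps matrix_mul_assoc)
  also have "e x ** pd i (Gam j) x = pd i (pd j e) x + (om j x ** pd i e x + pd i (om j) x ** e x) - pd i e x ** Gam j x"
    using pd_N[of i j] by simp
  also have "e x ** pd j (Gam i) x = pd i (pd j e) x + (om i x ** pd j e x + pd j (om i) x ** e x) - pd j e x ** Gam i x"
    using pd_N[of j i] by (simp add: sym)
  finally show ?thesis
    by (simp add: Om_def pd_e[OF assms] matmul_simps matrix_mul_assoc)
qed

section \<open>Covariant derivatives, contractions and curvature operators in the frame\<close>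

lemma cov2_eq:
  assumes "x \<in> U" "h differentiable (at x)"
  shows "(\<chi> i j. cov2 g h k i j x) = pd k h x - transpose (Gam k x) ** h x - h x ** Gam k x"
  by (simp add: vec_eq_iff cov2_def pd_matrix_nth[OF assms(2)] matrix_matrix_mult_def transpose_def Gam_def mult.commute)

text \<open>By \<open>pd_e\<close> the derivative of the coframe consists of a Christoffel term,
  which cancels the Christoffel terms of \<open>cov2\<close>, and a connection term, which is what
  remains.\<close>

lemma cov2_frame:
  assumes "x \<in> U" "H differentiable (at x)" "\<And>y. y \<in> U \<Longrightarrow> h y = transpose (e y) ** H y ** e y"
  shows "(\<chi> i j. cov2 g h k i j x) =
    transpose (e x) ** (pd k H x - transpose (om k x) ** H x - H x ** om k x) ** e x"
proof -
  have "h differentiable (at x)" by (rule pd_tensor(2)[OF assms])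
  moreover have "pd k h x = transpose (pd k e x) ** H x ** e x + transpose (e x) ** pd k H x ** e x
      + transpose (e x) ** H x ** pd k e x"
    by (rule pd_tensor(1)[OF assms])
  ultimately show ?thesis
    by (simp add: cov2_eq[OF assms(1)] assms(3)[OF assms(1)] pd_e[OF assms(1)] transpose_simps
        matrix_transpose_mul matmul_simps matrix_mul_assoc)
qed

text \<open>For fixed \<open>k\<close> the 3-tensor is a 2-tensor \<open>t k\<close>, so
  \<open>cov2_frame\<close> applies; the Christoffel term of the slot \<open>k\<close> is left over.
  Through \<open>frame_Gam\<close> it splits into the derivative of the coefficients
  \<open>e y $ c $ k\<close> and the connection term acting on the frame index
  \<open>c\<close>.\<close>

lemma cov3_frame:
  assumes x: "x \<in> U" and D: "\<And>c. D c differentiable (at x)"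
    and T: "\<And>k y. y \<in> U \<Longrightarrow> (\<chi> i j. T k i j y) = transpose (e y) ** (\<Sum>c\<in>UNIV. e y $ c $ k *\<^sub>R D c y) ** e y"
  shows "(\<chi> i j. cov3 g T m k i j x) = transpose (e x) ** (\<Sum>c\<in>UNIV. e x $ c $ k *\<^sub>R
      (pd m (D c) x - transpose (om m x) ** D c x - D c x ** om m x - (\<Sum>d\<in>UNIV. om m x $ d $ c *\<^sub>R D d x))) ** e x"
proof -
  define B where "B k y = (\<Sum>c\<in>UNIV. e y $ c $ k *\<^sub>R D c y)" for k y
  define t where "t k y = (\<chi> i j. T k i j y)" for k y
  note de = d_e[OF x]
  have dB: "B k differentiable (at x)" for k
    unfolding B_def by (intro differentiable_sum ballI differentiable_scaleR differentiable_vec_nth de D) auto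
  have tB: "t k y = transpose (e y) ** B k y ** e y" if "y \<in> U" for k y
    using T[OF that, of k] by (simp add: t_def B_def)
  have dt: "t k differentiable (at x)" for k by (rule pd_tensor(2)[OF x dB tB])
  have Tt: "T k i j = (\<lambda>y. t k y $ i $ j)" for k i j by (simp add: t_def)
  have "(\<chi> i j. cov3 g T m k i j x)
    = (\<chi> i j. cov2 g (t k) m i j x) - (\<Sum>l\<in>UNIV. Gam m x $ l $ k *\<^sub>R t l x)"
    by (simp add: vec_eq_iff cov3_def cov2_def Tt Gam_def)
  also have "(\<chi> i j. cov2 g (t k) m i j x) = transpose (e x) ** (pd m (B k) x - transpose (om m x) ** B k x - B k x ** om m x) ** e x"
    by (rule cov2_frame[OF x dB tB])
  also have "(\<Sum>l\<in>UNIV. Gam m x $ l $ k *\<^sub>R t l x) = transpose (e x) ** (\<Sum>l\<in>UNIV. Gam m x $ l $ k *\<^sub>R B l x) ** e x"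
    by (simp add: tB[OF x] matmul.sum_left matmul.sum_right matmul_simps)
  also have "(\<Sum>l\<in>UNIV. Gam m x $ l $ k *\<^sub>R B l x) = (\<Sum>c\<in>UNIV. (e x ** Gam m x) $ c $ k *\<^sub>R D c x)"
    unfolding B_def scaleR_sum_right
    by (subst sum.swap) (simp add: matrix_matrix_mult_def scaleR_sum_left mult_ac)
  also have "\<dots> = (\<Sum>c\<in>UNIV. pd m e x $ c $ k *\<^sub>R D c x) + (\<Sum>c\<in>UNIV. (\<Sum>d\<in>UNIV. om m x $ c $ d * e x $ d $ k) *\<^sub>R D c x)"
    unfolding frame_Gam[OF x] by (simp add: scaleR_add_left sum.distrib matmul_nth)
  also have "(\<Sum>c\<in>UNIV. (\<Sum>d\<in>UNIV. om m x $ c $ d * e x $ d $ k) *\<^sub>R D c x) = (\<Sum>c\<in>UNIV. e x $ c $ k *\<^sub>R (\<Sum>d\<in>UNIV. om m x $ d $ c *\<^sub>R D d x))"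
    unfolding scaleR_sum_right scaleR_sum_left by (subst sum.swap) (simp add: mult_ac)
  also have "pd m (B k) x = (\<Sum>c\<in>UNIV. e x $ c $ k *\<^sub>R pd m (D c) x) + (\<Sum>c\<in>UNIV. pd m e x $ c $ k *\<^sub>R D c x)"
  proof -
    have de': "(\<lambda>y. e y $ c $ k) differentiable (at x)" for c
      by (intro differentiable_vec_nth de)
    have "pd m (B k) x = (\<Sum>c\<in>UNIV. pd m (\<lambda>y. e y $ c $ k *\<^sub>R D c y) x)"
      unfolding B_def by (rule pd_sum) (auto intro!: differentiable_scaleR de' D)
    then show ?thesis
      by (simp add: pd_bilinear[OF bounded_bilinear_scaleR de' D] pd_matrix_nth[OF de] sum.distrib)
  qed
  finally show ?thesis
    unfolding matmul.diff_left[symmetric] matmul.diff_right[symmetric]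
    by (simp add: B_def matmul.scaleR_left matmul.scaleR_right sum_subtractf scaleR_diff_right
        matmul.sum_left matmul.sum_right algebra_simps sum.distrib)
qed

lemma tr_metric_frame:
  assumes "x \<in> U" "h x = transpose (e x) ** H ** e x"
  shows "tr_metric g h x = (\<Sum>c\<in>UNIV. H $ c $ c / q c)"
  using contract[OF assms(1), of "\<lambda>c d. H $ c $ d"]
  by (simp add: tr_metric_def assms(2) congruence_nth)

lemma divergence_frame:
  assumes x: "x \<in> U"
    and D: "\<And>k. (\<chi> i j. cov2 g h k i j x) = transpose (e x) ** (\<Sum>c\<in>UNIV. e x $ c $ k *\<^sub>R D c) ** e x"
    and 0: "\<And>a. (\<Sum>c\<in>UNIV. D c $ c $ a / q c) = 0"
  shows "divergence g h x = 0"
proof (subst vec_eq_iff, intro allI)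
  fix j
  have "cov2 g h i k j x = (\<Sum>c\<in>UNIV. \<Sum>d\<in>UNIV. (e x $ c $ i * e x $ d $ k) *\<^sub>R (D c ** e x) $ d $ j)" for i k
  proof -
    have "cov2 g h i k j x = (\<chi> k j. cov2 g h i k j x) $ k $ j" by simp
    also have "\<dots> = (\<Sum>c\<in>UNIV. e x $ c $ i * (transpose (e x) ** (D c ** e x)) $ k $ j)"
      unfolding D by (simp add: matmul.sum_left matmul.sum_right matmul_simps matrix_mul_assoc)
    finally show ?thesis
      by (simp add: matmul_nth[of "transpose _"] transpose_nth sum_distrib_left mult_ac)
  qed
  then have "divergence g h x $ j = - (\<Sum>c\<in>UNIV. (1 / q c) *\<^sub>R (D c ** e x) $ c $ j)"
    using contract[OF x, of "\<lambda>c d. (D c ** e x) $ d $ j"] by (simp add: divergence_def)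
  also have "(\<Sum>c\<in>UNIV. (1 / q c) *\<^sub>R (D c ** e x) $ c $ j) = (\<Sum>a\<in>UNIV. (\<Sum>c\<in>UNIV. D c $ c $ a / q c) * e x $ a $ j)"
    unfolding matrix_matrix_mult_def sum_distrib_right
    by (subst sum.swap) (simp add: sum_divide_distrib)
  finally show "divergence g h x $ j = 0 $ j" by (simp add: 0)
qed

lemma rough_laplacian_frame:
  assumes x: "x \<in> U"
    and F: "\<And>m k. (\<chi> i j. cov3 g (cov2 g h) m k i j x) =
      transpose (e x) ** (\<Sum>c\<in>UNIV. e x $ c $ k *\<^sub>R (\<Sum>d\<in>UNIV. e x $ d $ m *\<^sub>R F d c)) ** e x"
  shows "rough_laplacian g h x = transpose (e x) ** (- (\<Sum>c\<in>UNIV. (1 / q c) *\<^sub>R F c c)) ** e x"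
proof -
  have "(\<chi> i j. cov3 g (cov2 g h) m k i j x) = (\<Sum>c\<in>UNIV. \<Sum>d\<in>UNIV. (e x $ c $ m * e x $ d $ k) *\<^sub>R (transpose (e x) ** F c d ** e x))" for m k
    unfolding F by (subst sum.swap) (simp add: matmul.sum_left matmul.sum_right matmul_simps scaleR_sum_right mult_ac)
  moreover have "rough_laplacian g h x = - (\<Sum>m\<in>UNIV. \<Sum>k\<in>UNIV. matrix_inv (g x) $ m $ k *\<^sub>R (\<chi> i j. cov3 g (cov2 g h) m k i j x))"
    by (simp add: rough_laplacian_def vec_eq_iff)
  ultimately show ?thesis
    using contract[OF x, of "\<lambda>c d. transpose (e x) ** F c d ** e x"]
    by (simp add: matmul.sum_left matmul.sum_right matmul_simps)
qed

lemma inner_metric_frame: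
  assumes x: "x \<in> U" and "h x = transpose (e x) ** H ** e x" "k x = transpose (e x) ** K ** e x"
  shows "inner_metric g h k x = (\<Sum>a\<in>UNIV. \<Sum>b\<in>UNIV. H $ a $ b * K $ a $ b / (q a * q b))"
proof -
  let ?gi = "matrix_inv (g x)"
  have inner_contract: "(\<Sum>j\<in>UNIV. \<Sum>b\<in>UNIV. ?gi $ j $ b *\<^sub>R (h x $ i $ j * k x $ a $ b))
     = (\<Sum>c\<in>UNIV. (1 / q c) *\<^sub>R ((transpose (e x) ** H) $ i $ c * (transpose (e x) ** K) $ a $ c))" for i a
  proof -
    have "h x $ i $ j * k x $ a $ b = (\<Sum>c\<in>UNIV. \<Sum>d\<in>UNIV. (e x $ c $ j * e x $ d $ b) *\<^sub>R
        ((transpose (e x) ** H) $ i $ c * (transpose (e x) ** K) $ a $ d))" for j b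
      unfolding assms matmul_nth[of _ "e x"] sum_product by (simp add: mult_ac)
    then show ?thesis using contract[OF x, of "\<lambda>c d. (transpose (e x) ** H) $ i $ c * (transpose (e x) ** K) $ a $ d"]
      by simp
  qed
  have "inner_metric g h k x = (\<Sum>i\<in>UNIV. \<Sum>a\<in>UNIV. ?gi $ i $ a *\<^sub>R (\<Sum>j\<in>UNIV. \<Sum>b\<in>UNIV. ?gi $ j $ b *\<^sub>R (h x $ i $ j * k x $ a $ b)))"
  proof -
    have "(\<Sum>j\<in>UNIV. \<Sum>a\<in>UNIV. \<Sum>b\<in>UNIV. ?gi $ i $ a * ?gi $ j $ b * h x $ i $ j * k x $ a $ b) =
      (\<Sum>a\<in>UNIV. \<Sum>j\<in>UNIV. \<Sum>b\<in>UNIV. ?gi $ i $ a * ?gi $ j $ b * h x $ i $ j * k x $ a $ b)" for i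
      by (rule sum.swap)
    then show ?thesis by (simp add: inner_metric_def sum_distrib_left mult_ac)
  qed
  also have "\<dots> = (\<Sum>i\<in>UNIV. \<Sum>a\<in>UNIV. ?gi $ i $ a *\<^sub>R (\<Sum>c\<in>UNIV. (1 / q c) *\<^sub>R ((transpose (e x) ** H) $ i $ c * (transpose (e x) ** K) $ a $ c)))"
    unfolding inner_contract ..
  also have "(\<Sum>i\<in>UNIV. \<Sum>a\<in>UNIV. ?gi $ i $ a *\<^sub>R (\<Sum>c\<in>UNIV. (1 / q c) *\<^sub>R ((transpose (e x) ** H) $ i $ c * (transpose (e x) ** K) $ a $ c)))
    = (\<Sum>i\<in>UNIV. \<Sum>a\<in>UNIV. ?gi $ i $ a *\<^sub>R (\<Sum>r\<in>UNIV. \<Sum>s\<in>UNIV. (e x $ r $ i * e x $ s $ a) *\<^sub>R (\<Sum>c\<in>UNIV. H $ r $ c * K $ s $ c / q c)))"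
  proof -
    have "(\<Sum>c\<in>UNIV. (1 / q c) *\<^sub>R ((transpose (e x) ** H) $ i $ c * (transpose (e x) ** K) $ a $ c))
       = (\<Sum>r\<in>UNIV. \<Sum>s\<in>UNIV. (e x $ r $ i * e x $ s $ a) *\<^sub>R (\<Sum>c\<in>UNIV. H $ r $ c * K $ s $ c / q c))" for i a
    proof -
      have "(\<Sum>c\<in>UNIV. (1 / q c) *\<^sub>R ((transpose (e x) ** H) $ i $ c * (transpose (e x) ** K) $ a $ c))
        = (\<Sum>c\<in>UNIV. \<Sum>r\<in>UNIV. \<Sum>s\<in>UNIV. (e x $ r $ i * e x $ s $ a) * (H $ r $ c * K $ s $ c / q c))"
        by (simp add: matrix_matrix_mult_def transpose_def sum_product sum_divide_distrib mult_ac)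
      also have "\<dots> = (\<Sum>r\<in>UNIV. \<Sum>s\<in>UNIV. \<Sum>c\<in>UNIV. (e x $ r $ i * e x $ s $ a) * (H $ r $ c * K $ s $ c / q c))"
        by (rule sum_rotate3)
      finally show ?thesis by (simp add: sum_distrib_left)
    qed
    then show ?thesis by simp
  qed
  also have "\<dots> = (\<Sum>r\<in>UNIV. \<Sum>c\<in>UNIV. H $ r $ c * K $ r $ c / (q r * q c))"
    unfolding contract[OF x] by (simp add: sum_divide_distrib mult_ac)
  finally show ?thesis .
qed

context
  fixes x K
  assumes x: "x \<in> U"
    and K: "\<And>i j. Om i j x = (\<Sum>c\<in>UNIV. \<Sum>d\<in>UNIV. (e x $ c $ i * e x $ d $ j) *\<^sub>R K c d)"
begin

lemma riem_frame:
  "(\<chi> l k. riem g l k i j x) = matrix_inv (e x) ** Om i j x ** e x"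
proof -
  have "(\<chi> l k. riem g l k i j x) = (matrix_inv (e x) ** e x) ** (\<chi> l k. riem g l k i j x)"
    by (simp add: matrix_inv_left[OF invertible_e[OF x]])
  then show ?thesis by (simp add: frame_riem[OF x] flip: matrix_mul_assoc)
qed

lemma ricci_frame:
  "ricci g x = transpose (e x) ** (\<chi> d b. \<Sum>a\<in>UNIV. K a d $ a $ b) ** e x"
proof -
  have inv: "(\<Sum>i\<in>UNIV. e x $ c $ i * matrix_inv (e x) $ i $ a) = (if c = a then 1 else 0)" for c a
    using matrix_inv_right[OF invertible_e[OF x]]
    by (simp add: vec_eq_iff matrix_matrix_mult_def mat_def)
  have "ricci g x $ j $ k = (transpose (e x) ** (\<chi> d b. \<Sum>a\<in>UNIV. K a d $ a $ b) ** e x) $ j $ k" for j k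
  proof -
    have "ricci g x $ j $ k = (\<Sum>i\<in>UNIV. (\<chi> l k. riem g l k i j x) $ i $ k)"
      by (simp add: ricci_def)
    also have "\<dots> = (\<Sum>i\<in>UNIV. \<Sum>a\<in>UNIV. matrix_inv (e x) $ i $ a * (\<Sum>c\<in>UNIV. \<Sum>d\<in>UNIV. (e x $ c $ i * e x $ d $ j) * (K c d ** e x) $ a $ k))"
      unfolding riem_frame matrix_mul_assoc[symmetric] K
      by (simp add: matrix_matrix_mult_def[of "matrix_inv _"] matmul.sum_left matmul_simps)
    also have "\<dots> = (\<Sum>i\<in>UNIV. \<Sum>a\<in>UNIV. \<Sum>c\<in>UNIV. (e x $ c $ i * matrix_inv (e x) $ i $ a) * (\<Sum>d\<in>UNIV. e x $ d $ j * (K c d ** e x) $ a $ k))"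
      by (simp add: sum_distrib_left mult_ac)
    also have "\<dots> = (\<Sum>a\<in>UNIV. \<Sum>c\<in>UNIV. \<Sum>i\<in>UNIV. (e x $ c $ i * matrix_inv (e x) $ i $ a) * (\<Sum>d\<in>UNIV. e x $ d $ j * (K c d ** e x) $ a $ k))"
      by (rule sum_rotate3)
    also have "\<dots> = (\<Sum>a\<in>UNIV. \<Sum>d\<in>UNIV. e x $ d $ j * (K a d ** e x) $ a $ k)"
      by (simp add: inv if_distrib if_distribR flip: sum_distrib_right cong: if_cong)
    also have "\<dots> = (\<Sum>d\<in>UNIV. \<Sum>a\<in>UNIV. \<Sum>b\<in>UNIV. e x $ d $ j * e x $ b $ k * K a d $ a $ b)"
      by (subst sum.swap) (simp add: matrix_matrix_mult_def sum_distrib_left mult_ac)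
    also have "\<dots> = (\<Sum>d\<in>UNIV. \<Sum>b\<in>UNIV. \<Sum>a\<in>UNIV. e x $ d $ j * e x $ b $ k * K a d $ a $ b)"
      by (rule sum_swap_inner)
    finally show ?thesis by (simp add: congruence_nth sum_distrib_left)
  qed
  then show ?thesis by (simp add: vec_eq_iff)
qed

lemma curv_action_frame:
  assumes "h x = transpose (e x) ** H ** e x"
  shows "curv_action g h x = transpose (e x) ** (\<chi> d a. \<Sum>c\<in>UNIV. (transpose (K c d) ** H) $ a $ c / q c) ** e x"
proof -
  let ?gi = "matrix_inv (g x)"
  have "curv_action g h x $ i $ j = (transpose (e x) ** (\<chi> d a. \<Sum>c\<in>UNIV. (transpose (K c d) ** H) $ a $ c / q c) ** e x) $ i $ j" for i j
  proof -
    have 1: "(\<Sum>l\<in>UNIV. riem g l j a i x * h x $ l $ b) =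
       (\<Sum>c\<in>UNIV. \<Sum>r\<in>UNIV. (e x $ c $ a * e x $ r $ b) *\<^sub>R (\<Sum>d\<in>UNIV. e x $ d $ i * (transpose (e x) ** transpose (K c d) ** H) $ j $ r))" for a b
    proof -
      have "(\<Sum>l\<in>UNIV. riem g l j a i x * h x $ l $ b) = (transpose (\<chi> l k. riem g l k a i x) ** h x) $ j $ b"
        by (simp add: matrix_matrix_mult_def transpose_def)
      also have "transpose (\<chi> l k. riem g l k a i x) ** h x = transpose (e x) ** transpose (Om a i x) ** (transpose (matrix_inv (e x)) ** transpose (e x)) ** H ** e x"
        unfolding riem_frame assms by (simp add: matrix_transpose_mul matrix_mul_assoc)
      also have "transpose (matrix_inv (e x)) ** transpose (e x) = mat 1"
        using matrix_inv_right[OF invertible_e[OF x]] by (simp flip: matrix_transpose_mul)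
      finally have "(\<Sum>l\<in>UNIV. riem g l j a i x * h x $ l $ b) = (transpose (e x) ** transpose (Om a i x) ** H ** e x) $ j $ b"
        by simp
      also have "\<dots> = (\<Sum>c\<in>UNIV. \<Sum>d\<in>UNIV. (e x $ c $ a * e x $ d $ i) * (\<Sum>r\<in>UNIV. (transpose (e x) ** transpose (K c d) ** H) $ j $ r * e x $ r $ b))"
        unfolding K by (simp add: matmul.sum_left matmul.sum_right matmul_simps transpose_simps transpose_sum
            flip: matmul_nth)
      also have "\<dots> = (\<Sum>c\<in>UNIV. \<Sum>d\<in>UNIV. \<Sum>r\<in>UNIV. (e x $ c $ a * e x $ r $ b) * (e x $ d $ i * (transpose (e x) ** transpose (K c d) ** H) $ j $ r))"
        by (simp add: sum_distrib_left mult_ac)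
      also have "\<dots> = (\<Sum>c\<in>UNIV. \<Sum>r\<in>UNIV. \<Sum>d\<in>UNIV. (e x $ c $ a * e x $ r $ b) * (e x $ d $ i * (transpose (e x) ** transpose (K c d) ** H) $ j $ r))"
        by (rule sum_swap_inner)
      finally show ?thesis by (simp add: sum_distrib_left)
    qed
    have "curv_action g h x $ i $ j = (\<Sum>a\<in>UNIV. \<Sum>b\<in>UNIV. ?gi $ a $ b *\<^sub>R (\<Sum>l\<in>UNIV. riem g l j a i x * h x $ l $ b))"
      by (simp add: curv_action_def sum_distrib_left mult_ac)
    also have "\<dots> = (\<Sum>c\<in>UNIV. (1 / q c) *\<^sub>R (\<Sum>d\<in>UNIV. e x $ d $ i * (transpose (e x) ** transpose (K c d) ** H) $ j $ c))"
      unfolding 1 by (rule contract[OF x])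
    also have "\<dots> = (\<Sum>d\<in>UNIV. \<Sum>c\<in>UNIV. \<Sum>a\<in>UNIV. e x $ d $ i * e x $ a $ j * ((transpose (K c d) ** H) $ a $ c / q c))"
      unfolding matrix_mul_assoc[symmetric] matmul_nth[of "transpose (e x)"] scaleR_sum_right
      by (subst sum.swap) (simp add: transpose_nth sum_distrib_left sum_divide_distrib mult_ac)
    also have "\<dots> = (\<Sum>d\<in>UNIV. \<Sum>a\<in>UNIV. \<Sum>c\<in>UNIV. e x $ d $ i * e x $ a $ j * ((transpose (K c d) ** H) $ a $ c / q c))"
      by (rule sum_swap_inner)
    finally show ?thesis by (simp add: congruence_nth sum_distrib_left)
  qed
  then show ?thesis by (simp add: vec_eq_iff)
qed

end

end

section \<open>The Lie algebra so(5) and its decomposition\<close>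

definition vec5 :: "'a \<Rightarrow> 'a \<Rightarrow> 'a \<Rightarrow> 'a \<Rightarrow> 'a \<Rightarrow> 'a^5" where
  "vec5 x1 x2 x3 x4 x5 = (\<chi> i. if i = 1 then x1 else if i = 2 then x2 else if i = 3 then x3 else if i = 4 then x4 else x5)"

lemma vec5_nth [simp]:
  "vec5 x1 x2 x3 x4 x5 $ 1 = x1"
  "vec5 x1 x2 x3 x4 x5 $ 2 = x2"
  "vec5 x1 x2 x3 x4 x5 $ 3 = x3"
  "vec5 x1 x2 x3 x4 x5 $ 4 = x4"
  "vec5 x1 x2 x3 x4 x5 $ 5 = x5"
  by (simp_all add: vec5_def)

lemma vec5_eq: "vec5 x1 x2 x3 x4 x5 = vec5 y1 y2 y3 y4 y5 \<longleftrightarrow> x1 = y1 \<and> x2 = y2 \<and> x3 = y3 \<and> x4 = y4 \<and> x5 = y5"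
  by (simp add: vec_eq_iff forall_5)

lemma vec5_eq_0: "vec5 x1 x2 x3 x4 x5 = 0 \<longleftrightarrow> x1 = 0 \<and> x2 = 0 \<and> x3 = 0 \<and> x4 = 0 \<and> x5 = 0"
  "0 = vec5 x1 x2 x3 x4 x5 \<longleftrightarrow> x1 = 0 \<and> x2 = 0 \<and> x3 = 0 \<and> x4 = 0 \<and> x5 = 0"
  by (auto simp add: vec_eq_iff forall_5)

lemma vec5_expand: "x = vec5 (x $ 1) (x $ 2) (x $ 3) (x $ 4) (x $ 5)"
  by (simp add: vec_eq_iff forall_5)

lemma vec5_linear:
  "vec5 x1 x2 x3 x4 x5 + vec5 y1 y2 y3 y4 y5 = vec5 (x1 + y1) (x2 + y2) (x3 + y3) (x4 + y4) (x5 + y5)"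
  "vec5 x1 x2 x3 x4 x5 - vec5 y1 y2 y3 y4 y5 = vec5 (x1 - y1) (x2 - y2) (x3 - y3) (x4 - y4) (x5 - y5)"
  "- vec5 x1 x2 x3 x4 x5 = vec5 (- x1) (- x2) (- x3) (- x4) (- x5)"
  "c *\<^sub>R vec5 z1 z2 z3 z4 z5 = vec5 (c *\<^sub>R z1) (c *\<^sub>R z2) (c *\<^sub>R z3) (c *\<^sub>R z4) (c *\<^sub>R z5)"
  by (simp_all add: vec_eq_iff forall_5)

lemma vec5_inner: "vec5 x1 x2 x3 x4 x5 \<bullet> vec5 y1 y2 y3 y4 y5 = x1 \<bullet> y1 + x2 \<bullet> y2 + x3 \<bullet> y3 + x4 \<bullet> y4 + x5 \<bullet> y5"
  by (simp add: inner_vec_def sum_5)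

text \<open>Products are computed row by row on explicit vectors, so that identities in so(5) reduce
  to arithmetic of entries without expanding sums over indices.\<close>

lemma vec5_matmul:
  "vec5 x1 x2 x3 x4 x5 ** A = vec5 (x1 v* A) (x2 v* A) (x3 v* A) (x4 v* A) (x5 v* A)"
  "vec5 x1 x2 x3 x4 x5 *v x = vec5 (x1 \<bullet> x) (x2 \<bullet> x) (x3 \<bullet> x) (x4 \<bullet> x) (x5 \<bullet> x)"
  for A :: "real^'n^'m"
  by (simp_all add: vec_eq_iff forall_5 matrix_matrix_mult_def vector_matrix_mult_def matrix_vector_mult_def inner_vec_def mult.commute)

lemma vec5_vecmat: "vec5 x1 x2 x3 x4 x5 v* vec5 y1 y2 y3 y4 y5 = x1 *\<^sub>R y1 + x2 *\<^sub>R y2 + x3 *\<^sub>R y3 + x4 *\<^sub>R y4 + x5 *\<^sub>R y5"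
  for y1 :: "real^'n"
  by (simp add: vec_eq_iff vector_matrix_mult_def sum_5)

lemma vec5_transpose: "transpose (vec5 (vec5 a11 a12 a13 a14 a15) (vec5 a21 a22 a23 a24 a25) (vec5 a31 a32 a33 a34 a35) (vec5 a41 a42 a43 a44 a45) (vec5 a51 a52 a53 a54 a55)) =
  vec5 (vec5 a11 a21 a31 a41 a51) (vec5 a12 a22 a32 a42 a52) (vec5 a13 a23 a33 a43 a53) (vec5 a14 a24 a34 a44 a54) (vec5 a15 a25 a35 a45 a55)"
  by (simp add: vec_eq_iff forall_5 transpose_nth)

lemma UNIV_7: "(UNIV :: 7 set) = {1, 2, 3, 4, 5, 6, 7}"
proof -
  have "card {1, 2, 3, 4, 5, 6, 7 :: 7} = CARD(7)" by simp
  then show ?thesis by (metis card_subset_eq finite subset_UNIV)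
qed

lemma sum_7: "sum f (UNIV :: 7 set) = f 1 + f 2 + f 3 + f 4 + f 5 + f 6 + f 7"
  unfolding UNIV_7 by (simp add: add.assoc)

lemma forall_7: "(\<forall>a :: 7. P a) \<longleftrightarrow> P 1 \<and> P 2 \<and> P 3 \<and> P 4 \<and> P 5 \<and> P 6 \<and> P 7"
  using UNIV_7 by (metis UNIV_I empty_iff insert_iff)

definition vec7 :: "'a \<Rightarrow> 'a \<Rightarrow> 'a \<Rightarrow> 'a \<Rightarrow> 'a \<Rightarrow> 'a \<Rightarrow> 'a \<Rightarrow> 'a^7" where
  "vec7 x1 x2 x3 x4 x5 x6 x7 = (\<chi> i. if i = 1 then x1 else if i = 2 then x2 else if i = 3 then x3 else if i = 4 then x4 else if i = 5 then x5 else if i = 6 then x6 else x7)"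

lemma vec7_nth [simp]:
  "vec7 x1 x2 x3 x4 x5 x6 x7 $ 1 = x1"
  "vec7 x1 x2 x3 x4 x5 x6 x7 $ 2 = x2"
  "vec7 x1 x2 x3 x4 x5 x6 x7 $ 3 = x3"
  "vec7 x1 x2 x3 x4 x5 x6 x7 $ 4 = x4"
  "vec7 x1 x2 x3 x4 x5 x6 x7 $ 5 = x5"
  "vec7 x1 x2 x3 x4 x5 x6 x7 $ 6 = x6"
  "vec7 x1 x2 x3 x4 x5 x6 x7 $ 7 = x7"
  by (simp_all add: vec7_def)

lemma vec7_eq: "vec7 x1 x2 x3 x4 x5 x6 x7 = vec7 y1 y2 y3 y4 y5 y6 y7 \<longleftrightarrow> x1 = y1 \<and> x2 = y2 \<and> x3 = y3 \<and> x4 = y4 \<and> x5 = y5 \<and> x6 = y6 \<and> x7 = y7"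
  by (simp add: vec_eq_iff forall_7)

lemma vec7_eq_0: "vec7 x1 x2 x3 x4 x5 x6 x7 = 0 \<longleftrightarrow> x1 = 0 \<and> x2 = 0 \<and> x3 = 0 \<and> x4 = 0 \<and> x5 = 0 \<and> x6 = 0 \<and> x7 = 0"
  "0 = vec7 x1 x2 x3 x4 x5 x6 x7 \<longleftrightarrow> x1 = 0 \<and> x2 = 0 \<and> x3 = 0 \<and> x4 = 0 \<and> x5 = 0 \<and> x6 = 0 \<and> x7 = 0"
  by (auto simp add: vec_eq_iff forall_7)

lemma vec7_linear:
  "vec7 x1 x2 x3 x4 x5 x6 x7 + vec7 y1 y2 y3 y4 y5 y6 y7 = vec7 (x1 + y1) (x2 + y2) (x3 + y3) (x4 + y4) (x5 + y5) (x6 + y6) (x7 + y7)"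
  "vec7 x1 x2 x3 x4 x5 x6 x7 - vec7 y1 y2 y3 y4 y5 y6 y7 = vec7 (x1 - y1) (x2 - y2) (x3 - y3) (x4 - y4) (x5 - y5) (x6 - y6) (x7 - y7)"
  "- vec7 x1 x2 x3 x4 x5 x6 x7 = vec7 (- x1) (- x2) (- x3) (- x4) (- x5) (- x6) (- x7)"
  "c *\<^sub>R vec7 z1 z2 z3 z4 z5 z6 z7 = vec7 (c *\<^sub>R z1) (c *\<^sub>R z2) (c *\<^sub>R z3) (c *\<^sub>R z4) (c *\<^sub>R z5) (c *\<^sub>R z6) (c *\<^sub>R z7)"
  by (simp_all add: vec_eq_iff forall_7)

lemma vec7_inner: "vec7 x1 x2 x3 x4 x5 x6 x7 \<bullet> vec7 y1 y2 y3 y4 y5 y6 y7 = x1 \<bullet> y1 + x2 \<bullet> y2 + x3 \<bullet> y3 + x4 \<bullet> y4 + x5 \<bullet> y5 + x6 \<bullet> y6 + x7 \<bullet> y7"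
  by (simp add: inner_vec_def sum_7)

lemma vec7_matmul:
  "vec7 x1 x2 x3 x4 x5 x6 x7 ** A = vec7 (x1 v* A) (x2 v* A) (x3 v* A) (x4 v* A) (x5 v* A) (x6 v* A) (x7 v* A)"
  "vec7 x1 x2 x3 x4 x5 x6 x7 *v x = vec7 (x1 \<bullet> x) (x2 \<bullet> x) (x3 \<bullet> x) (x4 \<bullet> x) (x5 \<bullet> x) (x6 \<bullet> x) (x7 \<bullet> x)"
  for A :: "real^'n^'m"
  by (simp_all add: vec_eq_iff forall_7 matrix_matrix_mult_def vector_matrix_mult_def matrix_vector_mult_def inner_vec_def mult.commute)

lemma vec7_vecmat: "vec7 x1 x2 x3 x4 x5 x6 x7 v* vec7 y1 y2 y3 y4 y5 y6 y7 = x1 *\<^sub>R y1 + x2 *\<^sub>R y2 + x3 *\<^sub>R y3 + x4 *\<^sub>R y4 + x5 *\<^sub>R y5 + x6 *\<^sub>R y6 + x7 *\<^sub>R y7"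
  for y1 :: "real^'n"
  by (simp add: vec_eq_iff vector_matrix_mult_def sum_7)

lemma vec7_transpose: "transpose (vec7 (vec7 a11 a12 a13 a14 a15 a16 a17) (vec7 a21 a22 a23 a24 a25 a26 a27) (vec7 a31 a32 a33 a34 a35 a36 a37)
    (vec7 a41 a42 a43 a44 a45 a46 a47) (vec7 a51 a52 a53 a54 a55 a56 a57) (vec7 a61 a62 a63 a64 a65 a66 a67) (vec7 a71 a72 a73 a74 a75 a76 a77)) =
  vec7 (vec7 a11 a21 a31 a41 a51 a61 a71) (vec7 a12 a22 a32 a42 a52 a62 a72) (vec7 a13 a23 a33 a43 a53 a63 a73) (vec7 a14 a24 a34 a44 a54 a64 a74) (vec7 a15 a25 a35 a45 a55 a65 a75) (vec7 a16 a26 a36 a46 a56 a66 a76) (vec7 a17 a27 a37 a47 a57 a67 a77)"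
  by (simp add: vec_eq_iff forall_7 transpose_nth)

text \<open>A real weight basis of m under \<open>hbas 1\<close>, as \<open>lamL 1\<close> shows:
  \<open>mbas 3\<close> has weight 0, and the pairs (5, 7), (1, 2), (4, 6) have weights 1, 2, 3. The
  scaling makes the entries of \<open>lamM\<close> and \<open>lamL\<close> rational.\<close>

definition mbas :: "7 \<Rightarrow> real^5^5" where
  "mbas c = vec7
    (vec5 (vec5 0 0 0 0 (sqrt 3)) (vec5 0 0 0 0 0) (vec5 0 0 0 0 0) (vec5 0 0 0 0 0) (vec5 (-sqrt 3) 0 0 0 0))
    (vec5 (vec5 0 0 0 0 0) (vec5 0 0 0 0 0) (vec5 0 0 0 0 0) (vec5 0 0 0 0 (sqrt 3)) (vec5 0 0 0 (-sqrt 3) 0))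
    (vec5 (vec5 0 0 0 1 0) (vec5 0 0 2 0 0) (vec5 0 (-2) 0 0 0) (vec5 (-1) 0 0 0 0) (vec5 0 0 0 0 0))
    (vec5 (vec5 0 0 1 0 0) (vec5 0 0 0 1 0) (vec5 (-1) 0 0 0 0) (vec5 0 (-1) 0 0 0) (vec5 0 0 0 0 0))
    (vec5 (vec5 0 0 3 0 0) (vec5 0 0 0 (-3) (2 * sqrt 3)) (vec5 (-3) 0 0 0 0) (vec5 0 3 0 0 0) (vec5 0 (-2 * sqrt 3) 0 0 0))
    (vec5 (vec5 0 1 0 0 0) (vec5 (-1) 0 0 0 0) (vec5 0 0 0 (-1) 0) (vec5 0 0 1 0 0) (vec5 0 0 0 0 0))
    (vec5 (vec5 0 3 0 0 0) (vec5 (-3) 0 0 0 0) (vec5 0 0 0 3 (2 * sqrt 3)) (vec5 0 0 (-3) 0 0) (vec5 0 0 (-2 * sqrt 3) 0 0)) $ c"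

text \<open>The derivatives at the identity of \<open>so3_irr\<close> along the rotations in the
  three coordinate planes; see \<open>irr_drot\<close>.\<close>

definition hbas :: "3 \<Rightarrow> real^5^5" where
  "hbas c = vector [
    vec5 (vec5 0 0 0 (-2) 0) (vec5 0 0 1 0 0) (vec5 0 (-1) 0 0 0) (vec5 2 0 0 0 0) (vec5 0 0 0 0 0),
    vec5 (vec5 0 0 1 0 0) (vec5 0 0 0 (-1) (-sqrt 3)) (vec5 (-1) 0 0 0 0) (vec5 0 1 0 0 0) (vec5 0 (sqrt 3) 0 0 0),
    vec5 (vec5 0 1 0 0 0) (vec5 (-1) 0 0 0 0) (vec5 0 0 0 1 (-sqrt 3)) (vec5 0 0 (-1) 0 0) (vec5 0 0 (sqrt 3) 0 0)] $ c"

text \<open>These are squared Frobenius norms of the basis matrices, by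
  \<open>basis_orthogonal\<close>. The 10 in \<open>eta\<close> is likewise the squared norm of each
  \<open>hbas i\<close>.\<close>

definition nrm :: "7 \<Rightarrow> real" where
  "nrm c = vec7 6 6 10 4 60 4 60 $ c"

definition theta :: "real^5^5 \<Rightarrow> real^7" where
  "theta X = (\<chi> c. (mbas c \<bullet> X) / nrm c)"

definition eta :: "real^5^5 \<Rightarrow> real^3" where
  "eta X = (\<chi> c. (hbas c \<bullet> X) / 10)"

text \<open>\<open>lamM c\<close> and \<open>lamL c\<close> are the matrices of \<open>(1/2) [mbas c, _]\<close>, projected to the span of
  \<open>mbas\<close>, and of \<open>[hbas c, _]\<close>.\<close>

definition lamM :: "7 \<Rightarrow> real^7^7" where
  "lamM c = vec7
    (vec7 (vec7 0 0 0 0 0 0 0)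
      (vec7 0 0 (1/2) 0 0 0 0)
      (vec7 0 (-3/10) 0 0 0 0 0)
      (vec7 0 0 0 0 0 0 (-3/2))
      (vec7 0 0 0 0 0 (1/10) 0)
      (vec7 0 0 0 0 (-3/2) 0 0)
      (vec7 0 0 0 (1/10) 0 0 0))
    (vec7 (vec7 0 0 (-1/2) 0 0 0 0)
      (vec7 0 0 0 0 0 0 0)
      (vec7 (3/10) 0 0 0 0 0 0)
      (vec7 0 0 0 0 (3/2) 0 0)
      (vec7 0 0 0 (-1/10) 0 0 0)
      (vec7 0 0 0 0 0 0 (-3/2))
      (vec7 0 0 0 0 0 (1/10) 0))
    (vec7 (vec7 0 (1/2) 0 0 0 0 0)
      (vec7 (-1/2) 0 0 0 0 0 0)
      (vec7 0 0 0 0 0 0 0)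
      (vec7 0 0 0 0 0 (-1/2) 0)
      (vec7 0 0 0 0 0 0 (-1/2))
      (vec7 0 0 0 (1/2) 0 0 0)
      (vec7 0 0 0 0 (1/2) 0 0))
    (vec7 (vec7 0 0 0 0 0 0 1)
      (vec7 0 0 0 0 (-1) 0 0)
      (vec7 0 0 0 0 0 (1/5) 0)
      (vec7 0 0 0 0 0 0 0)
      (vec7 0 (1/10) 0 0 0 0 0)
      (vec7 0 0 (-1/2) 0 0 0 0)
      (vec7 (-1/10) 0 0 0 0 0 0))
    (vec7 (vec7 0 0 0 0 0 (-1) 0)
      (vec7 0 0 0 1 0 0 0)
      (vec7 0 0 0 0 0 0 3)
      (vec7 0 (-3/2) 0 0 0 0 0)
      (vec7 0 0 0 0 0 0 0)
      (vec7 (3/2) 0 0 0 0 0 0)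
      (vec7 0 0 (-1/2) 0 0 0 0))
    (vec7 (vec7 0 0 0 0 1 0 0)
      (vec7 0 0 0 0 0 0 1)
      (vec7 0 0 0 (-1/5) 0 0 0)
      (vec7 0 0 (1/2) 0 0 0 0)
      (vec7 (-1/10) 0 0 0 0 0 0)
      (vec7 0 0 0 0 0 0 0)
      (vec7 0 (-1/10) 0 0 0 0 0))
    (vec7 (vec7 0 0 0 (-1) 0 0 0)
      (vec7 0 0 0 0 0 (-1) 0)
      (vec7 0 0 0 0 (-3) 0 0)
      (vec7 (3/2) 0 0 0 0 0 0)
      (vec7 0 0 (1/2) 0 0 0 0)
      (vec7 0 (3/2) 0 0 0 0 0)
      (vec7 0 0 0 0 0 0 0)) $ c"

definition lamL :: "3 \<Rightarrow> real^7^7" where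
  "lamL c = vector [
    vec7 (vec7 0 (-2) 0 0 0 0 0)
      (vec7 2 0 0 0 0 0 0)
      (vec7 0 0 0 0 0 0 0)
      (vec7 0 0 0 0 0 (-3) 0)
      (vec7 0 0 0 0 0 0 1)
      (vec7 0 0 0 3 0 0 0)
      (vec7 0 0 0 0 (-1) 0 0),
    vec7 (vec7 0 0 0 0 0 1 5)
      (vec7 0 0 0 (-1) 5 0 0)
      (vec7 0 0 0 0 0 0 6)
      (vec7 0 (3/2) 0 0 0 0 0)
      (vec7 0 (-1/2) 0 0 0 0 0)
      (vec7 (-3/2) 0 0 0 0 0 0)
      (vec7 (-1/2) 0 (-1) 0 0 0 0),
    vec7 (vec7 0 0 0 1 5 0 0)
      (vec7 0 0 0 0 0 1 (-5))
      (vec7 0 0 0 0 (-6) 0 0)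
      (vec7 (-3/2) 0 0 0 0 0 0)
      (vec7 (-1/2) 0 1 0 0 0 0)
      (vec7 0 (-3/2) 0 0 0 0 0)
      (vec7 0 (1/2) 0 0 0 0 0)] $ c"

text \<open>The Nomizu map of the Levi-Civita connection of a normal homogeneous metric: half of the
  m-part of the bracket on m, and the isotropy representation on so(3).\<close>

definition Lam :: "real^5^5 \<Rightarrow> real^7^7" where
  "Lam X = (\<Sum>c\<in>UNIV. theta X $ c *\<^sub>R lamM c) + (\<Sum>c\<in>UNIV. eta X $ c *\<^sub>R lamL c)"

definition curv :: "real^5^5 \<Rightarrow> real^5^5 \<Rightarrow> real^7^7" where
  "curv X Y = Lam X ** Lam Y - Lam Y ** Lam X - Lam (bracket X Y)"

lemma mbas_skew: "transpose (mbas c) = - mbas c"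
  and hbas_skew: "transpose (hbas d) = - hbas d"
proof -
  have "\<forall>c. transpose (mbas c) = - mbas c" "\<forall>d. transpose (hbas d) = - hbas d"
    by (simp_all add: forall_7 forall_3 mbas_def hbas_def vec5_transpose vec5_linear)
  then show "transpose (mbas c) = - mbas c" "transpose (hbas d) = - hbas d" by auto
qed

lemma theta_nth: "theta X $ c = (mbas c \<bullet> X) / nrm c"
  and eta_nth: "eta X $ d = (hbas d \<bullet> X) / 10"
  by (simp_all add: theta_def eta_def)

lemma nrm_pos: "nrm c > 0"
proof -
  have "\<forall>c. nrm c > 0" by (simp add: forall_7 nrm_def)
  then show ?thesis by blast
qed

lemma theta_linear: "linear theta" and eta_linear: "linear eta"
  by (auto simp: linear_iff theta_def eta_def vec_eq_iff inner_add_right add_divide_distrib)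

lemma Lam_linear: "linear Lam"
  by (auto simp: linear_iff Lam_def linear_add[OF theta_linear] linear_add[OF eta_linear]
      linear_cmul[OF theta_linear] linear_cmul[OF eta_linear] algebra_simps sum.distrib scaleR_sum_right)

lemma basis_orthogonal:
  "mbas c \<bullet> mbas d = (if c = d then nrm c else 0)"
  "hbas i \<bullet> hbas j = (if i = j then 10 else 0)"
  "mbas c \<bullet> hbas i = 0" "hbas i \<bullet> mbas c = 0"
proof -
  have "\<forall>c d. mbas c \<bullet> mbas d = (if c = d then nrm c else 0)"
    "\<forall>i j. hbas i \<bullet> hbas j = (if i = j then 10 else 0)" "\<forall>c i. mbas c \<bullet> hbas i = 0"
    by (simp_all add: forall_7 forall_3 mbas_def hbas_def nrm_def vec5_inner)
  then show "mbas c \<bullet> mbas d = (if c = d then nrm c else 0)"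
    "hbas i \<bullet> hbas j = (if i = j then 10 else 0)" "mbas c \<bullet> hbas i = 0" "hbas i \<bullet> mbas c = 0"
    by (auto simp: inner_commute)
qed

lemma theta_basis [simp]: "theta (mbas c) = axis c 1" "theta (hbas i) = 0"
  and eta_basis [simp]: "eta (mbas c) = 0" "eta (hbas i) = axis i 1"
  using nrm_pos[THEN less_imp_neq, symmetric]
  by (simp_all add: vec_eq_iff theta_nth eta_nth basis_orthogonal axis_def)

lemma Lam_basis [simp]: "Lam (mbas c) = lamM c" "Lam (hbas i) = lamL i"
  by (simp_all add: Lam_def axis_def if_distrib if_distribR cong: if_cong)

lemma so5_decomposition:
  assumes "X \<in> so5"
  shows "X = (\<Sum>c\<in>UNIV. theta X $ c *\<^sub>R mbas c) + (\<Sum>i\<in>UNIV. eta X $ i *\<^sub>R hbas i)"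
proof -
  have "transpose X = - X"
    using assms unfolding so5_def mem_Collect_eq .
  then have "transpose X $ a $ b = (- X) $ a $ b" for a b by (rule arg_cong)
  then have sk: "X $ b $ a = - X $ a $ b" for a b
    unfolding transpose_nth vector_uminus_component .
  obtain a b c d e f g h k l where ent: "X $ 1 $ 2 = a" "X $ 1 $ 3 = b" "X $ 1 $ 4 = c" "X $ 1 $ 5 = d"
    "X $ 2 $ 3 = e" "X $ 2 $ 4 = f" "X $ 2 $ 5 = g" "X $ 3 $ 4 = h" "X $ 3 $ 5 = k" "X $ 4 $ 5 = l"
    by blast
  have z: "X $ a $ a = 0" for a using sk[of a a] by linarith
  have X: "X = vec5 (vec5 0 a b c d) (vec5 (-a) 0 e f g) (vec5 (-b) (-e) 0 h k) (vec5 (-c) (-f) (-h) 0 l) (vec5 (-d) (-g) (-k) (-l) 0)"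
    using ent z sk[of 1 2] sk[of 1 3] sk[of 1 4] sk[of 1 5] sk[of 2 3] sk[of 2 4] sk[of 2 5] sk[of 3 4] sk[of 3 5] sk[of 4 5]
    by (simp add: vec_eq_iff forall_5)
  have t: "theta X $ 1 = sqrt 3 * d / 3" "theta X $ 2 = sqrt 3 * l / 3" "theta X $ 3 = (c + 2 * e) / 5"
    "theta X $ 4 = (b + f) / 2" "theta X $ 5 = (3 * b - 3 * f + 2 * sqrt 3 * g) / 30"
    "theta X $ 6 = (a - h) / 2" "theta X $ 7 = (3 * a + 3 * h + 2 * sqrt 3 * k) / 30"
    "eta X $ 1 = (e - 2 * c) / 5" "eta X $ 2 = (b - f - sqrt 3 * g) / 5" "eta X $ 3 = (a + h - sqrt 3 * k) / 5"
    unfolding X theta_nth eta_nth mbas_def hbas_def nrm_def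
    by (simp_all add: vec5_inner)
  show ?thesis
    unfolding sum_7 sum_3 t
    by (subst X) (simp add: mbas_def hbas_def vec5_linear vec5_eq, simp add: field_simps)
qed

text \<open>Claims linear in \<open>X\<close> reduce to the ten basis matrices.\<close>

lemma so5_induct [consumes 1, case_names add scaleR mbas hbas]:
  assumes "X \<in> so5" and add: "\<And>X Y. P X \<Longrightarrow> P Y \<Longrightarrow> P (X + Y)"
    and scaleR: "\<And>a X. P X \<Longrightarrow> P (a *\<^sub>R X)" and "\<And>c. P (mbas c)" "\<And>i. P (hbas i)"
  shows "P X"
proof -
  have "P ((\<Sum>c\<in>UNIV. theta X $ c *\<^sub>R mbas c) + (\<Sum>i\<in>UNIV. eta X $ i *\<^sub>R hbas i))"
    unfolding sum_7 sum_3 by (intro add scaleR assms(4,5))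
  then show ?thesis by (simp flip: so5_decomposition[OF assms(1)])
qed

section \<open>Brackets, torsion and the curvature tensor in the basis\<close>

lemma bracket_linear:
  "bracket (X + Y) Z = bracket X Z + bracket Y Z" "bracket (a *\<^sub>R X) Z = a *\<^sub>R bracket X Z"
  "bracket Z (X + Y) = bracket Z X + bracket Z Y" "bracket Z (a *\<^sub>R X) = a *\<^sub>R bracket Z X"
  "bracket X Y = - bracket Y X" "bracket X X = 0"
  by (simp_all add: bracket_def matmul_simps scaleR_diff_right)

lemma so5_bracket: "X \<in> so5 \<Longrightarrow> Y \<in> so5 \<Longrightarrow> bracket X Y \<in> so5"
  by (simp add: so5_def bracket_def transpose_simps matrix_transpose_mul matmul_simps)

lemma basis_so5 [simp]: "mbas c \<in> so5" "hbas i \<in> so5"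
  by (simp_all add: so5_def mbas_skew hbas_skew)

lemma sqrt3_mult [simp]: "sqrt 3 * (sqrt 3 * x) = 3 * x" "sqrt 3 * (x * sqrt 3) = 3 * x"
  "x * sqrt 3 * sqrt 3 = 3 * x"
proof -
  show "sqrt 3 * (sqrt 3 * x) = 3 * x" by (simp flip: mult.assoc)
  then show "sqrt 3 * (x * sqrt 3) = 3 * x" "x * sqrt 3 * sqrt 3 = 3 * x"
    by (simp_all only: mult.commute[of x] mult.assoc mult.commute[of "x * sqrt 3"])
qed

lemmas vec5_simps = vec5_linear vec5_matmul vec5_vecmat vec5_inner vec5_eq
lemmas vec7_simps = vec7_linear vec7_matmul vec7_vecmat vec7_inner vec7_eq vec7_eq_0

lemma theta_vec7: "theta X = vec7 ((mbas 1 \<bullet> X) / 6) ((mbas 2 \<bullet> X) / 6) ((mbas 3 \<bullet> X) / 10)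
    ((mbas 4 \<bullet> X) / 4) ((mbas 5 \<bullet> X) / 60) ((mbas 6 \<bullet> X) / 4) ((mbas 7 \<bullet> X) / 60)"
  by (simp add: vec_eq_iff forall_7 theta_nth nrm_def)

lemma vec7_column: "column j (vec7 x1 x2 x3 x4 x5 x6 x7) = vec7 (x1 $ j) (x2 $ j) (x3 $ j) (x4 $ j) (x5 $ j) (x6 $ j) (x7 $ j)"
  by (simp add: vec_eq_iff column_def forall_7)

lemmas mbas_vals = mbas_def[of 1, unfolded vec7_nth] mbas_def[of 2, unfolded vec7_nth]
  mbas_def[of 3, unfolded vec7_nth] mbas_def[of 4, unfolded vec7_nth] mbas_def[of 5, unfolded vec7_nth]
  mbas_def[of 6, unfolded vec7_nth] mbas_def[of 7, unfolded vec7_nth]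
lemmas lamM_vals = lamM_def[of 1, unfolded vec7_nth] lamM_def[of 2, unfolded vec7_nth]
  lamM_def[of 3, unfolded vec7_nth] lamM_def[of 4, unfolded vec7_nth] lamM_def[of 5, unfolded vec7_nth]
  lamM_def[of 6, unfolded vec7_nth] lamM_def[of 7, unfolded vec7_nth]
lemmas hbas_vals = hbas_def[of 1, unfolded vector_3] hbas_def[of 2, unfolded vector_3] hbas_def[of 3, unfolded vector_3]
lemmas lamL_vals = lamL_def[of 1, unfolded vector_3] lamL_def[of 2, unfolded vector_3] lamL_def[of 3, unfolded vector_3]
lemmas basis_vals = mbas_vals lamM_vals hbas_vals lamL_vals

text \<open>Each term on the right is half a bracket; by antisymmetry their difference is the whole
  m-part.\<close>

lemma bracket_mbas_theta:
  "theta (bracket (mbas c) (mbas d)) = lamM c *v axis d 1 - lamM d *v axis c 1"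
proof -
  have "\<forall>c d. theta (bracket (mbas c) (mbas d)) = column d (lamM c) - column c (lamM d)"
    unfolding bracket_def theta_vec7 forall_7 basis_vals vec5_matmul vec5_vecmat
    by (simp add: vec5_linear vec5_inner vec7_column vec7_linear vec7_eq vec7_eq_0)
  then show ?thesis by (simp add: matrix_vector_mult_basis)
qed

lemma bracket_hbas_mbas:
  "theta (bracket (hbas i) (mbas d)) = lamL i *v axis d 1"
  "eta (bracket (hbas i) (mbas d)) = 0"
proof -
  have "\<forall>i d. theta (bracket (hbas i) (mbas d)) = column d (lamL i)"
    unfolding bracket_def theta_vec7 forall_7 forall_3 basis_vals vec5_matmul vec5_vecmat
    by (simp add: vec5_linear vec5_inner vec7_column vec7_linear vec7_eq vec7_eq_0)
  then show "theta (bracket (hbas i) (mbas d)) = lamL i *v axis d 1"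
    by (simp add: matrix_vector_mult_basis)
  have "\<forall>i d. eta (bracket (hbas i) (mbas d)) = 0"
    unfolding bracket_def forall_7 forall_3 vec_eq_iff eta_nth basis_vals vec5_matmul vec5_vecmat
    by (simp add: vec5_linear vec5_inner)
  then show "eta (bracket (hbas i) (mbas d)) = 0" by blast
qed

lemma bracket_hbas_hbas: "theta (bracket (hbas i) (hbas j)) = 0"
proof -
  have "\<forall>i j. theta (bracket (hbas i) (hbas j)) = 0"
    unfolding bracket_def theta_vec7 forall_3 basis_vals vec5_matmul vec5_vecmat
    by (simp add: vec5_linear vec5_inner vec7_eq_0)
  then show ?thesis by blast
qed

text \<open>Vanishing torsion in algebraic form. Together with the Maurer-Cartan equation it yields
  the assumption \<open>torsion_free\<close> of the moving frame.\<close>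

lemma theta_bracket:
  assumes "X \<in> so5" "Y \<in> so5"
  shows "theta (bracket X Y) = Lam X *v theta Y - Lam Y *v theta X"
proof -
  note lin = bracket_linear(1-4) linear_add[OF theta_linear] linear_cmul[OF theta_linear]
    linear_add[OF Lam_linear] linear_cmul[OF Lam_linear] matvec.add_left matvec.add_right
    matvec.scaleR_left matvec.scaleR_right add_diff_add scaleR_diff_right
  show ?thesis using assms(1)
  proof (induction rule: so5_induct)
    case (mbas c)
    show ?case using assms(2)
    proof (induction rule: so5_induct)
      case (mbas d) then show ?case by (simp add: bracket_mbas_theta)
    next
      case (hbas i) then show ?case
        using bracket_linear(5)[of "mbas c" "hbas i"] linear_neg[OF theta_linear]
        by (simp add: bracket_hbas_mbas)
    qed (simp_all add: lin)
  next
    case (hbas i)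
    show ?case using assms(2)
      by (induction rule: so5_induct) (simp_all add: bracket_hbas_mbas bracket_hbas_hbas lin)
  qed (simp_all add: lin)
qed

lemma diag_vec7: "diag q = vec7 (vec7 (q 1) 0 0 0 0 0 0) (vec7 0 (q 2) 0 0 0 0 0) (vec7 0 0 (q 3) 0 0 0 0)
  (vec7 0 0 0 (q 4) 0 0 0) (vec7 0 0 0 0 (q 5) 0 0) (vec7 0 0 0 0 0 (q 6) 0) (vec7 0 0 0 0 0 0 (q 7))"
  by (simp add: vec_eq_iff forall_7 diag_def)

text \<open>Metric compatibility in algebraic form: brackets with skew matrices are skew for the
  Frobenius product, and so are their projections to m.\<close>

lemma Lam_skew: "transpose (Lam X) ** diag nrm = - (diag nrm ** Lam X)"
proof -
  have "\<forall>c. transpose (lamM c) ** diag nrm = - (diag nrm ** lamM c)"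
    "\<forall>i. transpose (lamL i) ** diag nrm = - (diag nrm ** lamL i)"
    unfolding forall_7 forall_3 basis_vals diag_vec7 vec7_transpose vec7_matmul vec7_vecmat
    by (simp_all add: nrm_def vec7_linear vec7_eq vec7_eq_0)
  then show ?thesis
    by (simp add: Lam_def transpose_simps transpose_sum matmul_simps matmul.sum_left matmul.sum_right
        sum_negf)
qed

lemma curv_linear:
  "curv (X + Y) Z = curv X Z + curv Y Z" "curv (a *\<^sub>R X) Z = a *\<^sub>R curv X Z"
  "curv Z (X + Y) = curv Z X + curv Z Y" "curv Z (a *\<^sub>R X) = a *\<^sub>R curv Z X"
  "curv X Y = - curv Y X"
  using linear_neg[OF Lam_linear, of "bracket Y X"] bracket_linear(5)[of X Y]
  by (simp_all add: curv_def bracket_linear(1-4) linear_add[OF Lam_linear] linear_cmul[OF Lam_linear]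
      matmul_simps algebra_simps scaleR_diff_right)

lemma Lam_expand:
  "Lam X = ((mbas 1 \<bullet> X) / 6) *\<^sub>R lamM 1 + ((mbas 2 \<bullet> X) / 6) *\<^sub>R lamM 2 + ((mbas 3 \<bullet> X) / 10) *\<^sub>R lamM 3
    + ((mbas 4 \<bullet> X) / 4) *\<^sub>R lamM 4 + ((mbas 5 \<bullet> X) / 60) *\<^sub>R lamM 5 + ((mbas 6 \<bullet> X) / 4) *\<^sub>R lamM 6
    + ((mbas 7 \<bullet> X) / 60) *\<^sub>R lamM 7 + ((hbas 1 \<bullet> X) / 10) *\<^sub>R lamL 1 + ((hbas 2 \<bullet> X) / 10) *\<^sub>R lamL 2
    + ((hbas 3 \<bullet> X) / 10) *\<^sub>R lamL 3"
  by (simp add: Lam_def sum_7 sum_3 theta_nth eta_nth nrm_def)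

text \<open>\<open>Lam\<close> is equivariant under the isotropy algebra, which acts on m by a
  representation. Hence the curvature sees only m-parts, and \<open>curv_eq\<close> can expand it in
  \<open>theta\<close> alone.\<close>

lemma curv_hbas:
  assumes "Y \<in> so5"
  shows "curv (hbas i) Y = 0"
  using assms
proof (induction rule: so5_induct)
  case (mbas c)
  have "\<forall>i c. curv (hbas i) (mbas c) = 0"
    unfolding curv_def Lam_basis bracket_def Lam_expand[of "_ - _"] forall_7 forall_3
    unfolding basis_vals vec5_matmul vec5_vecmat vec7_matmul vec7_vecmat
    by (simp add: vec5_linear vec5_inner vec7_linear vec7_eq vec7_eq_0)
  then show ?case by blast
next
  case (hbas j)
  have "\<forall>i j. curv (hbas i) (hbas j) = 0"
    unfolding curv_def Lam_basis bracket_def Lam_expand[of "_ - _"] forall_7 forall_3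
    unfolding basis_vals vec5_matmul vec5_vecmat vec7_matmul vec7_vecmat
    by (simp add: vec5_linear vec5_inner vec7_linear vec7_eq vec7_eq_0)
  then show ?case by blast
qed (simp_all add: curv_linear(1-4))

text \<open>The whole curvature tensor: the remaining pairs follow by antisymmetry from
  \<open>curv_mbas_flip\<close> and \<open>curv_self\<close>.\<close>

lemma curv_mbas:
  "curv (mbas 1) (mbas 2) = vec7 (vec7 0 (51/20) 0 0 0 0 0)
      (vec7 (-51/20) 0 0 0 0 0 0)
      (vec7 0 0 0 0 0 0 0)
      (vec7 0 0 0 0 0 3 0)
      (vec7 0 0 0 0 0 0 (-9/5))
      (vec7 0 0 0 (-3) 0 0 0)
      (vec7 0 0 0 0 (9/5) 0 0)"
  "curv (mbas 1) (mbas 3) = vec7 (vec7 0 0 (1/4) 0 0 0 0)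
      (vec7 0 0 0 0 0 0 0)
      (vec7 (-3/20) 0 0 0 0 0 0)
      (vec7 0 0 0 0 (-3) 0 0)
      (vec7 0 0 0 (1/5) 0 0 0)
      (vec7 0 0 0 0 0 0 3)
      (vec7 0 0 0 0 0 (-1/5) 0)"
  "curv (mbas 1) (mbas 4) = vec7 (vec7 0 0 0 (7/10) 3 0 0)
      (vec7 0 0 0 0 0 1 (-3))
      (vec7 0 0 0 0 (-12/5) 0 0)
      (vec7 (-21/20) 0 0 0 0 0 0)
      (vec7 (-3/10) 0 (2/5) 0 0 0 0)
      (vec7 0 (-3/2) 0 0 0 0 0)
      (vec7 0 (3/10) 0 0 0 0 0)"
  "curv (mbas 1) (mbas 5) = vec7 (vec7 0 0 0 3 (33/2) 0 0)
      (vec7 0 0 0 0 0 3 (-9))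
      (vec7 0 0 0 (-6/5) (-18) 0 0)
      (vec7 (-9/2) 0 3 0 0 0 0)
      (vec7 (-33/20) 0 3 0 0 0 0)
      (vec7 0 (-9/2) 0 0 0 0 0)
      (vec7 0 (9/10) 0 0 0 0 0)"
  "curv (mbas 1) (mbas 6) = vec7 (vec7 0 0 0 0 0 (7/10) 3)
      (vec7 0 0 0 (-1) 3 0 0)
      (vec7 0 0 0 0 0 0 (12/5))
      (vec7 0 (3/2) 0 0 0 0 0)
      (vec7 0 (-3/10) 0 0 0 0 0)
      (vec7 (-21/20) 0 0 0 0 0 0)
      (vec7 (-3/10) 0 (-2/5) 0 0 0 0)"
  "curv (mbas 1) (mbas 7) = vec7 (vec7 0 0 0 0 0 3 (33/2))
      (vec7 0 0 0 (-3) 9 0 0)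
      (vec7 0 0 0 0 0 (6/5) 18)
      (vec7 0 (9/2) 0 0 0 0 0)
      (vec7 0 (-9/10) 0 0 0 0 0)
      (vec7 (-9/2) 0 (-3) 0 0 0 0)
      (vec7 (-33/20) 0 (-3) 0 0 0 0)"
  "curv (mbas 2) (mbas 3) = vec7 (vec7 0 0 0 0 0 0 0)
      (vec7 0 0 (1/4) 0 0 0 0)
      (vec7 0 (-3/20) 0 0 0 0 0)
      (vec7 0 0 0 0 0 0 (-3))
      (vec7 0 0 0 0 0 (1/5) 0)
      (vec7 0 0 0 0 (-3) 0 0)
      (vec7 0 0 0 (1/5) 0 0 0)"
  "curv (mbas 2) (mbas 4) = vec7 (vec7 0 0 0 0 0 (-1) (-3))
      (vec7 0 0 0 (7/10) (-3) 0 0)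
      (vec7 0 0 0 0 0 0 (-12/5))
      (vec7 0 (-21/20) 0 0 0 0 0)
      (vec7 0 (3/10) 0 0 0 0 0)
      (vec7 (3/2) 0 0 0 0 0 0)
      (vec7 (3/10) 0 (2/5) 0 0 0 0)"
  "curv (mbas 2) (mbas 5) = vec7 (vec7 0 0 0 0 0 3 9)
      (vec7 0 0 0 (-3) (33/2) 0 0)
      (vec7 0 0 0 0 0 (-6/5) 18)
      (vec7 0 (9/2) 0 0 0 0 0)
      (vec7 0 (-33/20) 0 0 0 0 0)
      (vec7 (-9/2) 0 3 0 0 0 0)
      (vec7 (-9/10) 0 (-3) 0 0 0 0)"
  "curv (mbas 2) (mbas 6) = vec7 (vec7 0 0 0 1 3 0 0)
      (vec7 0 0 0 0 0 (7/10) (-3))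
      (vec7 0 0 0 0 (-12/5) 0 0)
      (vec7 (-3/2) 0 0 0 0 0 0)
      (vec7 (-3/10) 0 (2/5) 0 0 0 0)
      (vec7 0 (-21/20) 0 0 0 0 0)
      (vec7 0 (3/10) 0 0 0 0 0)"
  "curv (mbas 2) (mbas 7) = vec7 (vec7 0 0 0 (-3) (-9) 0 0)
      (vec7 0 0 0 0 0 (-3) (33/2))
      (vec7 0 0 0 (-6/5) 18 0 0)
      (vec7 (9/2) 0 3 0 0 0 0)
      (vec7 (9/10) 0 (-3) 0 0 0 0)
      (vec7 0 (9/2) 0 0 0 0 0)
      (vec7 0 (-33/20) 0 0 0 0 0)"
  "curv (mbas 3) (mbas 4) = vec7 (vec7 0 0 0 0 (-2) 0 0)
      (vec7 0 0 0 0 0 0 (-2))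
      (vec7 0 0 0 (1/10) 0 0 0)
      (vec7 0 0 (-1/4) 0 0 0 0)
      (vec7 (1/5) 0 0 0 0 0 0)
      (vec7 0 0 0 0 0 0 0)
      (vec7 0 (1/5) 0 0 0 0 0)"
  "curv (mbas 3) (mbas 5) = vec7 (vec7 0 0 0 (-4) (-30) 0 0)
      (vec7 0 0 0 0 0 (-4) 30)
      (vec7 0 0 0 0 (75/2) 0 0)
      (vec7 6 0 0 0 0 0 0)
      (vec7 3 0 (-25/4) 0 0 0 0)
      (vec7 0 6 0 0 0 0 0)
      (vec7 0 (-3) 0 0 0 0 0)"
  "curv (mbas 3) (mbas 6) = vec7 (vec7 0 0 0 0 0 0 2)
      (vec7 0 0 0 0 (-2) 0 0)
      (vec7 0 0 0 0 0 (1/10) 0)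
      (vec7 0 0 0 0 0 0 0)
      (vec7 0 (1/5) 0 0 0 0 0)
      (vec7 0 0 (-1/4) 0 0 0 0)
      (vec7 (-1/5) 0 0 0 0 0 0)"
  "curv (mbas 3) (mbas 7) = vec7 (vec7 0 0 0 0 0 4 30)
      (vec7 0 0 0 (-4) 30 0 0)
      (vec7 0 0 0 0 0 0 (75/2))
      (vec7 0 6 0 0 0 0 0)
      (vec7 0 (-3) 0 0 0 0 0)
      (vec7 (-6) 0 0 0 0 0 0)
      (vec7 (-3) 0 (-25/4) 0 0 0 0)"
  "curv (mbas 4) (mbas 5) = vec7 (vec7 0 0 (-2) 0 0 0 0)
      (vec7 0 0 0 0 0 0 0)
      (vec7 (6/5) 0 0 0 0 0 0)
      (vec7 0 0 0 0 (3/2) 0 0)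
      (vec7 0 0 0 (-1/10) 0 0 0)
      (vec7 0 0 0 0 0 0 (-6))
      (vec7 0 0 0 0 0 (2/5) 0)"
  "curv (mbas 4) (mbas 6) = vec7 (vec7 0 2 0 0 0 0 0)
      (vec7 (-2) 0 0 0 0 0 0)
      (vec7 0 0 0 0 0 0 0)
      (vec7 0 0 0 0 0 (37/10) 0)
      (vec7 0 0 0 0 0 0 (-4/5))
      (vec7 0 0 0 (-37/10) 0 0 0)
      (vec7 0 0 0 0 (4/5) 0 0)"
  "curv (mbas 4) (mbas 7) = vec7 (vec7 0 0 0 0 0 0 0)
      (vec7 0 0 (-2) 0 0 0 0)
      (vec7 0 (6/5) 0 0 0 0 0)
      (vec7 0 0 0 0 0 0 (3/2))
      (vec7 0 0 0 0 0 (-2/5) 0)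
      (vec7 0 0 0 0 6 0 0)
      (vec7 0 0 0 (-1/10) 0 0 0)"
  "curv (mbas 5) (mbas 6) = vec7 (vec7 0 0 0 0 0 0 0)
      (vec7 0 0 2 0 0 0 0)
      (vec7 0 (-6/5) 0 0 0 0 0)
      (vec7 0 0 0 0 0 0 (-6))
      (vec7 0 0 0 0 0 (1/10) 0)
      (vec7 0 0 0 0 (-3/2) 0 0)
      (vec7 0 0 0 (2/5) 0 0 0)"
  "curv (mbas 5) (mbas 7) = vec7 (vec7 0 (-18) 0 0 0 0 0)
      (vec7 18 0 0 0 0 0 0)
      (vec7 0 0 0 0 0 0 0)
      (vec7 0 0 0 0 0 (-12) 0)
      (vec7 0 0 0 0 0 0 (15/2))
      (vec7 0 0 0 12 0 0 0)
      (vec7 0 0 0 0 (-15/2) 0 0)"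
  "curv (mbas 6) (mbas 7) = vec7 (vec7 0 0 2 0 0 0 0)
      (vec7 0 0 0 0 0 0 0)
      (vec7 (-6/5) 0 0 0 0 0 0)
      (vec7 0 0 0 0 (-6) 0 0)
      (vec7 0 0 0 (2/5) 0 0 0)
      (vec7 0 0 0 0 0 0 (3/2))
      (vec7 0 0 0 0 0 (-1/10) 0)"
  unfolding curv_def Lam_basis bracket_def Lam_expand[of "_ - _"]
  unfolding basis_vals vec5_matmul vec5_vecmat vec7_matmul vec7_vecmat
  by (simp_all add: vec5_linear vec5_inner vec7_linear vec7_eq vec7_eq_0)

lemma curv_eq:
  assumes "X \<in> so5" "Y \<in> so5"
  shows "curv X Y = (\<Sum>c\<in>UNIV. \<Sum>d\<in>UNIV. (theta X $ c * theta Y $ d) *\<^sub>R curv (mbas c) (mbas d))"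
proof -
  note lin = curv_linear(1-4) linear_add[OF theta_linear] linear_cmul[OF theta_linear]
    scaleR_add_left sum.distrib scaleR_sum_right
  have 0: "curv (mbas c) (hbas i) = 0" for c i
    using curv_linear(5)[of "mbas c" "hbas i"] curv_hbas[of "mbas c" i] by simp
  have axis: "(\<Sum>c\<in>UNIV. axis d (1::real) $ c *\<^sub>R f c) = f d" for d and f :: "7 \<Rightarrow> real^7^7"
    by (simp add: axis_def if_distrib if_distribR cong: if_cong)
  have "curv (mbas c) Y = (\<Sum>d\<in>UNIV. theta Y $ d *\<^sub>R curv (mbas c) (mbas d))" for c
    using assms(2) by (induction rule: so5_induct) (simp_all add: lin 0 axis)
  moreover have "curv X Y = (\<Sum>c\<in>UNIV. theta X $ c *\<^sub>R curv (mbas c) Y)"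
    using assms(1) by (induction rule: so5_induct) (simp_all add: lin curv_hbas[OF assms(2)] axis)
  ultimately show ?thesis by (simp add: scaleR_sum_right)
qed

lemma curv_self: "curv X X = 0"
  by (simp add: curv_def bracket_linear(6) linear_0[OF Lam_linear])

lemmas curv_mbas_flip = curv_linear(5)[of "mbas 2" "mbas 1"]
  curv_linear(5)[of "mbas 3" "mbas 1"]
  curv_linear(5)[of "mbas 3" "mbas 2"]
  curv_linear(5)[of "mbas 4" "mbas 1"]
  curv_linear(5)[of "mbas 4" "mbas 2"]
  curv_linear(5)[of "mbas 4" "mbas 3"]
  curv_linear(5)[of "mbas 5" "mbas 1"]
  curv_linear(5)[of "mbas 5" "mbas 2"]
  curv_linear(5)[of "mbas 5" "mbas 3"]
  curv_linear(5)[of "mbas 5" "mbas 4"]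
  curv_linear(5)[of "mbas 6" "mbas 1"]
  curv_linear(5)[of "mbas 6" "mbas 2"]
  curv_linear(5)[of "mbas 6" "mbas 3"]
  curv_linear(5)[of "mbas 6" "mbas 4"]
  curv_linear(5)[of "mbas 6" "mbas 5"]
  curv_linear(5)[of "mbas 7" "mbas 1"]
  curv_linear(5)[of "mbas 7" "mbas 2"]
  curv_linear(5)[of "mbas 7" "mbas 3"]
  curv_linear(5)[of "mbas 7" "mbas 4"]
  curv_linear(5)[of "mbas 7" "mbas 5"]
  curv_linear(5)[of "mbas 7" "mbas 6"]

text \<open>The isotropy representation m is irreducible, so the Ricci form is a multiple of the
  metric. Here 27/20 = 3 * 9/20, where 9/20 is the Einstein constant for minus the Killing form and
  3 is the factor of \<open>killing_so5\<close>.\<close>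

lemma ricci_constant:
  "(\<chi> d b. \<Sum>a\<in>UNIV. curv (mbas a) (mbas d) $ a $ b) = (27 / 20) *\<^sub>R diag nrm"
  unfolding vec_eq_iff forall_7
  by (simp add: sum_7 curv_mbas_flip curv_self curv_mbas diag_def nrm_def)

section \<open>The destabilizing tensor at the base point\<close>

text \<open>\<open>Hf w\<close> is, up to a factor, the matrix of the form \<open>(X, Y) \<mapsto> cub w \<bullet> (X Y + Y X)\<close> in the basis \<open>mbas\<close>
  (lemma \<open>cub_mbas\<close>).  Dividing the last coordinate by \<open>sqrt 3\<close> makes all entries rational.\<close>

definition Hx :: "real \<Rightarrow> real \<Rightarrow> real \<Rightarrow> real \<Rightarrow> real \<Rightarrow> real^7^7" where
  "Hx a b c d z = vec7 (vec7 0 0 (-4 * d) (2 * c) (-6 * c) (2 * b) (-6 * b))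
      (vec7 0 0 (4 * a) (-2 * b) (-6 * b) (2 * c) (6 * c))
      (vec7 (-4 * d) (4 * a) (8 * z) 0 (-4 * c) 0 (4 * b))
      (vec7 (2 * c) (-2 * b) 0 (-4 * z) (4 * d) 0 (-4 * a))
      (vec7 (-6 * c) (-6 * b) (-4 * c) (4 * d) (24 * d + 36 * z) (-4 * a) (24 * a))
      (vec7 (2 * b) (2 * c) 0 0 (-4 * a) (-4 * z) (-4 * d))
      (vec7 (-6 * b) (6 * c) (4 * b) (-4 * a) (24 * a) (-4 * d) (-24 * d + 36 * z))"

definition Hf :: "real^5 \<Rightarrow> real^7^7" where
  "Hf w = Hx (w $ 1) (w $ 2) (w $ 3) (w $ 4) (w $ 5 / sqrt 3)"

text \<open>With the last coordinate written as \<open>sqrt 3 * z\<close>, the action on R^5 has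
  rational coefficients, as \<open>Hx\<close> has.\<close>

lemma mbas_mult_vec:
  "mbas 1 *v vec5 a b c d (sqrt 3 * z) = vec5 (3 * z) 0 0 0 (sqrt 3 * (- a))"
  "mbas 2 *v vec5 a b c d (sqrt 3 * z) = vec5 0 0 0 (3 * z) (sqrt 3 * (- d))"
  "mbas 3 *v vec5 a b c d (sqrt 3 * z) = vec5 d (2 * c) (-2 * b) (- a) (sqrt 3 * 0)"
  "mbas 4 *v vec5 a b c d (sqrt 3 * z) = vec5 c d (- a) (- b) (sqrt 3 * 0)"
  "mbas 5 *v vec5 a b c d (sqrt 3 * z) = vec5 (3 * c) (-3 * d + 6 * z) (-3 * a) (3 * b) (sqrt 3 * (-2 * b))"
  "mbas 6 *v vec5 a b c d (sqrt 3 * z) = vec5 b (- a) (- d) c (sqrt 3 * 0)"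
  "mbas 7 *v vec5 a b c d (sqrt 3 * z) = vec5 (3 * b) (-3 * a) (3 * d + 6 * z) (-3 * c) (sqrt 3 * (-2 * c))"
  by (simp_all add: mbas_vals vec5_matmul vec5_inner vec5_eq)

lemma hbas_mult_vec:
  "hbas 1 *v vec5 a b c d (sqrt 3 * z) = vec5 (-2 * d) c (- b) (2 * a) (sqrt 3 * 0)"
  "hbas 2 *v vec5 a b c d (sqrt 3 * z) = vec5 c (- d - 3 * z) (- a) b (sqrt 3 * b)"
  "hbas 3 *v vec5 a b c d (sqrt 3 * z) = vec5 b (- a) (d - 3 * z) (- c) (sqrt 3 * c)"
  by (simp_all add: hbas_vals vec5_matmul vec5_inner vec5_eq)

lemma Hf_vec5: "Hf (vec5 a b c d (sqrt 3 * z)) = Hx a b c d z"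
  by (simp add: Hf_def)

lemma vec5_sqrt3: obtains a b c d z where "w = vec5 a b c d (sqrt 3 * z)"
proof -
  have "w = vec5 (w $ 1) (w $ 2) (w $ 3) (w $ 4) (sqrt 3 * (w $ 5 / sqrt 3))"
    using vec5_expand[of w] by simp
  then show ?thesis using that by blast
qed

lemma Hf_linear: "linear Hf"
  unfolding linear_iff Hf_def Hx_def
  by (simp add: vec7_linear vec7_eq algebra_simps add_divide_distrib)

text \<open>The covariant derivative in direction \<open>X\<close> of the equivariant function \<open>P \<mapsto> f (P\<^sup>T u)\<close>
  with values in the 2-tensors on the span of \<open>mbas\<close>, at \<open>P\<^sup>T u = w\<close>.\<close>

definition nab :: "real^5^5 \<Rightarrow> (real^5 \<Rightarrow> real^7^7) \<Rightarrow> real^5 \<Rightarrow> real^7^7" where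
  "nab X f w = - f (X *v w) - transpose (Lam X) ** f w - f w ** Lam X"

lemma nab_linear:
  assumes "linear f" shows "nab (X + Y) f w = nab X f w + nab Y f w" "nab (a *\<^sub>R X) f w = a *\<^sub>R nab X f w"
  using assms
  by (simp_all add: nab_def linear_add linear_cmul linear_add[OF Lam_linear] linear_cmul[OF Lam_linear]
      matvec.add_left matvec.scaleR_left matmul_simps transpose_simps algebra_simps scaleR_diff_right)

lemma nab_linear_arg: "linear f \<Longrightarrow> linear (nab X f)"
  by (simp add: linear_iff nab_def matvec.add_right matvec.scaleR_right matmul_simps algebra_simps scaleR_diff_right)

text \<open>The Ricci identity in algebraic form. It uses that \<open>bracket X Y\<close> acts on
  R^5 as the commutator of the actions of \<open>X\<close> and \<open>Y\<close>.\<close>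

lemma nab_commute:
  assumes "linear f"
  shows "nab X (nab Y f) w - nab Y (nab X f) w =
    nab (bracket X Y) f w - transpose (curv X Y) ** f w - f w ** curv X Y"
proof -
  have "bracket X Y *v w = X *v (Y *v w) - Y *v (X *v w)"
    by (simp add: bracket_def matvec.diff_left matrix_vector_mul_assoc)
  then have "f (bracket X Y *v w) = f (X *v (Y *v w)) - f (Y *v (X *v w))"
    using assms by (simp add: linear_diff)
  then show ?thesis
    by (simp add: nab_def curv_def matmul_simps transpose_simps matrix_transpose_mul matrix_mul_assoc)
qed

text \<open>Infinitesimal SO(3)-equivariance of \<open>Hf\<close>. Because of it only the m-part of
  \<open>X\<close> contributes to \<open>nab X Hf\<close>.\<close>

lemma nab_hbas_Hf: "nab (hbas i) Hf w = 0"
proof -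
  obtain a b c d z where w: "w = vec5 a b c d (sqrt 3 * z)" by (rule vec5_sqrt3)
  have "\<forall>i. nab (hbas i) Hf w = 0"
    unfolding w nab_def Lam_basis forall_3 hbas_mult_vec Hf_vec5 Hx_def
    unfolding basis_vals vec7_transpose vec7_matmul vec7_vecmat
    by (simp add: vec7_linear vec7_eq_0) (simp add: field_simps)
  then show ?thesis by blast
qed

lemma nab_mbas_Hf:
  "nab (mbas 1) Hf (vec5 a b c d (sqrt 3 * z)) = vec7 (vec7 0 (-6 / 5 * d) 0 (3 / 5 * b) (3 * b) (3 / 5 * c) (3 * c))
      (vec7 (-6 / 5 * d) (12 / 5 * a) (-48 / 5 * z) (-3 / 5 * c) (9 / 5 * c) (3 / 5 * b) (-9 / 5 * b))
      (vec7 0 (-48 / 5 * z) (4 * a) (3 / 5 * b) (3 * b) (-3 / 5 * c) (-3 * c))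
      (vec7 (3 / 5 * b) (-3 / 5 * c) (3 / 5 * b) (-16 / 5 * a) (-12 / 5 * a) 0 (12 / 5 * d + 12 / 5 * z))
      (vec7 (3 * b) (9 / 5 * c) (3 * b) (-12 / 5 * a) (24 * a) (-12 / 5 * d + 12 / 5 * z) (-72 * z))
      (vec7 (3 / 5 * c) (3 / 5 * b) (-3 / 5 * c) 0 (-12 / 5 * d + 12 / 5 * z) (-16 / 5 * a) (-12 / 5 * a))
      (vec7 (3 * c) (-9 / 5 * b) (-3 * c) (12 / 5 * d + 12 / 5 * z) (-72 * z) (-12 / 5 * a) (24 * a))"
  "nab (mbas 2) Hf (vec5 a b c d (sqrt 3 * z)) = vec7 (vec7 (12 / 5 * d) (-6 / 5 * a) (48 / 5 * z) (-3 / 5 * c) (-9 / 5 * c) (3 / 5 * b) (9 / 5 * b))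
      (vec7 (-6 / 5 * a) 0 0 (-3 / 5 * b) (3 * b) (-3 / 5 * c) (3 * c))
      (vec7 (48 / 5 * z) 0 (4 * d) (3 / 5 * c) (-3 * c) (3 / 5 * b) (-3 * b))
      (vec7 (-3 / 5 * c) (-3 / 5 * b) (3 / 5 * c) (-16 / 5 * d) (12 / 5 * d - 12 / 5 * z) 0 (12 / 5 * a))
      (vec7 (-9 / 5 * c) (3 * b) (-3 * c) (12 / 5 * d - 12 / 5 * z) (24 * d - 72 * z) (-12 / 5 * a) 0)
      (vec7 (3 / 5 * b) (-3 / 5 * c) (3 / 5 * b) 0 (-12 / 5 * a) (-16 / 5 * d) (12 / 5 * d + 12 / 5 * z))
      (vec7 (9 / 5 * b) (3 * c) (-3 * b) (12 / 5 * a) 0 (12 / 5 * d + 12 / 5 * z) (24 * d + 72 * z))"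
  "nab (mbas 3) Hf (vec5 a b c d (sqrt 3 * z)) = vec7 (vec7 0 0 (-2 * a) (2 * b) (-12 * b) (-2 * c) (12 * c))
      (vec7 0 0 (-2 * d) (2 * c) (12 * c) (2 * b) (12 * b))
      (vec7 (-2 * a) (-2 * d) 0 0 (-10 * b) 0 (-10 * c))
      (vec7 (2 * b) (2 * c) 0 0 (8 * a) 0 (8 * d))
      (vec7 (-12 * b) (12 * c) (-10 * b) (8 * a) 0 (8 * d) 0)
      (vec7 (-2 * c) (2 * b) 0 0 (8 * d) 0 (-8 * a))
      (vec7 (12 * c) (12 * b) (-10 * c) (8 * d) 0 (-8 * a) 0)"
  "nab (mbas 4) Hf (vec5 a b c d (sqrt 3 * z)) = vec7 (vec7 (-6 / 5 * b) (6 / 5 * c) (-13 / 5 * b) (8 / 5 * a) (-18 / 5 * a) (-8 / 5 * d) (18 / 5 * d + 18 / 5 * z))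
      (vec7 (6 / 5 * c) (6 / 5 * b) (-13 / 5 * c) (8 / 5 * d) (18 / 5 * d - 18 / 5 * z) (8 / 5 * a) (18 / 5 * a))
      (vec7 (-13 / 5 * b) (-13 / 5 * c) 0 0 (-2 * a) (-18 / 5 * z) (-2 * d))
      (vec7 (8 / 5 * a) (8 / 5 * d) 0 0 (2 * b) 0 (2 * c))
      (vec7 (-18 / 5 * a) (18 / 5 * d - 18 / 5 * z) (-2 * a) (2 * b) (12 * b) (34 / 5 * c) (-12 * c))
      (vec7 (-8 / 5 * d) (8 / 5 * a) (-18 / 5 * z) 0 (34 / 5 * c) 0 (-34 / 5 * b))
      (vec7 (18 / 5 * d + 18 / 5 * z) (18 / 5 * a) (-2 * d) (2 * c) (-12 * c) (-34 / 5 * b) (-12 * b))"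
  "nab (mbas 5) Hf (vec5 a b c d (sqrt 3 * z)) = vec7 (vec7 (-6 * b) 0 (9 * b) (6 * a) (-12 * a) (6 * d - 6 * z) (36 * z))
      (vec7 0 (-6 * b) (-9 * c) (-6 * d + 6 * z) (-12 * d + 36 * z) (6 * a) 0)
      (vec7 (9 * b) (-9 * c) (20 * b) (-6 * a) 0 (-6 * d) (-30 * z))
      (vec7 (6 * a) (-6 * d + 6 * z) (-6 * a) (-4 * b) (-6 * b) 0 (6 * c))
      (vec7 (-12 * a) (-12 * d + 36 * z) 0 (-6 * b) 0 (6 * c) (-60 * c))
      (vec7 (6 * d - 6 * z) (6 * a) (-6 * d) 0 (6 * c) (-4 * b) (6 * b))
      (vec7 (36 * z) 0 (-30 * z) (6 * c) (-60 * c) (6 * b) (120 * b))"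
  "nab (mbas 6) Hf (vec5 a b c d (sqrt 3 * z)) = vec7 (vec7 (-6 / 5 * c) (-6 / 5 * b) (13 / 5 * c) (8 / 5 * d) (-18 / 5 * d + 18 / 5 * z) (8 / 5 * a) (-18 / 5 * a))
      (vec7 (-6 / 5 * b) (6 / 5 * c) (-13 / 5 * b) (-8 / 5 * a) (-18 / 5 * a) (8 / 5 * d) (18 / 5 * d + 18 / 5 * z))
      (vec7 (13 / 5 * c) (-13 / 5 * b) 0 (18 / 5 * z) (-2 * d) 0 (2 * a))
      (vec7 (8 / 5 * d) (-8 / 5 * a) (18 / 5 * z) 0 (-34 / 5 * c) 0 (34 / 5 * b))
      (vec7 (-18 / 5 * d + 18 / 5 * z) (-18 / 5 * a) (-2 * d) (-34 / 5 * c) (-12 * c) (2 * b) (-12 * b))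
      (vec7 (8 / 5 * a) (8 / 5 * d) 0 0 (2 * b) 0 (2 * c))
      (vec7 (-18 / 5 * a) (18 / 5 * d + 18 / 5 * z) (2 * a) (34 / 5 * b) (-12 * b) (2 * c) (12 * c))"
  "nab (mbas 7) Hf (vec5 a b c d (sqrt 3 * z)) = vec7 (vec7 (-6 * c) 0 (-9 * c) (-6 * d - 6 * z) (36 * z) (6 * a) (-12 * a))
      (vec7 0 (-6 * c) (-9 * b) (-6 * a) 0 (-6 * d - 6 * z) (-12 * d - 36 * z))
      (vec7 (-9 * c) (-9 * b) (20 * c) (-6 * d) (30 * z) (6 * a) 0)
      (vec7 (-6 * d - 6 * z) (-6 * a) (-6 * d) (-4 * c) (6 * c) 0 (6 * b))
      (vec7 (36 * z) 0 (30 * z) (6 * c) (120 * c) (6 * b) (-60 * b))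
      (vec7 (6 * a) (-6 * d - 6 * z) (6 * a) 0 (6 * b) (-4 * c) (-6 * c))
      (vec7 (-12 * a) (-12 * d - 36 * z) 0 (6 * b) (-60 * b) (-6 * c) 0)"
  unfolding nab_def Lam_basis mbas_mult_vec Hf_vec5 Hx_def
  unfolding basis_vals vec7_transpose vec7_matmul vec7_vecmat
  by (simp_all add: vec7_linear vec7_eq) (simp_all add: field_simps)

section \<open>First and second covariant derivatives of the tensor\<close>

definition DH :: "7 \<Rightarrow> real^5 \<Rightarrow> real^7^7" where
  "DH c = nab (mbas c) Hf"

lemma DH_linear: "linear (DH c)"
  by (simp add: DH_def nab_linear_arg Hf_linear)

lemma nab_Hf:
  assumes "X \<in> so5"
  shows "nab X Hf w = (\<Sum>c\<in>UNIV. theta X $ c *\<^sub>R DH c w)"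
proof -
  have axis: "(\<Sum>c\<in>UNIV. axis d (1::real) $ c *\<^sub>R f c) = f d" for d and f :: "7 \<Rightarrow> real^7^7"
    by (simp add: axis_def if_distrib if_distribR cong: if_cong)
  show ?thesis
    using assms by (induction rule: so5_induct)
      (simp_all add: nab_linear Hf_linear linear_add[OF theta_linear] linear_cmul[OF theta_linear]
        scaleR_add_left sum.distrib scaleR_sum_right nab_hbas_Hf axis flip: DH_def)
qed

text \<open>The component of the second covariant derivative in directions \<open>d\<close>,
  \<open>c\<close>; the sum is the connection term of the slot \<open>c\<close> created by the first
  derivative.\<close>

definition FH :: "7 \<Rightarrow> 7 \<Rightarrow> real^5 \<Rightarrow> real^7^7" where
  "FH d c w = nab (mbas d) (DH c) w - (\<Sum>b\<in>UNIV. lamM d $ b $ c *\<^sub>R DH b w)"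

text \<open>The family \<open>DH\<close> is again SO(3)-equivariant, so the second covariant
  derivative also depends only on the m-part of the direction.\<close>

lemma nab_DH:
  assumes "X \<in> so5"
  shows "nab X (DH c) w - (\<Sum>b\<in>UNIV. Lam X $ b $ c *\<^sub>R DH b w) = (\<Sum>d\<in>UNIV. theta X $ d *\<^sub>R FH d c w)"
proof -
  have axis: "(\<Sum>c\<in>UNIV. axis d (1::real) $ c *\<^sub>R f c) = f d" for d and f :: "7 \<Rightarrow> real^7^7"
    by (simp add: axis_def if_distrib if_distribR cong: if_cong)
  show ?thesis using assms
  proof (induction rule: so5_induct)
    case (add X Y)
    have "nab (X + Y) (DH c) w - (\<Sum>b\<in>UNIV. Lam (X + Y) $ b $ c *\<^sub>R DH b w) =
      (nab X (DH c) w - (\<Sum>b\<in>UNIV. Lam X $ b $ c *\<^sub>R DH b w)) + (nab Y (DH c) w - (\<Sum>b\<in>UNIV. Lam Y $ b $ c *\<^sub>R DH b w))"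
      by (simp add: nab_linear DH_linear linear_add[OF Lam_linear] scaleR_add_left sum.distrib)
    then show ?case unfolding add
      by (simp add: linear_add[OF theta_linear] scaleR_add_left sum.distrib)
  next
    case (scaleR a X)
    have "nab (a *\<^sub>R X) (DH c) w - (\<Sum>b\<in>UNIV. Lam (a *\<^sub>R X) $ b $ c *\<^sub>R DH b w) =
      a *\<^sub>R (nab X (DH c) w - (\<Sum>b\<in>UNIV. Lam X $ b $ c *\<^sub>R DH b w))"
      by (simp add: nab_linear DH_linear linear_cmul[OF Lam_linear] scaleR_diff_right scaleR_sum_right)
    then show ?case unfolding scaleR
      by (simp add: linear_cmul[OF theta_linear] scaleR_sum_right)
  next
    case (mbas d) show ?case by (simp add: axis FH_def)
  next
    case (hbas i)
    \<comment> \<open>In \<open>nab_commute\<close> the curvature term vanishes by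
      \<open>curv_hbas\<close> and one of the two second derivatives vanishes by equivariance, which
      leaves the derivative in direction of the bracket.\<close>
    have 0: "nab (hbas i) Hf = (\<lambda>w. 0)" using nab_hbas_Hf by blast
    have "nab (hbas i) (DH c) w = nab (bracket (hbas i) (mbas c)) Hf w"
      using nab_commute[OF Hf_linear, of "hbas i" "mbas c" w]
      by (simp add: DH_def curv_hbas 0 transpose_zero) (simp add: nab_def)
    also have "\<dots> = (\<Sum>b\<in>UNIV. lamL i $ b $ c *\<^sub>R DH b w)"
      by (simp add: nab_Hf so5_bracket bracket_hbas_mbas matrix_vector_mult_basis column_def)
    finally show ?case by simp
  qed
qed

lemma trace_Hf: "(\<Sum>c\<in>UNIV. Hf w $ c $ c / nrm c) = 0"
  by (simp add: Hf_def Hx_def sum_7 nrm_def) (simp add: field_simps)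

text \<open>The left-hand side is an equivariant map from R^5 to the 7-dimensional irreducible m, so
  Schur's lemma predicts zero; the proof evaluates it.\<close>

lemma divergence_Hf: "(\<Sum>c\<in>UNIV. DH c w $ c $ a / nrm c) = 0"
proof -
  obtain a b c d z where w: "w = vec5 a b c d (sqrt 3 * z)" by (rule vec5_sqrt3)
  have "\<forall>a. (\<Sum>c\<in>UNIV. DH c w $ c $ a / nrm c) = 0"
    unfolding w DH_def forall_7 sum_7 nab_mbas_Hf by (simp add: nrm_def) (simp add: field_simps)
  then show ?thesis by blast
qed

text \<open>A scalar is to be expected, since R^5 occurs only once in the symmetric 2-tensors on m;
  the content is its value.\<close>

lemma laplacian_Hf: "(\<Sum>c\<in>UNIV. (1 / nrm c) *\<^sub>R FH c c w) = (- 19 / 20) *\<^sub>R Hf w"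
proof -
  obtain a b c d z where w: "w = vec5 a b c d (sqrt 3 * z)" by (rule vec5_sqrt3)
  \<comment> \<open>Column \<open>c\<close> of \<open>lamM c\<close> is half the m-part of the
    bracket of \<open>mbas c\<close> with itself. So the slot correction in \<open>FH\<close> drops
    out on the diagonal.\<close>
  have "\<forall>c b. lamM c $ b $ c = 0" unfolding forall_7 by (simp add: lamM_vals)
  then have FH: "FH c c w = - DH c (mbas c *v w) - transpose (lamM c) ** DH c w - DH c w ** lamM c" for c w
    by (simp add: FH_def nab_def)
  show ?thesis
    unfolding sum_7 FH w mbas_mult_vec DH_def nab_mbas_Hf Hf_vec5 Hx_def
    unfolding basis_vals vec7_transpose vec7_matmul vec7_vecmat
    by (simp add: nrm_def vec7_linear vec7_eq) (simp add: field_simps)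
qed

lemma curvature_Hf:
  "(\<chi> d a. \<Sum>c\<in>UNIV. (transpose (curv (mbas c) (mbas d)) ** Hf w) $ a $ c / nrm c) = (7 / 8) *\<^sub>R Hf w"
proof -
  obtain a b c d z where w: "w = vec5 a b c d (sqrt 3 * z)" by (rule vec5_sqrt3)
  have "(\<Sum>c\<in>UNIV. (transpose (curv (mbas c) (mbas i)) ** Hf w) $ j $ c / nrm c) =
    (\<Sum>c\<in>UNIV. \<Sum>k\<in>UNIV. curv (mbas c) (mbas i) $ k $ j * Hf w $ k $ c / nrm c)" for i j
    by (simp add: matmul_nth transpose_nth sum_divide_distrib)
  then show ?thesis
    unfolding vec_eq_iff forall_7 w Hf_vec5 Hx_def
    by (simp add: sum_7 curv_mbas_flip curv_self curv_mbas nrm_def) (simp add: field_simps)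
qed

text \<open>An SO(3)-invariant quadratic form on the irreducible R^5 is a multiple of the inner
  product. This makes the pointwise norm of the tensor field constant.\<close>

lemma norm_Hf: "(\<Sum>a\<in>UNIV. \<Sum>b\<in>UNIV. Hf w $ a $ b * Hf w $ a $ b / (nrm a * nrm b)) = (28 / 25) * (w \<bullet> w)"
proof -
  obtain a b c d z where w: "w = vec5 a b c d (sqrt 3 * z)" by (rule vec5_sqrt3)
  show ?thesis unfolding w Hf_vec5 Hx_def sum_7 vec5_inner by (simp add: nrm_def) (simp add: field_simps power2_eq_square)
qed

text \<open>The SO(3)-invariant cubic form of the 5-dimensional representation, contracted with \<open>w\<close>.\<close>

definition cub :: "real^5 \<Rightarrow> real^5^5" where
  "cub w = vec5 (vec5 (2 * w $ 5) (sqrt 3 * w $ 3) (sqrt 3 * w $ 2) 0 (2 * w $ 1))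
    (vec5 (sqrt 3 * w $ 3) (sqrt 3 * w $ 4 - w $ 5) (sqrt 3 * w $ 1) (sqrt 3 * w $ 2) (- w $ 2))
    (vec5 (sqrt 3 * w $ 2) (sqrt 3 * w $ 1) (- sqrt 3 * w $ 4 - w $ 5) (- sqrt 3 * w $ 3) (- w $ 3))
    (vec5 0 (sqrt 3 * w $ 2) (- sqrt 3 * w $ 3) (2 * w $ 5) (2 * w $ 4))
    (vec5 (2 * w $ 1) (- w $ 2) (- w $ 3) (2 * w $ 4) (-2 * w $ 5))"

lemma cub_mbas: "cub w \<bullet> (mbas a ** mbas b + mbas b ** mbas a) = sqrt 3 * Hf w $ a $ b"
proof -
  obtain p q r s z where w: "w = vec5 p q r s (sqrt 3 * z)" by (rule vec5_sqrt3)
  have "\<forall>a b. cub w \<bullet> (mbas a ** mbas b + mbas b ** mbas a) = sqrt 3 * Hf w $ a $ b"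
    unfolding forall_7 w Hf_vec5 Hx_def cub_def mbas_vals vec5_matmul vec5_vecmat
    by (simp add: vec5_linear vec5_inner algebra_simps)
  then show ?thesis by blast
qed

section \<open>The invariant cubic form and the subgroup\<close>

lemma cub_linear: "linear cub"
  unfolding linear_iff cub_def
  by (simp add: vec5_linear vec5_eq algebra_simps)

lemma sqrt6: "sqrt 6 = sqrt 2 * sqrt 3" "1 / sqrt 2 = sqrt 2 / 2" "1 / sqrt 6 = sqrt 2 * sqrt 3 / 6"
proof -
  show *: "sqrt 6 = sqrt 2 * sqrt 3" by (simp flip: real_sqrt_mult)
  show "1 / sqrt 2 = sqrt 2 / 2" by (simp add: field_simps)
  show "1 / sqrt 6 = sqrt 2 * sqrt 3 / 6" unfolding * by (simp add: field_simps)
qed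

lemma trace_mx: "trace (mx a b c d e f g h i) = a + e + i"
  by (simp add: mx_def trace_def sum_3)

lemma sqrt2_mult [simp]: "sqrt 2 * (sqrt 2 * x) = 2 * x" "sqrt 2 * (x * sqrt 2) = 2 * x" for x :: real
proof -
  show "sqrt 2 * (sqrt 2 * x) = 2 * x" by (simp flip: mult.assoc)
  then show "sqrt 2 * (x * sqrt 2) = 2 * x" by (simp only: mult.commute[of x])
qed

text \<open>Identifies \<open>cub\<close> with the polarization of the invariant tr(S^3) on
  traceless symmetric matrices, up to scale. In this form invariance under conjugation is
  visible.\<close>

lemma cub_eq_trace: "cub w $ b $ c = 2 * sqrt 6 * trace (sym_of w ** sym_basis b ** sym_basis c)"
proof -
  have "\<forall>b c. cub w $ b $ c = 2 * sqrt 6 * trace (sym_of w ** sym_basis b ** sym_basis c)"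
    unfolding forall_5 sym_of_def sum_5 sym_basis_mx sqrt6 mx_scale mx_add mx_mult trace_mx
    by (simp add: cub_def algebra_simps)
  then show ?thesis by blast
qed

text \<open>Row \<open>b\<close> of \<open>so3_irr Q\<close> expands the back-rotated basis matrix
  \<open>\<beta> b\<close>. Inserting this into the trace formula, the factors of \<open>Q\<close>
  cancel or move around cyclically.\<close>

lemma cub_so3_irr:
  assumes "rotation_matrix Q"
  shows "cub (so3_irr Q *v w) = so3_irr Q ** cub w ** transpose (so3_irr Q)"
proof -
  define k where "k = so3_irr Q"
  define \<beta> where "\<beta> b = transpose Q ** sym_basis b ** Q" for b
  have QT: "rotation_matrix (transpose Q)" and QQ: "Q ** transpose Q = mat 1"
    using assms by (simp_all add: rotation_matrix_def orthogonal_matrix_transpose orthogonal_matrix_def)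
  have "k $ b $ b' = sym_coords (\<beta> b) $ b'" for b b'
  proof -
    have "trace (sym_basis b ** Q ** (sym_basis b' ** transpose Q)) = trace ((sym_basis b' ** transpose Q) ** (sym_basis b ** Q))"
      by (rule trace_mul_sym)
    then show ?thesis by (simp add: k_def so3_irr_def sym_coords_def \<beta>_def matrix_mul_assoc)
  qed
  then have \<beta>: "(\<Sum>b'\<in>UNIV. k $ b $ b' *\<^sub>R sym_basis b') = \<beta> b" for b
    using sym_of_sym_coords[OF traceless_sym_conj[OF QT traceless_sym_basis], of b]
    by (simp add: sym_of_def \<beta>_def)
  have S: "sym_of (k *v w) = Q ** sym_of w ** transpose Q"
    by (simp add: k_def so3_irr_mult_vec sym_of_sym_coords traceless_sym_conj[OF assms traceless_sym_of])
  have "(k ** cub w ** transpose k) $ b $ c = cub (k *v w) $ b $ c" for b c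
  proof -
    have "(k ** cub w ** transpose k) $ b $ c = (\<Sum>c'\<in>UNIV. \<Sum>b'\<in>UNIV. k $ b $ b' * cub w $ b' $ c' * k $ c $ c')"
      by (simp add: matmul_nth transpose_nth sum_distrib_right)
    also have "\<dots> = 2 * sqrt 6 * trace (sym_of w ** (\<Sum>b'\<in>UNIV. k $ b $ b' *\<^sub>R sym_basis b') ** (\<Sum>c'\<in>UNIV. k $ c $ c' *\<^sub>R sym_basis c'))"
      by (simp add: cub_eq_trace matmul.sum_left matmul.sum_right matmul_simps trace_sum trace_scaleR
          sum_distrib_left scaleR_sum_right mult_ac)
    also have "\<dots> = 2 * sqrt 6 * trace ((sym_of w ** transpose Q ** sym_basis b) ** (Q ** transpose Q) ** sym_basis c ** Q)"
      by (simp only: \<beta>) (simp only: \<beta>_def matrix_mul_assoc)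
    also have "\<dots> = 2 * sqrt 6 * trace (Q ** (sym_of w ** transpose Q ** sym_basis b ** sym_basis c))"
      by (subst trace_mul_sym) (simp add: QQ)
    also have "\<dots> = cub (k *v w) $ b $ c"
      by (simp add: cub_eq_trace S matrix_mul_assoc)
    finally show ?thesis .
  qed
  then show ?thesis by (simp add: vec_eq_iff k_def)
qed

lemma SO3_irrE:
  assumes "k \<in> SO3_irr"
  obtains "orthogonal_matrix k" "\<And>w. cub (k *v w) = k ** cub w ** transpose k"
  using assms orthogonal_so3_irr cub_so3_irr unfolding SO3_irr_def by blast

lemma SO3_irr_one: "mat 1 \<in> SO3_irr"
proof -
  have "rotation_matrix (mat 1 :: real^3^3)"
    by (simp add: rotation_matrix_def orthogonal_matrix_id)
  then show ?thesis unfolding SO3_irr_def using so3_irr_mat_1 by (metis image_eqI mem_Collect_eq)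
qed

lemma SO3_irr_mult: "k \<in> SO3_irr \<Longrightarrow> l \<in> SO3_irr \<Longrightarrow> k ** l \<in> SO3_irr"
  unfolding SO3_irr_def
  by (auto simp flip: so3_irr_mult simp: rotation_matrix_def orthogonal_matrix_mul det_mul)

lemma SO3_irr_transpose: "k \<in> SO3_irr \<Longrightarrow> transpose k \<in> SO3_irr"
  unfolding SO3_irr_def
  by (auto simp flip: so3_irr_transpose simp: rotation_matrix_def orthogonal_matrix_transpose det_transpose)

lemma orthogonal_SO3_irr: "k \<in> SO3_irr \<Longrightarrow> orthogonal_matrix k"
  using SO3_irrE by blast

text \<open>The infinitesimal action of \<open>X\<close> on the cubic form, contracted with
  \<open>w\<close>, for skew \<open>X\<close>.\<close>

definition dcub :: "real^5^5 \<Rightarrow> real^5 \<Rightarrow> real^5^5" where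
  "dcub X w = X ** cub w - cub w ** X - cub (X *v w)"

lemma dcub_linear: "linear (\<lambda>X. dcub X w)"
  by (simp add: linear_iff dcub_def matmul_simps matvec.add_left matvec.scaleR_left
      linear_add[OF cub_linear] linear_cmul[OF cub_linear] algebra_simps scaleR_diff_right)

text \<open>The orthogonal projection to m in coordinates; on so(5) it agrees with
  \<open>proj_m\<close> by \<open>proj_m_eq\<close>.\<close>

definition prm :: "real^5^5 \<Rightarrow> real^5^5" where
  "prm X = (\<Sum>c\<in>UNIV. theta X $ c *\<^sub>R mbas c)"

lemma prm_linear: "linear prm"
  by (simp add: linear_iff prm_def linear_add[OF theta_linear] linear_cmul[OF theta_linear]
      scaleR_add_left sum.distrib scaleR_sum_right)

lemma prm_zero_iff: "prm X = 0 \<longleftrightarrow> theta X = 0"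
proof
  assume *: "prm X = 0"
  have "mbas c \<bullet> prm X = theta X $ c * nrm c" for c
    by (simp add: prm_def inner_sum_right basis_orthogonal if_distrib if_distribR cong: if_cong)
  then have "theta X $ c = 0" for c using nrm_pos[of c] by (metis * inner_zero_right less_irrefl mult_eq_0_iff)
  then show "theta X = 0" by (simp add: vec_eq_iff)
qed (simp add: prm_def)

lemma dcub_hbas: "dcub (hbas i) w = 0"
proof -
  obtain a b c d z where w: "w = vec5 a b c d (sqrt 3 * z)" by (rule vec5_sqrt3)
  have "\<forall>i. dcub (hbas i) w = 0"
    unfolding w dcub_def forall_3 hbas_mult_vec cub_def hbas_vals vec5_matmul vec5_vecmat
    by (simp add: vec5_linear vec5_inner vec5_eq_0) (simp add: algebra_simps)
  then show ?thesis by blast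
qed

lemma axis_vec5: "axis 1 x = vec5 x 0 0 0 0" "axis 2 x = vec5 0 x 0 0 0" "axis 3 x = vec5 0 0 x 0 0"
  "axis 4 x = vec5 0 0 0 x 0" "axis 5 x = vec5 0 0 0 0 x"
  by (simp_all add: vec_eq_iff forall_5 axis_def)

text \<open>The left side is equivariant in \<open>X\<close> and kills so(3), and R^5 tensor R^5
  contains m exactly once. Hence it is a multiple of the projection to m, and 30 is the multiple.
  This inverts \<open>dcub\<close> on m by an explicit contraction.\<close>

lemma dcub_contract:
  assumes "X \<in> so5"
  shows "dcub X (axis a 1) \<bullet> cub (axis d 1) = 30 * prm X $ a $ d"
  using assms
proof (induction rule: so5_induct)
  case (mbas c)
  have ax: "(\<Sum>c\<in>UNIV. axis d (1::real) $ c *\<^sub>R f c) = f d" for d and f :: "7 \<Rightarrow> real^5^5"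
    by (simp add: axis_def if_distrib if_distribR cong: if_cong)
  have "\<forall>c a d. dcub (mbas c) (axis a 1) \<bullet> cub (axis d 1) = 30 * mbas c $ a $ d"
    unfolding dcub_def forall_7 forall_5 cub_def mbas_vals axis_vec5 vec5_matmul vec5_vecmat vec5_nth
    by (simp add: vec5_linear vec5_inner)
  then show ?case by (simp add: prm_def ax)
next
  case (hbas i)
  show ?case by (simp add: dcub_hbas prm_def)
qed (simp_all add: linear_add[OF dcub_linear] linear_cmul[OF dcub_linear] linear_add[OF prm_linear]
    linear_cmul[OF prm_linear] inner_add_left)

text \<open>The stabilizer of the cubic form in so(5) is exactly the span of
  \<open>hbas\<close>.\<close>

lemma theta_zero_iff:
  assumes "X \<in> so5" shows "theta X = 0 \<longleftrightarrow> (\<forall>w. dcub X w = 0)"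
proof
  assume "theta X = 0"
  then have "X = (\<Sum>i\<in>UNIV. eta X $ i *\<^sub>R hbas i)"
    using so5_decomposition[OF assms] by simp
  moreover have "dcub (\<Sum>i\<in>UNIV. eta X $ i *\<^sub>R hbas i) w = 0" for w
    by (simp add: linear_sum[OF dcub_linear] linear_cmul[OF dcub_linear] dcub_hbas)
  ultimately show "\<forall>w. dcub X w = 0" by simp
next
  assume "\<forall>w. dcub X w = 0"
  then have "prm X = 0"
    using dcub_contract[OF assms] by (simp add: vec_eq_iff[where x="prm X"] vec_eq_iff[where x="prm X $ _"])
  then show "theta X = 0" by (simp add: prm_zero_iff)
qed

subsection \<open>One-parameter subgroups\<close>

definition rot :: "3 \<Rightarrow> real \<Rightarrow> real^3^3" where
  "rot i t = vector [mx (cos t) (sin t) 0 (- sin t) (cos t) 0 0 0 1,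
     mx (cos t) 0 (sin t) 0 1 0 (- sin t) 0 (cos t),
     mx 1 0 0 0 (cos t) (sin t) 0 (- sin t) (cos t)] $ i"

definition drot :: "3 \<Rightarrow> real^3^3" where
  "drot i = vector [mx 0 1 0 (-1) 0 0 0 0 0, mx 0 0 1 0 0 0 (-1) 0 0, mx 0 0 0 0 0 1 0 (-1) 0] $ i"

definition rotK :: "3 \<Rightarrow> real \<Rightarrow> real^5^5" where
  "rotK i t = so3_irr (rot i t)"

lemma rotK_SO3_irr: "rotK i t \<in> SO3_irr"
proof -
  have "\<forall>i. rotation_matrix (rot i t)"
    unfolding forall_3 rot_def vector_3 mx_rotation mx_mult mx_eq
    using sin_cos_squared_add3[of t] by (simp add: algebra_simps power2_eq_square)
  then show ?thesis by (simp add: rotK_def SO3_irr_def)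
qed

lemma rot_0: "rot i 0 = mat 1"
proof -
  have "\<forall>i. rot i 0 = mat 1" unfolding forall_3 rot_def vector_3 mx_mat_1 by simp
  then show ?thesis by blast
qed

lemma rotK_0: "rotK i 0 = mat 1"
  by (simp add: rotK_def rot_0 so3_irr_mat_1)

lemma has_vector_derivative_rot: "(rot i has_vector_derivative drot i) (at 0)"
  and continuous_on_rot: "continuous_on UNIV (rot i)"
proof -
  have c: "(cos has_real_derivative 0) (at (0::real))" "(sin has_real_derivative 1) (at (0::real))"
    using DERIV_cos[of "0::real"] DERIV_sin[of "0::real"] by simp_all
  \<comment> \<open>\<open>rot i\<close> has the form A + cos t B + sin t C with C =
    \<open>drot i\<close>. The value at pi/2 gives A + C, and the value at 0 gives A + B =
    1.\<close>
  have *: "\<forall>i. rot i = (\<lambda>t. (rot i (pi / 2) - drot i) + cos t *\<^sub>R (mat 1 - (rot i (pi / 2) - drot i)) + sin t *\<^sub>R drot i)"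
    unfolding forall_3 fun_eq_iff rot_def drot_def vector_3 mx_mat_1
    by (simp add: mx_def vec_eq_iff forall_3)
  have "((\<lambda>t. (rot i (pi / 2) - drot i) + cos t *\<^sub>R (mat 1 - (rot i (pi / 2) - drot i)) + sin t *\<^sub>R drot i)
      has_vector_derivative (0 + 0 *\<^sub>R (mat 1 - (rot i (pi / 2) - drot i)) + 1 *\<^sub>R drot i)) (at 0)"
    by (intro has_vector_derivative_add has_vector_derivative_const has_vector_derivative_scaleR[where g="\<lambda>_. _" and g'=0, simplified] c)
  then show "(rot i has_vector_derivative drot i) (at 0)"
    using *[rule_format, of i] by simp
  show "continuous_on UNIV (rot i)"
    by (subst *[rule_format]) (intro continuous_intros)
qed

text \<open>\<open>so3_irr\<close> is quadratic in \<open>Q\<close>; its bilinear version makes the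
  product rule available.\<close>

definition irr_bilinear :: "real^3^3 \<Rightarrow> real^3^3 \<Rightarrow> real^5^5" where
  "irr_bilinear P Q = (\<chi> a b. trace (sym_basis a ** (P ** sym_basis b ** transpose Q)))"

lemma bounded_bilinear_irr: "bounded_bilinear irr_bilinear"
  by (intro bilinear_conv_bounded_bilinear[THEN iffD1])
    (simp add: bilinear_def linear_iff irr_bilinear_def vec_eq_iff matmul_simps transpose_simps
      trace_add trace_scaleR)

lemma so3_irr_bilinear: "so3_irr Q = irr_bilinear Q Q"
  by (simp add: so3_irr_def irr_bilinear_def)

lemma continuous_on_rotK: "continuous_on UNIV (rotK i)"
  unfolding rotK_def so3_irr_bilinear
  by (intro bounded_bilinear.continuous_on[OF bounded_bilinear_irr] continuous_on_rot)

lemma irr_drot: "irr_bilinear (mat 1) (drot i) + irr_bilinear (drot i) (mat 1) = hbas i"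
proof -
  have "\<forall>i a b. trace (sym_basis a ** (mat 1 ** sym_basis b ** transpose (drot i))) +
      trace (sym_basis a ** (drot i ** sym_basis b ** transpose (mat 1))) = hbas i $ a $ b"
    unfolding forall_3 forall_5 drot_def vector_3 mx_mat_1 hbas_vals sym_basis_mx sqrt6 mx_scale mx_add mx_mult
      mx_transpose trace_mx vec5_nth
    by (simp add: algebra_simps real_div_sqrt)
  then show ?thesis by (simp add: irr_bilinear_def vec_eq_iff)
qed

lemma has_vector_derivative_rotK: "(rotK i has_vector_derivative hbas i) (at 0)"
  using bounded_bilinear.has_vector_derivative[OF bounded_bilinear_irr has_vector_derivative_rot has_vector_derivative_rot, of i i]
  by (simp add: rotK_def[abs_def] so3_irr_bilinear rot_0 irr_drot)

lemma has_derivative_rotK: "(rotK i has_derivative (\<lambda>t. t *\<^sub>R hbas i)) (at 0)"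
  using has_vector_derivative_rotK by (simp add: has_vector_derivative_def)

subsection \<open>The Lie algebra of the subgroup and its complement\<close>

lemma vanishing_derivative:
  assumes "(f has_vector_derivative D) (at (0::real))" "\<And>t. f t = c"
  shows "D = 0"
proof -
  have "f = (\<lambda>t. c)" using assms(2) by blast
  then have "(f has_vector_derivative 0) (at 0)"
    by simp
  then show ?thesis using assms(1) vector_derivative_unique_at by blast
qed

text \<open>A curve in the subgroup preserves the inner product and the cubic form; differentiating
  both puts its velocity in so(5) and in the stabilizer. Conversely, a product of the three
  one-parameter subgroups with speeds \<open>eta X\<close> has velocity \<open>X\<close>.\<close>

lemma so3_irr_alg_eq: "so3_irr_alg = {X \<in> so5. theta X = 0}"
proof (intro subset_antisym subsetI)
  fix X assume "X \<in> so3_irr_alg"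
  then obtain \<gamma> where \<gamma>: "\<And>t. \<gamma> t \<in> SO3_irr" "\<gamma> 0 = mat 1" "(\<gamma> has_vector_derivative X) (at 0)"
    by (auto simp: so3_irr_alg_def)
  have \<gamma>T: "((\<lambda>t. transpose (\<gamma> t)) has_vector_derivative transpose X) (at 0)"
    by (rule bounded_linear.has_vector_derivative[OF bounded_linear_transpose \<gamma>(3)])
  have "((\<lambda>t. transpose (\<gamma> t) ** \<gamma> t) has_vector_derivative transpose (\<gamma> 0) ** X + transpose X ** \<gamma> 0) (at 0)"
    by (rule bounded_bilinear.has_vector_derivative[OF bounded_bilinear_matrix_mult \<gamma>T \<gamma>(3)])
  from vanishing_derivative[OF this, of "mat 1"] have "X + transpose X = 0"
    using orthogonal_SO3_irr[OF \<gamma>(1)] \<gamma>(2) by (simp add: orthogonal_matrix_def)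
  then have TX: "transpose X = - X" by (simp add: eq_neg_iff_add_eq_0 add.commute)
  then have X: "X \<in> so5" by (simp add: so5_def)
  have "dcub X w = 0" for w
  proof -
    have 1: "((\<lambda>t. \<gamma> t ** cub w) has_vector_derivative X ** cub w) (at 0)"
      by (rule bounded_linear.has_vector_derivative[OF bounded_bilinear.bounded_linear_left[OF bounded_bilinear_matrix_mult] \<gamma>(3)])
    have 2: "((\<lambda>t. \<gamma> t ** cub w ** transpose (\<gamma> t)) has_vector_derivative (\<gamma> 0 ** cub w) ** transpose X + (X ** cub w) ** transpose (\<gamma> 0)) (at 0)"
      by (rule bounded_bilinear.has_vector_derivative[OF bounded_bilinear_matrix_mult 1 \<gamma>T])
    have "bounded_linear (\<lambda>Y. cub (Y *v w))"
      using bounded_linear_compose[OF linear_conv_bounded_linear[THEN iffD1, OF cub_linear]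
        bounded_bilinear.bounded_linear_left[OF bounded_bilinear_matrix_vector_mult]] .
    from has_vector_derivative_diff[OF 2 bounded_linear.has_vector_derivative[OF this \<gamma>(3)]]
    have "((\<lambda>t. \<gamma> t ** cub w ** transpose (\<gamma> t) - cub (\<gamma> t *v w)) has_vector_derivative
        (cub w ** transpose X + X ** cub w) - cub (X *v w)) (at 0)"
      by (simp add: \<gamma>(2))
    from vanishing_derivative[OF this, of 0] SO3_irrE[OF \<gamma>(1)] have "cub w ** transpose X + X ** cub w - cub (X *v w) = 0"
      by (metis right_minus_eq)
    then show ?thesis by (simp add: TX dcub_def matmul_simps)
  qed
  then show "X \<in> {X \<in> so5. theta X = 0}" using X theta_zero_iff by simp
next
  fix X assume "X \<in> {X \<in> so5. theta X = 0}"
  then have X: "X = eta X $ 1 *\<^sub>R hbas 1 + eta X $ 2 *\<^sub>R hbas 2 + eta X $ 3 *\<^sub>R hbas 3"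
    using so5_decomposition[of X] by (simp add: sum_3)
  define \<gamma> where "\<gamma> t = rotK 1 (eta X $ 1 * t) ** rotK 2 (eta X $ 2 * t) ** rotK 3 (eta X $ 3 * t)" for t
  have d: "((\<lambda>t. rotK i (a * t)) has_vector_derivative a *\<^sub>R hbas i) (at 0)" for i a
    using vector_diff_chain_at[of "\<lambda>t. a * t" a 0 "rotK i" "hbas i"] has_vector_derivative_rotK
    by (simp add: o_def has_vector_derivative_mult_right has_real_derivative_iff_has_vector_derivative[symmetric] DERIV_cmult_Id)
  have "(\<gamma> has_vector_derivative X) (at 0)"
    unfolding \<gamma>_def[abs_def]
    using bounded_bilinear.has_vector_derivative[OF bounded_bilinear_matrix_mult
        bounded_bilinear.has_vector_derivative[OF bounded_bilinear_matrix_mult d d] d,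
        of 1 "eta X $ 1" 2 "eta X $ 2" 3 "eta X $ 3"]
    by (subst X) (simp add: rotK_0 add_ac)
  moreover have "\<gamma> 0 = mat 1" by (simp add: \<gamma>_def rotK_0)
  moreover have "\<gamma> t \<in> SO3_irr" for t by (simp add: \<gamma>_def SO3_irr_mult rotK_SO3_irr)
  ultimately show "X \<in> so3_irr_alg" by (auto simp: so3_irr_alg_def)
qed

lemma inner_mat1: "trace A = mat 1 \<bullet> (A :: real^'n^'n)"
  by (simp add: trace_def inner_matrix mat_def if_distrib if_distribR cong: if_cong)

text \<open>The factor is 5 - 2. In the double bracket the two outer terms contribute 4 tr(XY) each,
  that is -8 times the inner product together, and the two mixed terms contribute +2 times it; the
  sum is halved in \<open>killing\<close>.\<close>

lemma killing_so5:
  assumes "X \<in> so5" "Y \<in> so5"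
  shows "killing X Y = - 3 * (X \<bullet> Y)"
proof -
  have E: "(A ** (\<chi> i j. if i = a \<and> j = b then 1 else 0) ** B) $ i $ j = A $ i $ a * B $ b $ j"
    for A B :: "real^5^5" and a b i j
  proof -
    have *: "(A ** (\<chi> i j. if i = a \<and> j = b then 1 else 0)) $ i $ k = (if k = b then A $ i $ a else 0)" for k
      by (cases "k = b") (simp_all add: matmul_nth if_distrib cong: if_cong)
    show ?thesis unfolding matmul_nth[of _ B] * by (simp add: if_distrib if_distribR cong: if_cong)
  qed
  have "skew_unit a b = (\<chi> i j. if i = a \<and> j = b then 1 else 0) - (\<chi> i j. if i = b \<and> j = a then 1 else 0)" for a b
    by (simp add: skew_unit_def vec_eq_iff)
  then have Z: "(A ** skew_unit a b ** B) $ a $ b = A $ a $ a * B $ b $ b - A $ a $ b * B $ a $ b" for A B a b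
    by (simp add: matmul_simps E)
  have brk: "bracket X (bracket Y S) = (X ** Y) ** S ** mat 1 - X ** S ** Y - Y ** S ** X + mat 1 ** S ** (Y ** X)" for S
    by (simp add: bracket_def matmul_simps matrix_mul_assoc)
  have XY: "trace (X ** Y) = - (X \<bullet> Y)" "trace (Y ** X) = - (X \<bullet> Y)"
    using assms inner_matmul_left[of X "Y" "mat 1"] inner_matmul_left[of Y "X" "mat 1"]
    by (simp_all add: inner_mat1 inner_commute so5_def)
  have diag0: "X $ a $ a = 0" for a
  proof -
    have "transpose X $ a $ a = (- X) $ a $ a" using assms(1) by (simp only: so5_def mem_Collect_eq)
    then show ?thesis by (simp add: transpose_nth)
  qed
  have m1: "(\<Sum>a\<in>UNIV. \<Sum>b\<in>UNIV. Z $ a $ a * mat 1 $ b $ b - Z $ a $ b * mat 1 $ a $ b) = 4 * trace Z"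
    "(\<Sum>a\<in>UNIV. \<Sum>b\<in>UNIV. mat 1 $ a $ a * Z $ b $ b - mat 1 $ a $ b * Z $ a $ b) = 4 * trace Z" for Z :: "real^5^5"
    by (simp_all add: mat_def trace_def sum_5)
  have m2: "(\<Sum>a\<in>UNIV. \<Sum>b\<in>UNIV. X $ a $ a * Y $ b $ b - X $ a $ b * Y $ a $ b) = - (X \<bullet> Y)"
    "(\<Sum>a\<in>UNIV. \<Sum>b\<in>UNIV. Y $ a $ a * X $ b $ b - Y $ a $ b * X $ a $ b) = - (X \<bullet> Y)"
    by (simp_all add: diag0 inner_matrix sum_negf mult.commute)
  have "(\<Sum>a\<in>UNIV. \<Sum>b\<in>UNIV. bracket X (bracket Y (skew_unit a b)) $ a $ b) =
     4 * trace (X ** Y) + X \<bullet> Y + X \<bullet> Y + 4 * trace (Y ** X)"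
    unfolding brk vector_add_component vector_minus_component Z sum.distrib sum_subtractf[where f="\<lambda>a. _ a - _ a"]
    using m1 m2 by (simp add: sum_subtractf)
  then show ?thesis by (simp add: killing_def XY)
qed

lemma prm_so5: "prm X \<in> so5"
  by (simp add: prm_def so5_def transpose_sum transpose_scaleR mbas_skew sum_negf)

lemma theta_prm: "theta (prm X) = theta X" and eta_prm: "eta (prm X) = 0"
  by (simp_all add: prm_def linear_sum[OF theta_linear] linear_cmul[OF theta_linear]
      linear_sum[OF eta_linear] linear_cmul[OF eta_linear] vec_eq_iff sum_component axis_def if_distrib cong: if_cong)

lemma compl_m_eq: "compl_m = {X \<in> so5. eta X = 0}"
proof -
  have "(\<forall>Y\<in>so3_irr_alg. killing X Y = 0) \<longleftrightarrow> eta X = 0" if X: "X \<in> so5" for X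
  proof
    assume *: "\<forall>Y\<in>so3_irr_alg. killing X Y = 0"
    have "hbas i \<in> so3_irr_alg" for i by (simp add: so3_irr_alg_eq)
    then have "X \<bullet> hbas i = 0" for i using * killing_so5[OF X, of "hbas i"] by simp
    then show "eta X = 0" by (simp add: vec_eq_iff eta_nth inner_commute)
  next
    assume eta: "eta X = 0"
    show "\<forall>Y\<in>so3_irr_alg. killing X Y = 0"
    proof
      fix Y assume Y: "Y \<in> so3_irr_alg"
      then have "X \<bullet> Y = X \<bullet> (\<Sum>i\<in>UNIV. eta Y $ i *\<^sub>R hbas i)"
        using so5_decomposition[of Y] by (simp add: so3_irr_alg_eq)
      also have "\<dots> = (\<Sum>i\<in>UNIV. eta Y $ i * (10 * eta X $ i))"
        by (simp add: inner_sum_right eta_nth inner_commute)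
      finally show "killing X Y = 0" using killing_so5[OF X] Y eta by (simp add: so3_irr_alg_eq)
    qed
  qed
  then show ?thesis by (auto simp: compl_m_def)
qed

lemma proj_m_eq:
  assumes "X \<in> so5" shows "proj_m X = prm X"
  unfolding proj_m_def
proof (rule the_equality)
  have "X - prm X \<in> so5" using assms prm_so5[of X] by (simp add: so5_def transpose_diff)
  then show "prm X \<in> compl_m \<and> X - prm X \<in> so3_irr_alg"
    using prm_so5 by (simp add: compl_m_eq so3_irr_alg_eq eta_prm theta_prm linear_diff[OF theta_linear])
next
  fix Y assume Y: "Y \<in> compl_m \<and> X - Y \<in> so3_irr_alg"
  then have "theta Y = theta X" by (simp add: so3_irr_alg_eq linear_diff[OF theta_linear])
  then show "Y = prm X" using so5_decomposition[of Y] Y by (simp add: compl_m_eq prm_def)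
qed

lemma inner_prm: "prm X \<bullet> prm Y = (\<Sum>c\<in>UNIV. nrm c * theta X $ c * theta Y $ c)"
  by (simp add: prm_def inner_sum_left inner_sum_right basis_orthogonal if_distrib if_distribR mult_ac cong: if_cong)

section \<open>Local lifts and the equivariant embedding\<close>

lemma SO5_orthogonal: "P \<in> SO5 \<Longrightarrow> transpose P ** P = mat 1" "P \<in> SO5 \<Longrightarrow> P ** transpose P = mat 1"
  by (simp_all add: SO5_def rotation_matrix_def orthogonal_matrix_def)

lemma left_coset_mult:
  assumes "k \<in> SO3_irr" shows "left_coset (P ** k) = left_coset P"
proof -
  have "k ** transpose k = mat 1"
    using orthogonal_SO3_irr[OF assms] by (simp add: orthogonal_matrix_def)
  then have "P ** l = P ** k ** (transpose k ** l)" for l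
    by (simp add: matrix_mul_assoc[of k] flip: matrix_mul_assoc[of P])
  then show ?thesis
    using SO3_irr_mult[OF assms] SO3_irr_mult[OF SO3_irr_transpose[OF assms]]
    unfolding left_coset_def image_def by (auto simp: matrix_mul_assoc[symmetric])
qed

lemma left_coset_eqE:
  assumes "left_coset P = left_coset P'" obtains k where "k \<in> SO3_irr" "P' = P ** k"
proof -
  have "P' ** mat 1 \<in> left_coset P'" using SO3_irr_one by (auto simp only: left_coset_def)
  then show ?thesis using assms that by (auto simp: left_coset_def)
qed

text \<open>The cubic form transported by \<open>P\<close> and contracted with
  \<open>u\<close>.\<close>

definition orbv :: "real^5^5 \<Rightarrow> real^5 \<Rightarrow> real^5^5" where
  "orbv P u = P ** cub (transpose P *v u) ** transpose P"

text \<open>The orbit map of the cubic form; it descends to an embedding of the quotient.\<close>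

definition orb :: "real^5^5 \<Rightarrow> real^5^5^5" where
  "orb P = (\<chi> a. orbv P (axis a 1))"

lemma orbv_mult: "k \<in> SO3_irr \<Longrightarrow> orbv (P ** k) u = orbv P u"
proof -
  assume k: "k \<in> SO3_irr"
  have kk: "k ** transpose k = mat 1"
    using orthogonal_SO3_irr[OF k] by (simp add: orthogonal_matrix_def)
  have "orbv (P ** k) u = P ** (k ** cub (transpose k *v (transpose P *v u)) ** transpose k) ** transpose P"
    by (simp add: orbv_def matrix_transpose_mul matrix_mul_assoc matrix_vector_mul_assoc del: transpose_matrix_vector)
  also have "k ** cub (transpose k *v (transpose P *v u)) ** transpose k = cub (k *v (transpose k *v (transpose P *v u)))"
    using SO3_irrE[OF k] by metis
  also have "\<dots> = cub (transpose P *v u)"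
    by (simp add: matrix_vector_mul_assoc matrix_mul_assoc kk del: transpose_matrix_vector)
  finally show ?thesis by (simp add: orbv_def)
qed

definition coset_orb :: "(real^5^5) set \<Rightarrow> real^5^5^5" where
  "coset_orb C = orb (SOME P. P \<in> C)"

lemma coset_orb: "coset_orb (left_coset P) = orb P"
proof -
  have "P ** mat 1 \<in> left_coset P" using SO3_irr_one by (auto simp only: left_coset_def)
  then have "(SOME P'. P' \<in> left_coset P) \<in> left_coset P" by (rule someI)
  then show ?thesis by (auto simp: coset_orb_def left_coset_def orb_def orbv_mult)
qed

definition emb :: "((real^5^5) set, 7) chart \<Rightarrow> real^7 \<Rightarrow> real^5^5^5" where
  "emb c x = coset_orb (snd c x)"

text \<open>For a lift \<open>\<sigma>\<close> of the chart \<open>c\<close>, \<open>Zf c x i\<close> is the \<open>m\<close>-part of \<open>\<sigma>\<^sup>T \<partial>\<^sub>i \<sigma>\<close> conjugated by \<open>\<sigma>\<close>; the factor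
  30 is that of \<open>dcub_contract\<close>.\<close>

definition zmat :: "real^5^5^5 \<Rightarrow> real^5^5^5 \<Rightarrow> real^5^5" where
  "zmat D E = (\<chi> a d. (D $ a \<bullet> E $ d) / 30)"

lemma bounded_bilinear_zmat: "bounded_bilinear zmat"
  by (intro bilinear_conv_bounded_bilinear[THEN iffD1])
    (simp add: bilinear_def linear_iff zmat_def vec_eq_iff inner_add_left inner_add_right add_divide_distrib)

definition Zf :: "((real^5^5) set, 7) chart \<Rightarrow> real^7 \<Rightarrow> 7 \<Rightarrow> real^5^5" where
  "Zf c x i = zmat (pd i (emb c) x) (emb c x)"

lemma dcub_inner:
  assumes "X \<in> so5" shows "dcub X p \<bullet> cub q = 30 * (p \<bullet> (prm X *v q))"
proof -
  have lin: "linear (dcub X)"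
    by (simp add: linear_iff dcub_def matmul_simps matvec.add_right matvec.scaleR_right
      linear_add[OF cub_linear] linear_cmul[OF cub_linear] algebra_simps scaleR_diff_right)
  have ex: "p = (\<Sum>a\<in>UNIV. p $ a *\<^sub>R axis a 1)" for p :: "real^5"
    using basis_expansion[of p] by (simp add: scalar_mult_eq_scaleR)
  have "dcub X p = (\<Sum>a\<in>UNIV. p $ a *\<^sub>R dcub X (axis a 1))"
    by (subst ex) (simp add: linear_sum[OF lin] linear_cmul[OF lin])
  moreover have "cub q = (\<Sum>d\<in>UNIV. q $ d *\<^sub>R cub (axis d 1))"
    by (subst ex) (simp add: linear_sum[OF cub_linear] linear_cmul[OF cub_linear])
  ultimately have "dcub X p \<bullet> cub q = (\<Sum>a\<in>UNIV. \<Sum>d\<in>UNIV. p $ a * (q $ d * (30 * prm X $ a $ d)))"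
    by (simp add: inner_sum_left inner_sum_right dcub_contract[OF assms] sum_distrib_left)
      (subst sum.swap, simp add: mult_ac)
  also have "\<dots> = 30 * (p \<bullet> (prm X *v q))"
    by (simp add: inner_vec_def matrix_vector_mult_def sum_distrib_left mult_ac)
  finally show ?thesis .
qed

lemma inner_conj:
  assumes "P \<in> SO5"
  shows "(P ** A ** transpose P) \<bullet> (P ** B ** transpose P) = A \<bullet> B"
proof -
  have "(P ** A ** transpose P) \<bullet> (P ** B ** transpose P) = A \<bullet> ((transpose P ** P) ** B ** (transpose P ** P))"
    unfolding inner_matmul_right[of "P ** A"] inner_matmul_left[of P A] by (simp add: matrix_mul_assoc)
  then show ?thesis by (simp add: SO5_orthogonal[OF assms])
qed

section \<open>Smooth maps into SO(5) and their Maurer-Cartan form\<close>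

locale lift =
  fixes W :: "(real^7) set" and \<sigma> :: "real^7 \<Rightarrow> real^5^5"
  assumes open_W: "open W" and smooth: "smooth_on W \<sigma>" and SO5: "x \<in> W \<Longrightarrow> \<sigma> x \<in> SO5"
begin

text \<open>The pullback of the left-invariant Maurer-Cartan form, in direction
  \<open>i\<close>.\<close>

definition X :: "7 \<Rightarrow> real^7 \<Rightarrow> real^5^5" where
  "X i x = transpose (\<sigma> x) ** pd i \<sigma> x"

lemmas orth = SO5_orthogonal[OF SO5]
lemmas d\<sigma> = smooth_on_differentiable[OF smooth]

lemma pd_\<sigma>: "x \<in> W \<Longrightarrow> pd i \<sigma> x = \<sigma> x ** X i x"
  by (simp add: X_def matrix_mul_assoc orth)

lemma d\<sigma>T: "x \<in> W \<Longrightarrow> (\<lambda>y. transpose (\<sigma> y)) differentiable (at x)"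
  and pd_\<sigma>T: "x \<in> W \<Longrightarrow> pd i (\<lambda>y. transpose (\<sigma> y)) x = transpose (pd i \<sigma> x)"
  by (simp_all add: differentiable_bounded_linear[OF bounded_linear_transpose] pd_bounded_linear[OF bounded_linear_transpose] d\<sigma>)

lemma X_so5: assumes "x \<in> W" shows "X i x \<in> so5"
proof -
  have "pd i (\<lambda>y. transpose (\<sigma> y) ** \<sigma> y) x = pd i (\<lambda>y. mat 1) x"
    by (rule pd_cong[OF open_W assms]) (simp add: orth)
  then have "transpose (\<sigma> x) ** pd i \<sigma> x + transpose (pd i \<sigma> x) ** \<sigma> x = 0"
    by (simp add: pd_matmul[OF d\<sigma>T d\<sigma>] assms pd_\<sigma>T)
  then show ?thesis
    by (simp add: so5_def X_def matrix_transpose_mul eq_neg_iff_add_eq_0 add.commute)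
qed

lemma X_skew: "x \<in> W \<Longrightarrow> transpose (X i x) = - X i x"
  using X_so5 by (simp add: so5_def)

lemma smooth_X: "smooth_on W (X i)"
  unfolding X_def[abs_def]
  by (intro smooth_on_matmul[OF open_W] smooth_on_bounded_linear[OF open_W bounded_linear_transpose] smooth smooth_on_pd)

lemma pd_X: assumes "x \<in> W"
  shows "pd i (X j) x = transpose (\<sigma> x) ** pd i (pd j \<sigma>) x - X i x ** X j x"
proof -
  have "pd i (X j) x = transpose (\<sigma> x) ** pd i (pd j \<sigma>) x + transpose (pd i \<sigma> x) ** pd j \<sigma> x"
    unfolding X_def[abs_def]
    using pd_matmul[OF d\<sigma>T[OF assms] smooth_on_differentiable[OF smooth_on_pd[OF smooth] assms]]
    by (simp add: pd_\<sigma>T[OF assms])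
  also have "transpose (pd i \<sigma> x) ** pd j \<sigma> x = (transpose (X i x) ** (transpose (\<sigma> x) ** \<sigma> x)) ** X j x"
    by (simp add: pd_\<sigma> assms matrix_transpose_mul matrix_mul_assoc)
  finally show ?thesis by (simp add: orth assms X_skew matmul_simps)
qed

text \<open>The structure equation of the group: the second derivatives of \<open>\<sigma>\<close>
  cancel by symmetry.\<close>

lemma maurer_cartan: "x \<in> W \<Longrightarrow> pd i (X j) x - pd j (X i) x = - bracket (X i x) (X j x)"
  by (simp add: pd_X pd_pd_commute[OF open_W _ smooth, of x i j] bracket_def)

lemma bounded_linear_cubT: "bounded_linear (\<lambda>Y. cub (transpose Y *v u))"
  using bounded_linear_compose[OF linear_conv_bounded_linear[THEN iffD1, OF cub_linear]
      bounded_linear_compose[OF bounded_bilinear.bounded_linear_left[OF bounded_bilinear_matrix_vector_mult] bounded_linear_transpose]] .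

lemma smooth_orbv: "smooth_on W (\<lambda>y. orbv (\<sigma> y) u)"
  unfolding orbv_def
  by (intro smooth_on_matmul[OF open_W] smooth smooth_on_bounded_linear[OF open_W bounded_linear_cubT]
      smooth_on_bounded_linear[OF open_W bounded_linear_transpose])

lemma pd_orbv:
  assumes x: "x \<in> W"
  shows "pd i (\<lambda>y. orbv (\<sigma> y) u) x = \<sigma> x ** dcub (X i x) (transpose (\<sigma> x) *v u) ** transpose (\<sigma> x)"
proof -
  note dc = differentiable_bounded_linear[OF bounded_linear_cubT d\<sigma>[OF x], of u]
  have "pd i (\<lambda>y. cub (transpose (\<sigma> y) *v u)) x = cub (transpose (pd i \<sigma> x) *v u)"
    by (rule pd_bounded_linear[OF bounded_linear_cubT d\<sigma>[OF x]])
  also have "\<dots> = - cub (X i x *v (transpose (\<sigma> x) *v u))"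
    by (simp add: pd_\<sigma>[OF x] matrix_transpose_mul X_skew[OF x] matrix_vector_mul_assoc matmul_simps
        matvec.minus_left linear_neg[OF cub_linear] del: transpose_matrix_vector)
  finally have "pd i (\<lambda>y. orbv (\<sigma> y) u) x =
      (\<sigma> x ** cub (transpose (\<sigma> x) *v u)) ** transpose (pd i \<sigma> x) +
      (\<sigma> x ** - cub (X i x *v (transpose (\<sigma> x) *v u)) + pd i \<sigma> x ** cub (transpose (\<sigma> x) *v u)) ** transpose (\<sigma> x)"
    unfolding orbv_def
    by (simp add: pd_matmul[OF differentiable_matmul[OF d\<sigma>[OF x] dc] d\<sigma>T[OF x]] pd_matmul[OF d\<sigma>[OF x] dc] pd_\<sigma>T[OF x] del: transpose_matrix_vector)
  then show ?thesis
    by (simp add: dcub_def pd_\<sigma>[OF x] matrix_transpose_mul X_skew[OF x] matmul_simps matrix_mul_assoc)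
qed

lemma smooth_orb: "smooth_on W (\<lambda>y. orb (\<sigma> y))"
  by (rule smooth_on_vec[OF open_W]) (simp add: orb_def smooth_orbv)

lemma pd_orb_nth: assumes "x \<in> W"
  shows "pd i (\<lambda>y. orb (\<sigma> y)) x $ a = \<sigma> x ** dcub (X i x) (transpose (\<sigma> x) *v axis a 1) ** transpose (\<sigma> x)"
  using pd_vec_nth[OF smooth_on_differentiable[OF smooth_orb assms], of i a] pd_orbv[OF assms, of i "axis a 1"]
  by (simp add: orb_def)

text \<open>Conjugation by \<open>\<sigma> x\<close> preserves the inner product, so the contraction
  can be evaluated at the base point by \<open>dcub_inner\<close>. The left side involves only the
  orbit map and its derivative, hence does not change when the lift is multiplied by elements of the
  subgroup.\<close>

lemma zmat_orb:
  assumes "x \<in> W"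
  shows "zmat (pd i (\<lambda>y. orb (\<sigma> y)) x) (orb (\<sigma> x)) = \<sigma> x ** prm (X i x) ** transpose (\<sigma> x)"
proof -
  have "axis a 1 \<bullet> (A *v axis d 1) = A $ a $ d" for A :: "real^5^5" and a d
    by (simp add: inner_axis' matrix_vector_mult_basis column_def)
  moreover have "(transpose (\<sigma> x) *v p) \<bullet> (B *v (transpose (\<sigma> x) *v q)) = p \<bullet> ((\<sigma> x ** B ** transpose (\<sigma> x)) *v q)" for p q and B :: "real^5^5"
    by (simp add: dot_lmul_matrix matrix_vector_mul_assoc matrix_mul_assoc del: vector_transpose_matrix transpose_matrix_vector
        flip: dot_matrix_vector_mul)
      (metis (no_types, lifting) dot_lmul_matrix matrix_mul_assoc matrix_vector_mul_assoc transpose_matrix_vector)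
  ultimately show ?thesis
    unfolding zmat_def vec_eq_iff pd_orb_nth[OF assms]
    by (simp add: orb_def orbv_def inner_conj[OF SO5[OF assms]] dcub_inner[OF X_so5[OF assms]])
qed

end

section \<open>Charts, their local lifts and lift-free formulas\<close>

locale chart_lift = lift +
  fixes c :: "((real^5^5) set, 7) chart"
  assumes W_sub: "W \<subseteq> fst c" and coset: "y \<in> W \<Longrightarrow> left_coset (\<sigma> y) = snd c y"
begin

lemma emb_eq: "y \<in> W \<Longrightarrow> emb c y = orb (\<sigma> y)"
  by (simp add: emb_def coset_orb flip: coset)

lemma smooth_emb: "smooth_on W (emb c)"
  by (rule smooth_on_cong[OF open_W _ smooth_orb]) (simp add: emb_eq)

lemma Zf_eq: assumes "y \<in> W" shows "Zf c y i = \<sigma> y ** prm (X i y) ** transpose (\<sigma> y)"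
  using pd_cong[OF open_W assms, of "emb c" "\<lambda>y. orb (\<sigma> y)" i] zmat_orb[OF assms] assms
  by (simp add: Zf_def emb_eq)

lemma local_lift: "y \<in> W \<Longrightarrow> local_lift c y \<sigma>"
  unfolding local_lift_def using open_W smooth SO5 W_sub coset by blast

lemma tangent_m_eq:
  assumes "y \<in> W"
  shows "tangent_m \<sigma> y v = prm (\<Sum>i\<in>UNIV. v $ i *\<^sub>R X i y)"
proof -
  have "transpose (\<sigma> y) ** frechet_derivative \<sigma> (at y) v = (\<Sum>i\<in>UNIV. v $ i *\<^sub>R X i y)"
    by (simp add: frechet_derivative_eq_pd[OF d\<sigma>[OF assms]] X_def matmul.sum_right matmul_simps)
  moreover have "(\<Sum>i\<in>UNIV. v $ i *\<^sub>R X i y) \<in> so5"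
    by (simp add: so5_def transpose_sum transpose_scaleR X_skew[OF assms] sum_negf)
  ultimately show ?thesis by (simp add: tangent_m_def proj_m_eq)
qed

lemma sum_Zf:
  assumes "y \<in> W"
  shows "(\<Sum>i\<in>UNIV. v $ i *\<^sub>R Zf c y i) = \<sigma> y ** tangent_m \<sigma> y v ** transpose (\<sigma> y)"
  by (simp add: Zf_eq assms tangent_m_eq linear_sum[OF prm_linear] linear_cmul[OF prm_linear]
      matmul.sum_left matmul.sum_right matmul_simps)

text \<open>The right side mentions only the chart. So the immersion condition, which the atlas
  guarantees for some lift, passes to every lift.\<close>

lemma inj_tangent_iff:
  assumes y: "y \<in> W"
  shows "inj (tangent_m \<sigma> y) \<longleftrightarrow> (\<forall>v. (\<Sum>i\<in>UNIV. v $ i *\<^sub>R Zf c y i) = 0 \<longrightarrow> v = 0)"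
proof -
  have "linear (tangent_m \<sigma> y)"
    by (simp add: linear_iff tangent_m_eq[OF y] scaleR_add_left sum.distrib linear_add[OF prm_linear]
        linear_cmul[OF prm_linear] flip: scaleR_sum_right scaleR_scaleR)
  then have "inj (tangent_m \<sigma> y) \<longleftrightarrow> (\<forall>v. tangent_m \<sigma> y v = 0 \<longrightarrow> v = 0)"
    by (rule linear_injective_0)
  moreover have "\<sigma> y ** A ** transpose (\<sigma> y) = 0 \<longleftrightarrow> A = 0" for A
    using inner_conj[OF SO5[OF y], of A A] by (metis inner_eq_zero_iff)
  ultimately show ?thesis by (simp add: sum_Zf[OF y])
qed

end

lemma local_lift_chart_lift:
  assumes "local_lift c x \<sigma>"
  obtains W where "x \<in> W" "chart_lift W \<sigma> c"
proof -
  obtain W where "open W" "x \<in> W" "W \<subseteq> fst c" "smooth_on W \<sigma>" "\<forall>y\<in>W. \<sigma> y \<in> SO5 \<and> left_coset (\<sigma> y) = snd c y"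
    using assms unfolding local_lift_def by blast
  then show ?thesis using that[of W] by (simp add: chart_lift_def chart_lift_axioms_def lift_def)
qed

lemma berger_atlas_lift:
  assumes "c \<in> berger_atlas" "x \<in> fst c"
  obtains W \<sigma> where "x \<in> W" "chart_lift W \<sigma> c"
proof -
  obtain \<sigma> where "local_lift c x \<sigma>" using assms unfolding berger_atlas_def by blast
  then show ?thesis using local_lift_chart_lift that by metis
qed

lemma atlas_immersion:
  assumes "c \<in> berger_atlas" "x \<in> fst c" "(\<Sum>i\<in>UNIV. v $ i *\<^sub>R Zf c x i) = 0"
  shows "v = 0"
proof -
  obtain \<sigma> where \<sigma>: "local_lift c x \<sigma>" "inj (tangent_m \<sigma> x)"
    using assms(1,2) unfolding berger_atlas_def by blast
  then obtain W where "x \<in> W" "chart_lift W \<sigma> c" by (metis local_lift_chart_lift)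
  then show ?thesis using chart_lift.inj_tangent_iff \<sigma>(2) assms(3) by blast
qed

text \<open>The chosen lift disappears, because \<open>Zf\<close> is computed from the chart alone
  and conjugation preserves the inner product. The 3 comes from \<open>killing_so5\<close>.\<close>

lemma berger_metric_eq:
  assumes "c \<in> berger_atlas" "x \<in> fst c"
  shows "berger_metric c x $ i $ j = 3 * (Zf c x i \<bullet> Zf c x j)"
proof -
  obtain \<sigma>' where "local_lift c x \<sigma>'" using assms unfolding berger_atlas_def by blast
  define \<sigma> where "\<sigma> = (SOME \<sigma>. local_lift c x \<sigma>)"
  have "local_lift c x \<sigma>" unfolding \<sigma>_def by (rule someI[of _ \<sigma>']) fact
  then obtain W where x: "x \<in> W" and "chart_lift W \<sigma> c" by (metis local_lift_chart_lift)
  then interpret chart_lift W \<sigma> c by simp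
  have t: "tangent_m \<sigma> x (axis i 1) = prm (X i x)" for i
    by (simp add: tangent_m_eq[OF x] axis_def if_distrib if_distribR cong: if_cong)
  have "berger_metric c x $ i $ j = - killing (prm (X i x)) (prm (X j x))"
    by (simp add: berger_metric_def t flip: \<sigma>_def)
  then show ?thesis
    by (simp add: killing_so5 prm_so5 Zf_eq[OF x] inner_conj[OF SO5[OF x]])
qed

lemma orbv_eq_sum_orb: "(\<Sum>a\<in>UNIV. u $ a *\<^sub>R orb P $ a) = orbv P u"
proof -
  have "linear (orbv P)"
    unfolding orbv_def
    by (simp add: linear_iff matvec.add_right matvec.scaleR_right linear_add[OF cub_linear]
        linear_cmul[OF cub_linear] matmul_simps del: transpose_matrix_vector)
  then have "(\<Sum>a\<in>UNIV. u $ a *\<^sub>R orbv P (axis a 1)) = orbv P (\<Sum>a\<in>UNIV. u $ a *\<^sub>R axis a 1)"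
    by (simp add: linear_sum linear_cmul)
  then show ?thesis using basis_expansion[of u] by (simp add: orb_def scalar_mult_eq_scaleR)
qed

text \<open>The transported cubic form paired with the anticommutator of tangent matrices; dividing
  by \<open>sqrt 3\<close> cancels the factor in \<open>cub_mbas\<close>.\<close>

definition destab :: "real^5 \<Rightarrow> ((real^5^5) set, 7) tensor2" where
  "destab u c x = (\<chi> i j. ((\<Sum>a\<in>UNIV. u $ a *\<^sub>R emb c x $ a) \<bullet>
     (Zf c x i ** Zf c x j + Zf c x j ** Zf c x i)) / sqrt 3)"

section \<open>Metric, curvature and destabilizing field in the coframe of a lift\<close>

locale berger_lift = chart_lift +
  fixes s :: real
  assumes atlas: "c \<in> berger_atlas" and s_pos: "s > 0"
begin

text \<open>The coframe is the m-part of the Maurer-Cartan form; index \<open>a\<close> numbers the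
  basis of m, index \<open>i\<close> the coordinates.\<close>

definition e :: "real^7 \<Rightarrow> real^7^7" where
  "e y = (\<chi> a i. theta (X i y) $ a)"

lemma e_nth: "e y $ a $ i = theta (X i y) $ a"
  by (simp add: e_def)

lemma prm_X: "prm (X i y) = (\<Sum>a\<in>UNIV. e y $ a $ i *\<^sub>R mbas a)"
  by (simp add: prm_def e_nth)

lemma bounded_linear_theta: "bounded_linear theta" and bounded_linear_Lam: "bounded_linear Lam"
  using theta_linear Lam_linear linear_conv_bounded_linear by blast+

lemmas dX = smooth_on_differentiable[OF smooth_X]

lemma smooth_e: "smooth_on W e"
proof (intro smooth_on_vec[OF open_W])
  fix a i
  have "smooth_on W (\<lambda>y. theta (X i y) $ a)"
    by (intro smooth_on_vec_nth[OF open_W] smooth_on_bounded_linear[OF open_W bounded_linear_theta] smooth_X)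
  then show "smooth_on W (\<lambda>y. e y $ a $ i)" by (simp add: e_nth)
qed

lemma pd_e_nth: "y \<in> W \<Longrightarrow> pd i e y $ a $ j = theta (pd i (X j) y) $ a"
proof -
  assume y: "y \<in> W"
  have "pd i (\<lambda>y. e y $ a $ j) y = theta (pd i (X j) y) $ a"
    unfolding e_nth
    using pd_vec_nth[OF differentiable_bounded_linear[OF bounded_linear_theta dX[OF y]]]
      pd_bounded_linear[OF bounded_linear_theta dX[OF y]] by metis
  then show ?thesis using pd_matrix_nth[OF smooth_on_differentiable[OF smooth_e y]] by metis
qed

lemma invertible_e: assumes "y \<in> W" shows "invertible (e y)"
proof -
  have "v = 0" if "e y *v v = 0" for v
  proof -
    have "e y *v v = theta (\<Sum>i\<in>UNIV. v $ i *\<^sub>R X i y)"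
      by (simp add: vec_eq_iff matrix_vector_mult_def e_nth linear_sum[OF theta_linear] linear_cmul[OF theta_linear]
          sum_component mult.commute)
    then have "tangent_m \<sigma> y v = 0" using that by (simp add: tangent_m_eq[OF assms] prm_zero_iff)
    then have "(\<Sum>i\<in>UNIV. v $ i *\<^sub>R Zf c y i) = 0" by (simp add: sum_Zf[OF assms])
    then show ?thesis using atlas_immersion[OF atlas] assms W_sub by blast
  qed
  then show ?thesis
    using matrix_left_invertible_ker[of "e y"] invertible_left_inverse by blast
qed

lemma metric_frame:
  assumes "y \<in> W"
  shows "s *\<^sub>R berger_metric c y = transpose (e y) ** diag (\<lambda>a. s * 3 * nrm a) ** e y"
proof -
  have "(s *\<^sub>R berger_metric c y) $ i $ j = (transpose (e y) ** diag (\<lambda>a. s * 3 * nrm a) ** e y) $ i $ j" for i j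
    unfolding congruence_diag_nth
    using assms W_sub atlas
    by (simp add: berger_metric_eq subset_iff Zf_eq inner_conj[OF SO5] inner_prm e_nth sum_distrib_left mult_ac)
  then show ?thesis by (simp add: vec_eq_iff)
qed

text \<open>The metric is diagonal with constant weights, where 3 is the Killing factor. The
  connection form is \<open>Lam\<close> of the Maurer-Cartan form: \<open>Lam_skew\<close> makes it
  metric, and \<open>maurer_cartan\<close> with \<open>theta_bracket\<close> makes it
  torsion-free.\<close>

sublocale moving_frame W "\<lambda>a. s * 3 * nrm a" e "\<lambda>i y. Lam (X i y)" "\<lambda>x. s *\<^sub>R berger_metric c x"
proof
  show "open W" by (rule open_W)
  show "s * 3 * nrm a \<noteq> 0" for a using s_pos nrm_pos[of a] by simp
  show "smooth_on W e" by (rule smooth_e)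
  show "smooth_on W (\<lambda>y. Lam (X i y))" for i
    by (intro smooth_on_bounded_linear[OF open_W bounded_linear_Lam] smooth_X)
  show "invertible (e x)" if "x \<in> W" for x by (rule invertible_e[OF that])
  show "s *\<^sub>R berger_metric c x = transpose (e x) ** diag (\<lambda>a. s * 3 * nrm a) ** e x" if "x \<in> W" for x
    by (rule metric_frame[OF that])
  show "transpose (Lam (X i x)) ** diag (\<lambda>a. s * 3 * nrm a) = - (diag (\<lambda>a. s * 3 * nrm a) ** Lam (X i x))" for i x
  proof -
    have "diag (\<lambda>a. s * 3 * nrm a) = (s * 3) *\<^sub>R diag nrm" by (simp add: diag_def vec_eq_iff)
    then show ?thesis using Lam_skew[of "X i x"] by (simp add: matmul_simps)
  qed
  show "(pd i e x + Lam (X i x) ** e x) $ a $ j = (pd j e x + Lam (X j x) ** e x) $ a $ i" if x: "x \<in> W" for i j x a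
  proof -
    have L: "(Lam (X i x) ** e x) $ a $ j = (Lam (X i x) *v theta (X j x)) $ a" for i j
      by (simp add: matmul_nth matrix_vector_mult_def e_nth)
    have "theta (pd i (X j) x) - theta (pd j (X i) x) = - (Lam (X i x) *v theta (X j x) - Lam (X j x) *v theta (X i x))"
      using maurer_cartan[OF x, of i j] theta_bracket[OF X_so5[OF x] X_so5[OF x], of i j]
      by (simp add: linear_neg[OF theta_linear] flip: linear_diff[OF theta_linear])
    from arg_cong[OF this, of "\<lambda>v. v $ a"] show ?thesis
      by (simp add: pd_e_nth[OF x] L)
  qed
qed

text \<open>By the Maurer-Cartan equation the exterior derivative of the connection form is
  \<open>- Lam\<close> of the bracket, which turns \<open>Om\<close> into the algebraic
  \<open>curv\<close>.\<close>

lemma Om_eq: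
  assumes x: "x \<in> W"
  shows "Om i j x = (\<Sum>c\<in>UNIV. \<Sum>d\<in>UNIV. (e x $ c $ i * e x $ d $ j) *\<^sub>R curv (mbas c) (mbas d))"
proof -
  have "pd i (\<lambda>y. Lam (X j y)) x - pd j (\<lambda>y. Lam (X i y)) x = - Lam (bracket (X i x) (X j x))"
    using maurer_cartan[OF x, of i j]
    by (simp add: pd_bounded_linear[OF bounded_linear_Lam dX[OF x]] flip: linear_diff[OF Lam_linear] linear_neg[OF Lam_linear])
  then have "Om i j x = curv (X i x) (X j x)" by (simp add: Om_def curv_def)
  then show ?thesis by (simp add: curv_eq[OF X_so5[OF x] X_so5[OF x]] e_nth)
qed

text \<open>The constant is the 27/20 of \<open>ricci_constant\<close> divided by the metric factor
  3 s.\<close>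

lemma ricci_eq:
  assumes "x \<in> W"
  shows "ricci (\<lambda>x. s *\<^sub>R berger_metric c x) x = (9 / (20 * s)) *\<^sub>R (s *\<^sub>R berger_metric c x)"
proof -
  have "diag (\<lambda>a. s * 3 * nrm a) = (s * 3) *\<^sub>R diag nrm" by (simp add: diag_def vec_eq_iff)
  then show ?thesis
    unfolding ricci_frame[OF assms Om_eq[OF assms]] ricci_constant metric_frame[OF assms]
    using s_pos by (simp add: matmul_simps)
qed

context
  fixes u :: "real^5"
begin

definition w :: "real^7 \<Rightarrow> real^5" where
  "w y = transpose (\<sigma> y) *v u"

lemma bounded_linear_wT: "bounded_linear (\<lambda>Y :: real^5^5. transpose Y *v u)"
  using bounded_linear_compose[OF bounded_bilinear.bounded_linear_left[OF bounded_bilinear_matrix_vector_mult] bounded_linear_transpose] .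

lemma dw: "x \<in> W \<Longrightarrow> w differentiable (at x)"
  unfolding w_def[abs_def] by (rule differentiable_bounded_linear[OF bounded_linear_wT d\<sigma>])

lemma pd_w: "x \<in> W \<Longrightarrow> pd i w x = - (X i x *v w x)"
  unfolding w_def[abs_def] pd_bounded_linear[OF bounded_linear_wT d\<sigma>]
  by (simp add: pd_\<sigma> matrix_transpose_mul X_skew matrix_vector_mul_assoc matmul_simps matvec.minus_left
      del: transpose_matrix_vector)

lemma linear_fw:
  assumes "linear f" "x \<in> W"
  shows "(\<lambda>y. f (w y)) differentiable (at x)"
    "pd m (\<lambda>y. f (w y)) x - transpose (Lam (X m x)) ** f (w x) - f (w x) ** Lam (X m x) = nab (X m x) f (w x)"
proof -
  have bl: "bounded_linear f" using assms(1) linear_conv_bounded_linear by blast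
  show "(\<lambda>y. f (w y)) differentiable (at x)"
    by (rule differentiable_bounded_linear[OF bl dw[OF assms(2)]])
  show "pd m (\<lambda>y. f (w y)) x - transpose (Lam (X m x)) ** f (w x) - f (w x) ** Lam (X m x) = nab (X m x) f (w x)"
    by (simp add: pd_bounded_linear[OF bl dw[OF assms(2)]] pd_w[OF assms(2)] linear_neg[OF assms(1)] nab_def)
qed

text \<open>All factors are conjugated by \<open>\<sigma> y\<close>, and the pairing is invariant
  under this; at the base point \<open>cub_mbas\<close> applies.\<close>

lemma destab_frame:
  assumes y: "y \<in> W"
  shows "destab u c y = transpose (e y) ** Hf (w y) ** e y"
proof -
  have "destab u c y $ i $ j = (transpose (e y) ** Hf (w y) ** e y) $ i $ j" for i j
  proof -
    let ?\<sigma> = "\<sigma> y" and ?p = "prm (X i y)" and ?q = "prm (X j y)"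
    have ZZ: "(?\<sigma> ** A ** transpose ?\<sigma>) ** (?\<sigma> ** B ** transpose ?\<sigma>) = ?\<sigma> ** (A ** B) ** transpose ?\<sigma>" for A B
    proof -
      have "(?\<sigma> ** A ** transpose ?\<sigma>) ** (?\<sigma> ** B ** transpose ?\<sigma>) = ?\<sigma> ** A ** (transpose ?\<sigma> ** ?\<sigma>) ** B ** transpose ?\<sigma>"
        by (simp only: matrix_mul_assoc)
      then show ?thesis by (simp add: orth[OF y] matrix_mul_assoc)
    qed
    have "destab u c y $ i $ j = orbv ?\<sigma> u \<bullet> (?\<sigma> ** (?p ** ?q + ?q ** ?p) ** transpose ?\<sigma>) / sqrt 3"
      by (simp add: destab_def emb_eq[OF y] orbv_eq_sum_orb Zf_eq[OF y] ZZ matmul_simps)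
    also have "\<dots> = cub (w y) \<bullet> (?p ** ?q + ?q ** ?p) / sqrt 3"
      unfolding orbv_def inner_conj[OF SO5[OF y]] by (simp add: w_def)
    also have "?p ** ?q + ?q ** ?p = (\<Sum>a\<in>UNIV. \<Sum>b\<in>UNIV. (e y $ a $ i * e y $ b $ j) *\<^sub>R (mbas a ** mbas b + mbas b ** mbas a))"
    proof -
      have "?q ** ?p = (\<Sum>a\<in>UNIV. \<Sum>b\<in>UNIV. (e y $ a $ i * e y $ b $ j) *\<^sub>R (mbas b ** mbas a))"
        unfolding prm_X by (simp add: matmul.sum_left matmul.sum_right matmul_simps scaleR_sum_right mult_ac)
      moreover have "?p ** ?q = (\<Sum>a\<in>UNIV. \<Sum>b\<in>UNIV. (e y $ a $ i * e y $ b $ j) *\<^sub>R (mbas a ** mbas b))"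
        unfolding prm_X by (subst sum.swap) (simp add: matmul.sum_left matmul.sum_right matmul_simps scaleR_sum_right mult_ac)
      ultimately show ?thesis by (simp add: scaleR_add_right sum.distrib)
    qed
    also have "cub (w y) \<bullet> \<dots> / sqrt 3 = (\<Sum>a\<in>UNIV. \<Sum>b\<in>UNIV. e y $ a $ i * e y $ b $ j * Hf (w y) $ a $ b)"
      by (simp add: inner_sum_right cub_mbas sum_divide_distrib mult.assoc)
    finally show ?thesis by (simp add: congruence_nth mult.assoc)
  qed
  then show ?thesis by (simp add: vec_eq_iff)
qed

lemma cov2_destab:
  assumes x: "x \<in> W"
  shows "(\<chi> i j. cov2 (\<lambda>x. s *\<^sub>R berger_metric c x) (destab u c) k i j x) =
    transpose (e x) ** (\<Sum>a\<in>UNIV. e x $ a $ k *\<^sub>R DH a (w x)) ** e x"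
proof -
  have "(\<chi> i j. cov2 (\<lambda>x. s *\<^sub>R berger_metric c x) (destab u c) k i j x) =
      transpose (e x) ** (pd k (\<lambda>y. Hf (w y)) x - transpose (Lam (X k x)) ** Hf (w x) - Hf (w x) ** Lam (X k x)) ** e x"
    by (rule cov2_frame[OF x linear_fw(1)[OF Hf_linear x] destab_frame])
  then show ?thesis unfolding linear_fw(2)[OF Hf_linear x] by (simp add: nab_Hf[OF X_so5[OF x]] e_nth)
qed

lemma cov3_destab:
  assumes x: "x \<in> W"
  shows "(\<chi> i j. cov3 (\<lambda>x. s *\<^sub>R berger_metric c x) (cov2 (\<lambda>x. s *\<^sub>R berger_metric c x) (destab u c)) m k i j x) =
    transpose (e x) ** (\<Sum>a\<in>UNIV. e x $ a $ k *\<^sub>R (\<Sum>d\<in>UNIV. e x $ d $ m *\<^sub>R FH d a (w x))) ** e x"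
proof -
  have "(\<chi> i j. cov3 (\<lambda>x. s *\<^sub>R berger_metric c x) (cov2 (\<lambda>x. s *\<^sub>R berger_metric c x) (destab u c)) m k i j x) =
    transpose (e x) ** (\<Sum>a\<in>UNIV. e x $ a $ k *\<^sub>R (pd m (\<lambda>y. DH a (w y)) x - transpose (Lam (X m x)) ** DH a (w x)
      - DH a (w x) ** Lam (X m x) - (\<Sum>d\<in>UNIV. Lam (X m x) $ d $ a *\<^sub>R DH d (w x)))) ** e x"
    by (rule cov3_frame[where D="\<lambda>a y. DH a (w y)", OF x linear_fw(1)[OF DH_linear x] cov2_destab])
  then show ?thesis unfolding linear_fw(2)[OF DH_linear x] nab_DH[OF X_so5[OF x]] e_nth .
qed

lemma destab_tt:
  assumes x: "x \<in> W"
  shows "tr_metric (\<lambda>x. s *\<^sub>R berger_metric c x) (destab u c) x = 0"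
    "divergence (\<lambda>x. s *\<^sub>R berger_metric c x) (destab u c) x = 0"
proof -
  have "(\<Sum>a\<in>UNIV. f a / (s * 3 * nrm a)) = (\<Sum>a\<in>UNIV. f a / nrm a) / (s * 3)" for f
    by (simp add: sum_divide_distrib mult_ac)
  then show "tr_metric (\<lambda>x. s *\<^sub>R berger_metric c x) (destab u c) x = 0"
    "divergence (\<lambda>x. s *\<^sub>R berger_metric c x) (destab u c) x = 0"
    using tr_metric_frame[where h="destab u c" and H="Hf (w x)", OF x destab_frame[OF x]] divergence_frame[OF x cov2_destab[OF x]]
    by (simp_all add: trace_Hf divergence_Hf)
qed

text \<open>The contributions are (19/20) / (3 s) from the rough Laplacian and -2 (7/8) / (3 s) from
  the curvature.\<close>

lemma stability_operator:
  assumes x: "x \<in> W"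
  shows "rough_laplacian (\<lambda>x. s *\<^sub>R berger_metric c x) (destab u c) x
      - 2 *\<^sub>R curv_action (\<lambda>x. s *\<^sub>R berger_metric c x) (destab u c) x
    = transpose (e x) ** ((- 4 / (15 * s)) *\<^sub>R Hf (w x)) ** e x"
proof -
  have "(\<Sum>a\<in>UNIV. (1 / (s * 3 * nrm a)) *\<^sub>R FH a a (w x)) = (1 / (s * 3)) *\<^sub>R (\<Sum>a\<in>UNIV. (1 / nrm a) *\<^sub>R FH a a (w x))"
    by (simp add: scaleR_sum_right)
  then have 1: "(\<Sum>a\<in>UNIV. (1 / (s * 3 * nrm a)) *\<^sub>R FH a a (w x)) = (1 / (s * 3)) *\<^sub>R ((- 19 / 20) *\<^sub>R Hf (w x))"
    by (simp only: laplacian_Hf)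
  have "(\<chi> d a. \<Sum>b\<in>UNIV. (transpose (curv (mbas b) (mbas d)) ** Hf (w x)) $ a $ b / (s * 3 * nrm b))
      = (1 / (s * 3)) *\<^sub>R (\<chi> d a. \<Sum>b\<in>UNIV. (transpose (curv (mbas b) (mbas d)) ** Hf (w x)) $ a $ b / nrm b)"
    by (simp add: vec_eq_iff sum_divide_distrib mult_ac)
  then have 2: "(\<chi> d a. \<Sum>b\<in>UNIV. (transpose (curv (mbas b) (mbas d)) ** Hf (w x)) $ a $ b / (s * 3 * nrm b))
      = (1 / (s * 3)) *\<^sub>R ((7 / 8) *\<^sub>R Hf (w x))"
    by (simp add: curvature_Hf)
  have 3: "curv_action (\<lambda>x. s *\<^sub>R berger_metric c x) (destab u c) x = transpose (e x) **
      (\<chi> d a. \<Sum>b\<in>UNIV. (transpose (curv (mbas b) (mbas d)) ** Hf (w x)) $ a $ b / (s * 3 * nrm b)) ** e x"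
    by (rule curv_action_frame[OF x Om_eq[OF x]]) (rule destab_frame[OF x])
  show ?thesis
    unfolding rough_laplacian_frame[OF x cov3_destab[OF x]] 3 1 2
    using s_pos by (simp add: matmul_simps flip: scaleR_diff_left scaleR_minus_left)
qed

text \<open>\<open>w x\<close> is a rotation of \<open>u\<close>, so \<open>norm_Hf\<close> gives
  the same value everywhere. The constant is (4/15) (28/25) / 9; two powers of s come from the
  inverse metrics and one from the operator.\<close>

lemma stability_density:
  assumes x: "x \<in> W"
  shows "inner_metric (\<lambda>x. s *\<^sub>R berger_metric c x)
    (\<lambda>x. rough_laplacian (\<lambda>x. s *\<^sub>R berger_metric c x) (destab u c) x
      - 2 *\<^sub>R curv_action (\<lambda>x. s *\<^sub>R berger_metric c x) (destab u c) x) (destab u c) x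
    = - (112 / (3375 * s ^ 3)) * (u \<bullet> u)"
proof -
  have "inner_metric (\<lambda>x. s *\<^sub>R berger_metric c x)
    (\<lambda>x. rough_laplacian (\<lambda>x. s *\<^sub>R berger_metric c x) (destab u c) x
      - 2 *\<^sub>R curv_action (\<lambda>x. s *\<^sub>R berger_metric c x) (destab u c) x) (destab u c) x
    = (\<Sum>a\<in>UNIV. \<Sum>b\<in>UNIV. ((- 4 / (15 * s)) *\<^sub>R Hf (w x)) $ a $ b * Hf (w x) $ a $ b / (s * 3 * nrm a * (s * 3 * nrm b)))"
    by (rule inner_metric_frame[OF x]) (rule stability_operator[OF x], rule destab_frame[OF x])
  also have "\<dots> = (- 4 / (15 * s)) / (9 * s^2) * (\<Sum>a\<in>UNIV. \<Sum>b\<in>UNIV. Hf (w x) $ a $ b * Hf (w x) $ a $ b / (nrm a * nrm b))"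
    by (simp add: sum_distrib_left power2_eq_square mult_ac)
  also have "\<dots> = (- 4 / (15 * s)) / (9 * s^2) * (28 / 25 * (w x \<bullet> w x))"
    unfolding norm_Hf ..
  also have "w x \<bullet> w x = u \<bullet> u"
  proof -
    have "w x \<bullet> w x = u \<bullet> (\<sigma> x *v (transpose (\<sigma> x) *v u))"
      using dot_lmul_matrix[of u "\<sigma> x" "w x"] by (simp add: w_def)
    then show ?thesis
      by (simp add: matrix_vector_mul_assoc orth[OF x] del: transpose_matrix_vector)
  qed
  finally show ?thesis by (simp add: field_simps power_def numeral_eq_Suc)
qed

lemma destab_nonzero:
  assumes x: "x \<in> W" and "u \<noteq> 0"
  shows "destab u c x \<noteq> 0"
proof
  assume "destab u c x = 0"
  then have "inner_metric g k (destab u c) x = 0" for g k by (simp add: inner_metric_def)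
  then have "(112 / (3375 * s ^ 3)) * (u \<bullet> u) = 0"
    using stability_density[OF x] by simp
  then show False using assms(2) s_pos by simp
qed

end

end

section \<open>Transition maps\<close>

lemma SO5_mult: "P \<in> SO5 \<Longrightarrow> Q \<in> SO5 \<Longrightarrow> P ** Q \<in> SO5"
  by (simp add: SO5_def rotation_matrix_def orthogonal_matrix_mul det_mul)

lemma SO5_transpose: "P \<in> SO5 \<Longrightarrow> transpose P \<in> SO5"
  by (simp add: SO5_def rotation_matrix_def orthogonal_matrix_transpose det_transpose)

text \<open>Coordinates of the second kind on the subgroup near the identity.\<close>

definition irr_param :: "real^3 \<Rightarrow> real^5^5" where
  "irr_param z = rotK 1 (z $ 1) ** rotK 2 (z $ 2) ** rotK 3 (z $ 3)"

lemma irr_param_SO3_irr: "irr_param z \<in> SO3_irr"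
  by (simp add: irr_param_def SO3_irr_mult rotK_SO3_irr)

lemma irr_param_0: "irr_param 0 = mat 1"
  by (simp add: irr_param_def rotK_0)

lemma has_derivative_irr_param:
  "(irr_param has_derivative (\<lambda>z. \<Sum>i\<in>UNIV. z $ i *\<^sub>R hbas i)) (at 0)"
proof -
  have d: "((\<lambda>z::real^3. rotK i (z $ i)) has_derivative (\<lambda>z. z $ i *\<^sub>R hbas i)) (at 0)" for i
  proof -
    have "((\<lambda>z::real^3. z $ i) has_derivative (\<lambda>z. z $ i)) (at 0)"
      by (rule bounded_linear_imp_has_derivative[OF bounded_linear_vec_nth])
    moreover have "(rotK i has_derivative (\<lambda>t. t *\<^sub>R hbas i)) (at ((0 :: real^3) $ i))"
      using has_derivative_rotK[of i] by simp
    ultimately show ?thesis by (rule has_derivative_compose)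
  qed
  show ?thesis
    unfolding irr_param_def[abs_def]
    using bounded_bilinear.FDERIV[OF bounded_bilinear_matrix_mult bounded_bilinear.FDERIV[OF bounded_bilinear_matrix_mult d[of 1] d[of 2]] d[of 3]]
    by (rule has_derivative_eq_rhs) (simp add: rotK_0 sum_3 add_ac)
qed

lemma continuous_on_irr_param: "continuous_on UNIV irr_param"
proof -
  have "continuous_on UNIV (\<lambda>z::real^3. rotK i (z $ i))" for i
    by (rule continuous_on_compose2[OF continuous_on_rotK]) (auto intro: continuous_intros)
  then show ?thesis unfolding irr_param_def[abs_def]
    by (intro bounded_bilinear.continuous_on[OF bounded_bilinear_matrix_mult])
qed

text \<open>The equation says R (2 + R) = 0, and the determinant condition excludes the eigenvalue
  -1 of the involution 1 + R.\<close>

lemma symmetric_involution_eq_one: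
  fixes R :: "real^5^5"
  assumes R: "transpose R = R" and "(mat 1 + R) ** (mat 1 + R) = mat 1" and det: "det (mat 2 + R) \<noteq> 0"
  shows "R = 0"
proof -
  have 2: "mat 2 = mat 1 + (mat 1 :: real^5^5)" by (simp add: mat_def vec_eq_iff)
  have "R ** (mat 2 + R) = (mat 1 + R) ** (mat 1 + R) - mat 1"
    unfolding 2 matmul.add_left matmul.add_right by (simp add: algebra_simps)
  then have "R ** (mat 2 + R) = 0" using assms by simp
  then have "(R ** (mat 2 + R)) ** matrix_inv (mat 2 + R) = 0"
    by (simp only: matmul.zero_left)
  then have "R ** ((mat 2 + R) ** matrix_inv (mat 2 + R)) = 0"
    by (simp only: matrix_mul_assoc)
  then show ?thesis using det by (simp add: matrix_inv_right invertible_det_nz)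
qed

context chart_lift
begin

text \<open>Near \<open>\<sigma> y\<close> every matrix is a product of a value of \<open>\<sigma>\<close>, an element of the subgroup, and a
  symmetric matrix near the identity, which is the identity if the product is orthogonal.\<close>

lemma coset_in_lift_image:
  assumes y: "y \<in> W" and inj: "inj (tangent_m \<sigma> y)" and N: "open N" "y \<in> N" "N \<subseteq> W"
  obtains \<delta> where "\<delta> > 0" "\<And>P. P \<in> SO5 \<Longrightarrow> dist P (\<sigma> y) < \<delta> \<Longrightarrow> \<exists>y'\<in>N. left_coset (\<sigma> y') = left_coset P"
proof -
  define F :: "(real^7) \<times> (real^3) \<times> (real^5^5) \<Rightarrow> real^5^5" where
    "F p = \<sigma> (fst p) ** (irr_param (fst (snd p)) ** (mat 1 + (snd (snd p) + transpose (snd (snd p)))))" for p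
  define F' :: "(real^7) \<times> (real^3) \<times> (real^5^5) \<Rightarrow> real^5^5" where
    "F' p = \<sigma> y ** ((\<Sum>i\<in>UNIV. fst p $ i *\<^sub>R X i y) + (\<Sum>i\<in>UNIV. fst (snd p) $ i *\<^sub>R hbas i) + (snd (snd p) + transpose (snd (snd p))))" for p
  have dF: "(F has_derivative F') (at (y, 0, 0))"
  proof -
    have 1: "((\<lambda>p. \<sigma> (fst p)) has_derivative (\<lambda>p. \<Sum>i\<in>UNIV. fst p $ i *\<^sub>R pd i \<sigma> y)) (at (y, 0 :: real^3, 0 :: real^5^5))"
      using has_derivative_compose[OF has_derivative_fst[OF has_derivative_ident], of \<sigma> _ "(y, 0 :: real^3, 0 :: real^5^5)"] has_derivative_pd[OF d\<sigma>[OF y]]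
      by simp
    have "((\<lambda>p::(real^7) \<times> (real^3) \<times> (real^5^5). fst (snd p)) has_derivative (\<lambda>p. fst (snd p))) (at (y, 0, 0))"
      by (intro has_derivative_fst has_derivative_snd has_derivative_ident)
    from has_derivative_compose[OF this, of irr_param]
    have 2: "((\<lambda>p. irr_param (fst (snd p))) has_derivative (\<lambda>p. \<Sum>i\<in>UNIV. fst (snd p) $ i *\<^sub>R hbas i)) (at (y, 0 :: real^3, 0 :: real^5^5))"
      using has_derivative_irr_param by simp
    have 3: "((\<lambda>p. mat 1 + (snd (snd p) + transpose (snd (snd p)))) has_derivative (\<lambda>p. 0 + (snd (snd p) + transpose (snd (snd p))))) (at (y, 0 :: real^3, 0 :: real^5^5))"
      by (intro has_derivative_add has_derivative_const has_derivative_snd has_derivative_ident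
          bounded_linear.has_derivative[OF bounded_linear_transpose])
    show ?thesis
      unfolding F_def
      using bounded_bilinear.FDERIV[OF bounded_bilinear_matrix_mult 1 bounded_bilinear.FDERIV[OF bounded_bilinear_matrix_mult 2 3]]
      by (rule has_derivative_eq_rhs)
        (simp add: F'_def fun_eq_iff irr_param_0 transpose_zero matmul_simps pd_\<sigma>[OF y] matmul.sum_right)
  qed
  have contF: "continuous_on (W \<times> UNIV) F"
    unfolding F_def
    by (intro bounded_bilinear.continuous_on[OF bounded_bilinear_matrix_mult] continuous_on_add continuous_on_const
        bounded_linear.continuous_on[OF bounded_linear_transpose] continuous_on_snd continuous_on_id
        continuous_on_compose2[OF smooth_on_continuous_on[OF smooth]] continuous_on_compose2[OF continuous_on_irr_param]
        continuous_on_fst) auto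
  have linF': "linear F'" using dF has_derivative_linear by blast
  have "surj F'"
  proof -
    have "\<exists>p. F' p = Y" for Y
    proof -
      define A where "A = transpose (\<sigma> y) ** Y"
      define B where "B = (1 / 2) *\<^sub>R (A - transpose A)"
      \<comment> \<open>A quarter, since \<open>S + transpose S\<close> doubles the symmetric matrix
        \<open>S\<close>. The skew part \<open>B\<close> is matched in m by the lift and in so(3) by
        \<open>irr_param\<close>.\<close>
      define S where "S = (1 / 4) *\<^sub>R (A + transpose A)"
      have B: "B \<in> so5" by (simp add: B_def so5_def transpose_simps algebra_simps)
      let ?f = "\<lambda>v. theta (\<Sum>i\<in>UNIV. v $ i *\<^sub>R X i y)"
      have linf: "linear ?f"
        by (simp add: linear_iff scaleR_add_left sum.distrib linear_add[OF theta_linear]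
            linear_cmul[OF theta_linear] flip: scaleR_sum_right scaleR_scaleR)
      have "inj ?f"
        unfolding linear_injective_0[OF linf]
      proof (intro allI impI)
        fix v assume "?f v = 0"
        then have "tangent_m \<sigma> y v = 0" by (simp add: tangent_m_eq[OF y] prm_zero_iff)
        then show "v = 0" using inj inj_tangent_iff[OF y] sum_Zf[OF y, of v] by (simp add: matmul_simps)
      qed
      then have "surj ?f" by (intro linear_injective_imp_surjective[OF linf]) simp_all
      then obtain v where v: "theta B = ?f v" by (blast dest: surjD)
      define Xv where "Xv = (\<Sum>i\<in>UNIV. v $ i *\<^sub>R X i y)"
      have Xv: "Xv \<in> so5"
        by (simp add: Xv_def so5_def transpose_sum transpose_scaleR X_skew[OF y] sum_negf)
      then have "B - Xv \<in> so5" using B by (simp add: so5_def transpose_simps)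
      moreover have "theta (B - Xv) = 0" using v by (simp add: linear_diff[OF theta_linear] Xv_def)
      ultimately have "B - Xv = (\<Sum>i\<in>UNIV. eta (B - Xv) $ i *\<^sub>R hbas i)"
        using so5_decomposition[of "B - Xv"] by simp
      then have "Xv + (\<Sum>i\<in>UNIV. eta (B - Xv) $ i *\<^sub>R hbas i) = B" by (simp add: algebra_simps)
      moreover have "S + transpose S = (1 / 2) *\<^sub>R (A + transpose A)"
        by (simp add: S_def transpose_simps add.commute flip: scaleR_add_left)
      moreover have "B + (1 / 2) *\<^sub>R (A + transpose A) = A"
        by (simp add: B_def vec_eq_iff field_simps)
      ultimately have "Xv + (\<Sum>i\<in>UNIV. eta (B - Xv) $ i *\<^sub>R hbas i) + (S + transpose S) = A"
        by simp
      then have "F' (v, eta (B - Xv), S) = \<sigma> y ** A" by (simp add: F'_def Xv_def)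
      then show ?thesis by (auto simp: A_def matrix_mul_assoc orth[OF y])
    qed
    then show ?thesis by (metis surjI)
  qed
  then obtain G where G: "linear G" "F' \<circ> G = id"
    using linear_surjective_right_inverse[OF linF'] by blast
  \<comment> \<open>The determinant condition is built into the domain so that the symmetric factor
    can later be forced to be the identity.\<close>
  define T :: "((real^7) \<times> (real^3) \<times> (real^5^5)) set" where
    "T = N \<times> (UNIV \<times> {S. det (mat 2 + (S + transpose S)) \<noteq> 0})"
  have "open {S :: real^5^5. det (mat 2 + (S + transpose S)) \<noteq> 0}"
  proof -
    have "continuous_on UNIV (\<lambda>S :: real^5^5. det (mat 2 + (S + transpose S)))"
      unfolding det_def by (intro continuous_intros bounded_linear.continuous_on[OF bounded_linear_transpose])
    then show ?thesis by (intro open_Collect_neq continuous_on_const)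
  qed
  then have "open T" unfolding T_def using N(1) by (intro open_Times open_UNIV)
  moreover have "(y, 0, 0) \<in> T"
  proof -
    have "det (mat 2 :: real^5^5) = (\<Prod>i\<in>UNIV. (mat 2 :: real^5^5) $ i $ i)"
      by (rule det_diagonal) (simp add: mat_def)
    then have "det (mat 2 :: real^5^5) \<noteq> 0" by (simp add: mat_def)
    then show ?thesis using N(2) by (simp add: T_def transpose_zero)
  qed
  ultimately have int: "(y, 0, 0) \<in> interior T" by (simp add: interior_open)
  \<comment> \<open>This open mapping theorem asks for continuity and for a derivative with a right
    inverse at the single point, which is all that is known of \<open>irr_param\<close>
    here.\<close>
  have "F (y, 0, 0) \<in> interior (F ` T)"
    by (rule sussmann_open_mapping[OF _ contF _ dF _ G(2) _ int])
      (use open_W y G(1) N(3) in \<open>auto simp: open_Times linear_conv_bounded_linear T_def\<close>)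
  moreover have "F (y, 0, 0) = \<sigma> y" by (simp add: F_def irr_param_0 transpose_zero)
  ultimately obtain \<delta> where \<delta>: "\<delta> > 0" "ball (\<sigma> y) \<delta> \<subseteq> F ` T"
    by (metis mem_interior)
  show ?thesis
  proof (rule that[OF \<delta>(1)])
    fix P assume P: "P \<in> SO5" "dist P (\<sigma> y) < \<delta>"
    then have "P \<in> F ` T" using \<delta>(2) by (auto simp: dist_commute)
    then obtain y' z S where yz: "y' \<in> N" and det: "det (mat 2 + (S + transpose S)) \<noteq> 0"
      and PF: "P = \<sigma> y' ** (irr_param z ** (mat 1 + (S + transpose S)))"
      by (auto simp: T_def F_def)
    define R where "R = S + transpose S"
    have R: "transpose R = R" by (simp add: R_def transpose_simps add.commute)
    have y': "y' \<in> W" using yz N(3) by blast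
    have k: "transpose (irr_param z) ** irr_param z = mat 1"
      using orthogonal_SO3_irr[OF irr_param_SO3_irr] by (simp add: orthogonal_matrix)
    have "transpose P ** P = (mat 1 + R) ** (transpose (irr_param z) ** ((transpose (\<sigma> y') ** \<sigma> y') ** (irr_param z ** (mat 1 + R))))"
      unfolding PF R_def[symmetric] by (simp add: matrix_transpose_mul transpose_add R matrix_mul_assoc)
    also have "\<dots> = (mat 1 + R) ** (mat 1 + R)"
      by (simp add: orth[OF y'] matrix_mul_assoc[of "transpose (irr_param z)"] k)
    finally have "R = 0"
      using SO5_orthogonal[OF P(1)] symmetric_involution_eq_one[OF R] det by (simp add: R_def)
    then have "P = \<sigma> y' ** irr_param z" using PF by (simp add: R_def[symmetric])
    then show "\<exists>y'\<in>N. left_coset (\<sigma> y') = left_coset P"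
      using yz left_coset_mult[OF irr_param_SO3_irr] by blast
  qed
qed

end

text \<open>A left inverse of \<open>f'\<close> reduces the claim to a map \<open>F\<close> whose
  derivative at \<open>\<phi> x\<close> is the identity. Continuity of \<open>\<phi>\<close> makes
  the error of \<open>F\<close> a small multiple of the increment of \<open>\<phi>\<close>;
  absorbing it bounds this increment linearly, and then the error is of lower order.\<close>

lemma differentiable_through_immersion:
  fixes f :: "'a::euclidean_space \<Rightarrow> 'b::euclidean_space" and \<phi> :: "'c::real_normed_vector \<Rightarrow> 'a"
  assumes f: "(f has_derivative f') (at (\<phi> x))" and inj: "inj f'"
    and comp: "((\<lambda>z. f (\<phi> z)) has_derivative h) (at x)" and cont: "isCont \<phi> x"
  shows "\<phi> differentiable (at x)"
proof -
  have linf: "linear f'" using f has_derivative_linear by blast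
  obtain L where L: "linear L" "L \<circ> f' = id"
    using linear_injective_left_inverse[OF linf inj] by blast
  have bl: "bounded_linear L" using L(1) linear_conv_bounded_linear by blast
  define F where "F y = L (f y)" for y
  have F: "(F has_derivative (\<lambda>v. v)) (at (\<phi> x))"
    unfolding F_def using L(2) by (intro has_derivative_eq_rhs[OF bounded_linear.has_derivative[OF bl f]]) (auto simp: fun_eq_iff)
  have H: "((\<lambda>z. F (\<phi> z)) has_derivative (\<lambda>v. L (h v))) (at x)"
    unfolding F_def by (rule bounded_linear.has_derivative[OF bl comp])
  define K where "K v = L (h v)" for v
  have blK: "bounded_linear K" unfolding K_def using H has_derivative_bounded_linear by blast
  then obtain C where C: "\<And>v. norm (K v) \<le> norm v * C" "C > 0"
    using bounded_linear.pos_bounded by metis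
  have "(\<phi> has_derivative K) (at x)"
    unfolding has_derivative_at_alt
  proof (intro conjI blK allI impI)
    fix e :: real assume e: "e > 0"
    \<comment> \<open>The bound 1/2 permits absorbing the error into \<open>norm p\<close>. The
      other bound is e/2 divided by the resulting Lipschitz constant 2 C + 2.\<close>
    define \<epsilon> where "\<epsilon> = min (1 / 2) ((e / 2) / (2 * C + 2))"
    have "\<epsilon> \<le> (e / 2) / (2 * C + 2)" "\<epsilon> \<le> 1 / 2" unfolding \<epsilon>_def by (rule min.cobounded2, rule min.cobounded1)
    moreover have "\<epsilon> > 0" using e C(2) by (simp add: \<epsilon>_def)
    ultimately have \<epsilon>: "\<epsilon> > 0" "\<epsilon> \<le> 1 / 2" "\<epsilon> * (2 * C + 2) \<le> e / 2"
      using C(2) pos_le_divide_eq[of "2 * C + 2" \<epsilon> "e / 2"] by linarith+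
    obtain d1 where d1: "d1 > 0" "\<And>y. norm (y - \<phi> x) < d1 \<Longrightarrow> norm (F y - F (\<phi> x) - (y - \<phi> x)) \<le> \<epsilon> * norm (y - \<phi> x)"
      using F \<epsilon>(1) unfolding has_derivative_at_alt by blast
    define \<epsilon>2 where "\<epsilon>2 = min 1 (e / 2)"
    have \<epsilon>2: "\<epsilon>2 > 0" "\<epsilon>2 \<le> 1" "\<epsilon>2 \<le> e / 2" using e by (auto simp: \<epsilon>2_def)
    obtain d2 where d2: "d2 > 0" "\<And>z. norm (z - x) < d2 \<Longrightarrow> norm (F (\<phi> z) - F (\<phi> x) - K (z - x)) \<le> \<epsilon>2 * norm (z - x)"
      using H \<epsilon>2(1) unfolding has_derivative_at_alt K_def by blast
    obtain d3 where d3: "d3 > 0" "\<And>z. norm (z - x) < d3 \<Longrightarrow> norm (\<phi> z - \<phi> x) < d1"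
      using cont d1(1) unfolding continuous_at_eps_delta dist_norm by blast
    show "\<exists>d>0. \<forall>z. norm (z - x) < d \<longrightarrow> norm (\<phi> z - \<phi> x - K (z - x)) \<le> e * norm (z - x)"
    proof (intro exI[of _ "min d2 d3"] conjI allI impI)
      show "min d2 d3 > 0" using d2 d3 by simp
      fix z assume z: "norm (z - x) < min d2 d3"
      define p where "p = \<phi> z - \<phi> x"
      define q where "q = F (\<phi> z) - F (\<phi> x)"
      have 1: "norm (q - p) \<le> \<epsilon> * norm p" using d1(2)[of "\<phi> z"] d3(2)[of z] z by (simp add: p_def q_def)
      have 2: "norm (q - K (z - x)) \<le> \<epsilon>2 * norm (z - x)" using d2(2)[of z] z by (simp add: q_def)
      have "norm p \<le> norm (q - p) + norm q" by (metis norm_minus_commute norm_triangle_sub add.commute)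
      then have "norm p \<le> norm p / 2 + norm q"
        using 1 mult_right_mono[OF \<epsilon>(2) norm_ge_zero[of p]] by simp
      then have p: "norm p \<le> 2 * norm q" by simp
      have "norm q \<le> norm (q - K (z - x)) + norm (K (z - x))" by (metis norm_triangle_sub add.commute)
      also have "\<dots> \<le> norm (z - x) + norm (z - x) * C"
        using 2 C(1)[of "z - x"] mult_right_mono[OF \<epsilon>2(2) norm_ge_zero[of "z - x"]] by simp
      finally have "norm p \<le> (2 * C + 2) * norm (z - x)" using p by (simp add: algebra_simps)
      then have "\<epsilon> * norm p \<le> \<epsilon> * ((2 * C + 2) * norm (z - x))" using \<epsilon>(1) by simp
      also have "\<dots> \<le> (e / 2) * norm (z - x)"
        using mult_right_mono[OF \<epsilon>(3) norm_ge_zero[of "z - x"]] by (simp add: mult.assoc)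
      finally have 3: "norm (q - p) \<le> (e / 2) * norm (z - x)" using 1 by simp
      have 4: "norm (q - K (z - x)) \<le> (e / 2) * norm (z - x)"
        using 2 mult_right_mono[OF \<epsilon>2(3) norm_ge_zero[of "z - x"]] by simp
      have "norm (p - K (z - x)) \<le> norm (q - K (z - x)) + norm (q - p)"
        using norm_triangle_ineq4[of "q - K (z - x)" "q - p"] by simp
      then show "norm (\<phi> z - \<phi> x - K (z - x)) \<le> e * norm (z - x)"
        using 3 4 by (simp add: p_def field_simps)
    qed
  qed
  then show ?thesis by (auto simp: differentiable_def)
qed


subsection \<open>Charts of the quotient\<close>

lemma atlas_open: "c \<in> berger_atlas \<Longrightarrow> open (fst c)"
  and atlas_inj: "c \<in> berger_atlas \<Longrightarrow> inj_on (snd c) (fst c)"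
  by (auto simp: berger_atlas_def)

lemma smooth_emb_chart: assumes "c \<in> berger_atlas" shows "smooth_on (fst c) (emb c)"
proof (rule smooth_on_local)
  fix x assume "x \<in> fst c"
  then obtain W \<sigma> where x: "x \<in> W" and "chart_lift W \<sigma> c" using berger_atlas_lift[OF assms] by metis
  then interpret chart_lift W \<sigma> c by simp
  show "\<exists>W. open W \<and> x \<in> W \<and> smooth_on W (emb c)" using x open_W smooth_emb by blast
qed

lemma smooth_Zf: assumes "c \<in> berger_atlas" shows "smooth_on (fst c) (\<lambda>x. Zf c x i)"
  unfolding Zf_def
  by (intro smooth_on_bilinear[OF atlas_open[OF assms] bounded_bilinear_zmat] smooth_on_pd smooth_emb_chart assms)

lemma smooth_destab: assumes "c \<in> berger_atlas" shows "smooth_on (fst c) (destab u c)"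
proof -
  note U = atlas_open[OF assms]
  note E = smooth_emb_chart[OF assms] and Z = smooth_Zf[OF assms]
  have "smooth_on (fst c) (\<lambda>x. ((\<Sum>a\<in>UNIV. u $ a *\<^sub>R emb c x $ a) \<bullet>
     (Zf c x i ** Zf c x j + Zf c x j ** Zf c x i)) / sqrt 3)" for i j
    by (intro smooth_on_bounded_linear[OF U bounded_linear_divide] smooth_on_bilinear[OF U bounded_bilinear_inner]
        smooth_on_sum[OF U] smooth_on_bounded_linear[OF U bounded_linear_scaleR_right] smooth_on_vec_nth[OF U] E
        smooth_on_add[OF U] smooth_on_matmul[OF U] Z)
  then show ?thesis
    by (intro smooth_on_vec[OF U]) (simp add: destab_def)
qed

text \<open>Contraction with \<open>emb c x\<close> maps the partial derivatives linearly to the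
  matrices \<open>Zf\<close>, whose independence is \<open>atlas_immersion\<close>.\<close>

lemma inj_pd_emb:
  assumes "c \<in> berger_atlas" "x \<in> fst c"
  shows "inj (\<lambda>v. \<Sum>i\<in>UNIV. v $ i *\<^sub>R pd i (emb c) x)"
proof -
  have lin: "linear (\<lambda>v::real^7. \<Sum>i\<in>UNIV. v $ i *\<^sub>R pd i (emb c) x)"
    by (simp add: linear_iff scaleR_add_left sum.distrib scaleR_sum_right)
  show ?thesis
    unfolding linear_injective_0[OF lin]
  proof (intro allI impI)
    fix v :: "real^7" assume "(\<Sum>i\<in>UNIV. v $ i *\<^sub>R pd i (emb c) x) = 0"
    then have "zmat (\<Sum>i\<in>UNIV. v $ i *\<^sub>R pd i (emb c) x) (emb c x) = 0"
      by (simp add: bounded_bilinear.zero_left[OF bounded_bilinear_zmat])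
    then have "(\<Sum>i\<in>UNIV. v $ i *\<^sub>R Zf c x i) = 0"
      by (simp add: Zf_def bounded_bilinear.sum_left[OF bounded_bilinear_zmat] bounded_bilinear.scaleR_left[OF bounded_bilinear_zmat])
    then show "v = 0" by (rule atlas_immersion[OF assms])
  qed
qed

text \<open>Charts are open for the quotient topology. The lift differs from the given
  representative \<open>P\<close> by a subgroup element, and right multiplication by it is an
  isometry, so the same radius serves.\<close>

lemma chart_openness:
  assumes d: "d \<in> berger_atlas" "y \<in> fst d" and N: "open N" "y \<in> N" "N \<subseteq> fst d"
    and P: "P \<in> SO5" "left_coset P = snd d y"
  obtains \<delta> where "\<delta> > 0" "\<And>Q. Q \<in> SO5 \<Longrightarrow> dist Q P < \<delta> \<Longrightarrow> left_coset Q \<in> snd d ` N"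
proof -
  obtain \<tau> where \<tau>: "local_lift d y \<tau>" "inj (tangent_m \<tau> y)"
    using d unfolding berger_atlas_def by blast
  then obtain W where y: "y \<in> W" and "chart_lift W \<tau> d" by (metis local_lift_chart_lift)
  then interpret chart_lift W \<tau> d by simp
  obtain \<delta> where \<delta>: "\<delta> > 0" "\<And>Q. Q \<in> SO5 \<Longrightarrow> dist Q (\<tau> y) < \<delta> \<Longrightarrow> \<exists>y'\<in>N \<inter> W. left_coset (\<tau> y') = left_coset Q"
    by (rule coset_in_lift_image[OF y \<tau>(2), of "N \<inter> W"]) (use N y open_W in auto)
  obtain k where k: "k \<in> SO3_irr" "\<tau> y = P ** k"
    using left_coset_eqE[of P "\<tau> y"] P(2) coset[OF y] by metis
  have "k = transpose P ** \<tau> y" by (simp add: k(2) matrix_mul_assoc SO5_orthogonal[OF P(1)])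
  then have k5: "k \<in> SO5" by (simp add: SO5_mult SO5_transpose P(1) SO5[OF y])
  have kk: "k ** transpose k = mat 1" using SO5_orthogonal[OF k5] by simp
  have dist: "dist (Q ** k) (P ** k) = dist Q P" for Q
  proof -
    have "norm (A ** k) = norm A" for A
    proof -
      have "(A ** k) \<bullet> (A ** k) = A \<bullet> A"
        unfolding inner_matmul_right[of A k] by (simp add: kk flip: matrix_mul_assoc)
      then show ?thesis by (simp add: norm_eq_sqrt_inner)
    qed
    then show ?thesis by (metis dist_norm matmul.diff_left)
  qed
  show ?thesis
  proof (rule that[OF \<delta>(1)])
    fix Q assume Q: "Q \<in> SO5" "dist Q P < \<delta>"
    then obtain y' where y': "y' \<in> N \<inter> W" "left_coset (\<tau> y') = left_coset (Q ** k)"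
      using \<delta>(2)[of "Q ** k"] SO5_mult[OF Q(1) k5] dist[of Q] by (auto simp: k(2))
    then show "left_coset Q \<in> snd d ` N"
      using coset[of y'] left_coset_mult[OF k(1)] by (auto intro!: image_eqI[of _ _ y'])
  qed
qed

context
  fixes c d :: "((real^5^5) set, 7) chart" and x y :: "real^7"
  assumes c: "c \<in> berger_atlas" and d: "d \<in> berger_atlas" and x: "x \<in> fst c" and y: "y \<in> fst d"
    and xy: "snd c x = snd d y"
begin

lemma transition_eq: "transition c d x = y"
  using inv_into_f_f[OF atlas_inj[OF d] y] xy by (simp add: transition_def)

text \<open>A lift of \<open>c\<close> is continuous at \<open>x\<close>, so nearby points have
  cosets in the open image of \<open>N\<close> under \<open>d\<close>.\<close>

lemma transition_near:
  assumes N: "open N" "y \<in> N" "N \<subseteq> fst d"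
  obtains \<delta> where "\<delta> > 0" "\<And>x'. dist x' x < \<delta> \<Longrightarrow> x' \<in> fst c \<and> transition c d x' \<in> N \<and> snd d (transition c d x') = snd c x'"
proof -
  obtain W \<sigma> where xW: "x \<in> W" and "chart_lift W \<sigma> c" using berger_atlas_lift[OF c x] by metis
  then interpret chart_lift W \<sigma> c by simp
  obtain \<delta>0 where \<delta>0: "\<delta>0 > 0" "\<And>Q. Q \<in> SO5 \<Longrightarrow> dist Q (\<sigma> x) < \<delta>0 \<Longrightarrow> left_coset Q \<in> snd d ` N"
    using chart_openness[OF d y N SO5[OF xW]] coset[OF xW] xy by metis
  have "isCont \<sigma> x"
    using smooth_on_continuous_on[OF smooth] open_W xW continuous_on_eq_continuous_at by blast
  then obtain \<delta>1 where \<delta>1: "\<delta>1 > 0" "\<And>x'. dist x' x < \<delta>1 \<Longrightarrow> dist (\<sigma> x') (\<sigma> x) < \<delta>0"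
    using \<delta>0(1) unfolding continuous_at_eps_delta by blast
  obtain \<delta>2 where \<delta>2: "\<delta>2 > 0" "ball x \<delta>2 \<subseteq> W" using open_W xW openE by blast
  show ?thesis
  proof (rule that[of "min \<delta>1 \<delta>2"])
    fix x' assume x': "dist x' x < min \<delta>1 \<delta>2"
    then have x'W: "x' \<in> W" using \<delta>2 by (auto simp: dist_commute)
    have "snd c x' \<in> snd d ` N"
      using \<delta>0(2)[OF SO5[OF x'W]] \<delta>1(2) x' coset[OF x'W] by simp
    then obtain y' where y': "y' \<in> N" "snd c x' = snd d y'" by blast
    then have "transition c d x' = y'"
      using inv_into_f_f[OF atlas_inj[OF d], of y'] N(3) by (auto simp: transition_def)
    then show "x' \<in> fst c \<and> transition c d x' \<in> N \<and> snd d (transition c d x') = snd c x'"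
      using y' x'W W_sub by auto
  qed (use \<delta>1 \<delta>2 in simp)
qed

lemma isCont_transition: "isCont (transition c d) x"
  unfolding continuous_at_eps_delta
proof (intro allI impI)
  fix e :: real assume "e > 0"
  then have "open (fst d \<inter> ball y e)" "y \<in> fst d \<inter> ball y e" using atlas_open[OF d] y by auto
  then obtain \<delta> where "\<delta> > 0" "\<And>x'. dist x' x < \<delta> \<Longrightarrow> transition c d x' \<in> fst d \<inter> ball y e"
    using transition_near[OF _ _ Int_lower1] by metis
  then show "\<exists>\<delta>>0. \<forall>x'. dist x' x < \<delta> \<longrightarrow> dist (transition c d x') (transition c d x) < e"
    by (auto simp: transition_eq dist_commute intro!: exI[of _ \<delta>])
qed

lemma emb_transition:
  obtains U where "open U" "x \<in> U" "\<And>x'. x' \<in> U \<Longrightarrow> emb c x' = emb d (transition c d x')"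
proof -
  obtain \<delta> where "\<delta> > 0" "\<And>x'. dist x' x < \<delta> \<Longrightarrow> snd d (transition c d x') = snd c x'"
    using transition_near[OF atlas_open[OF d] y order_refl] by metis
  then show ?thesis using that[of "ball x \<delta>"] by (simp add: emb_def dist_commute)
qed

text \<open>Near \<open>x\<close> the embedding in chart \<open>c\<close> is the one in chart
  \<open>d\<close> after the transition, and the latter is an immersion.\<close>

lemma differentiable_transition: "transition c d differentiable (at x)"
proof -
  note dd = smooth_on_differentiable[OF smooth_emb_chart]
  obtain U where U: "open U" "x \<in> U" "\<And>x'. x' \<in> U \<Longrightarrow> emb c x' = emb d (transition c d x')"
    using emb_transition by blast
  have "(\<lambda>z. emb d (transition c d z)) differentiable (at x)"
    using differentiable_cong_open[OF U(1,2), of "emb c"] U(3) dd[OF c x] by simp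
  then obtain h where "((\<lambda>z. emb d (transition c d z)) has_derivative h) (at x)"
    unfolding differentiable_def by blast
  then show ?thesis
    using differentiable_through_immersion[OF _ inj_pd_emb[OF d y], of "emb d" "transition c d" x h]
      has_derivative_pd[OF dd[OF d y]] isCont_transition by (simp add: transition_eq)
qed

lemma pd_emb_transition:
  "pd i (emb c) x = (\<Sum>a\<in>UNIV. pd i (transition c d) x $ a *\<^sub>R pd a (emb d) y)"
proof -
  obtain U where U: "open U" "x \<in> U" "\<And>x'. x' \<in> U \<Longrightarrow> emb c x' = emb d (transition c d x')"
    using emb_transition by blast
  have "(emb d has_derivative (\<lambda>v. \<Sum>i\<in>UNIV. v $ i *\<^sub>R pd i (emb d) y)) (at (transition c d x))"
    using has_derivative_pd[OF smooth_on_differentiable[OF smooth_emb_chart[OF d] y]] by (simp add: transition_eq)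
  from has_derivative_compose[OF frechet_derivative_works[THEN iffD1, OF differentiable_transition] this]
  have "pd i (\<lambda>z. emb d (transition c d z)) x = (\<Sum>a\<in>UNIV. pd i (transition c d) x $ a *\<^sub>R pd a (emb d) y)"
    by (simp add: pd_eqI) (simp add: pd_def)
  then show ?thesis using pd_cong[OF U(1,2), of "emb c"] U(3) by simp
qed

lemma emb_eq_transition: "emb c x = emb d y"
  by (simp add: emb_def xy)

lemma Zf_transition: "Zf c x i = (\<Sum>a\<in>UNIV. pd i (transition c d) x $ a *\<^sub>R Zf d y a)"
  by (simp add: Zf_def pd_emb_transition emb_eq_transition bounded_bilinear.sum_left[OF bounded_bilinear_zmat]
      bounded_bilinear.scaleR_left[OF bounded_bilinear_zmat])

lemma destab_transition:
  "destab u c x $ i $ j = (\<Sum>a\<in>UNIV. \<Sum>b\<in>UNIV. destab u d y $ a $ b * pd i (transition c d) x $ a * pd j (transition c d) x $ b)"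
proof -
  define p where "p i a = pd i (transition c d) x $ a" for i a
  have 1: "Zf c x i ** Zf c x j = (\<Sum>a\<in>UNIV. \<Sum>b\<in>UNIV. (p i a * p j b) *\<^sub>R (Zf d y a ** Zf d y b))" for i j
    unfolding Zf_transition p_def by (subst sum.swap) (simp add: matmul.sum_left matmul.sum_right matmul_simps scaleR_sum_right mult_ac)
  have 2: "Zf c x j ** Zf c x i = (\<Sum>a\<in>UNIV. \<Sum>b\<in>UNIV. (p i a * p j b) *\<^sub>R (Zf d y b ** Zf d y a))"
    unfolding 1 by (subst sum.swap) (simp add: mult_ac)
  have "Zf c x i ** Zf c x j + Zf c x j ** Zf c x i =
    (\<Sum>a\<in>UNIV. \<Sum>b\<in>UNIV. (p i a * p j b) *\<^sub>R (Zf d y a ** Zf d y b + Zf d y b ** Zf d y a))"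
    unfolding 1[of i j] 2 by (simp add: scaleR_add_right sum.distrib)
  then show ?thesis
    by (simp add: destab_def emb_eq_transition inner_sum_right sum_divide_distrib mult_ac flip: p_def)
qed

lemma metric_transition:
  "berger_metric c x = transpose (\<chi> a i. pd i (transition c d) x $ a) ** berger_metric d y ** (\<chi> a i. pd i (transition c d) x $ a)"
proof -
  have "berger_metric c x $ i $ j = (\<Sum>a\<in>UNIV. \<Sum>b\<in>UNIV. pd i (transition c d) x $ a * pd j (transition c d) x $ b * berger_metric d y $ a $ b)" for i j
    unfolding berger_metric_eq[OF c x] berger_metric_eq[OF d y] Zf_transition
    by (simp add: inner_sum_left inner_sum_right sum_distrib_left) (subst sum.swap, simp add: mult_ac)
  then show ?thesis by (simp add: vec_eq_iff congruence_nth)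
qed

end

lemma destab_smooth_sym_tensor2: "smooth_sym_tensor2 berger_atlas (destab u)"
  unfolding smooth_sym_tensor2_def
proof (intro conjI ballI impI allI)
  fix c x assume "c \<in> berger_atlas" "x \<in> fst c"
  show "transpose (destab u c x) = destab u c x"
    by (simp add: destab_def transpose_def vec_eq_iff add.commute)
qed (use smooth_destab destab_transition in blast)+

section \<open>An atlas of translated charts\<close>

text \<open>The generators of the rotations in seven coordinate planes span a complement of the subalgebra.\<close>

definition gens :: "7 \<Rightarrow> real^5^5" where
  "gens i = vec7
    (vec5 (vec5 0 0 0 1 0) (vec5 0 0 0 0 0) (vec5 0 0 0 0 0) (vec5 (-1) 0 0 0 0) (vec5 0 0 0 0 0))
    (vec5 (vec5 0 0 0 0 0) (vec5 0 0 0 1 0) (vec5 0 0 0 0 0) (vec5 0 (-1) 0 0 0) (vec5 0 0 0 0 0))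
    (vec5 (vec5 0 0 0 0 0) (vec5 0 0 0 0 0) (vec5 0 0 0 1 0) (vec5 0 0 (-1) 0 0) (vec5 0 0 0 0 0))
    (vec5 (vec5 0 0 0 0 1) (vec5 0 0 0 0 0) (vec5 0 0 0 0 0) (vec5 0 0 0 0 0) (vec5 (-1) 0 0 0 0))
    (vec5 (vec5 0 0 0 0 0) (vec5 0 0 0 0 1) (vec5 0 0 0 0 0) (vec5 0 0 0 0 0) (vec5 0 (-1) 0 0 0))
    (vec5 (vec5 0 0 0 0 0) (vec5 0 0 0 0 0) (vec5 0 0 0 0 1) (vec5 0 0 0 0 0) (vec5 0 0 (-1) 0 0))
    (vec5 (vec5 0 0 0 0 0) (vec5 0 0 0 0 0) (vec5 0 0 0 0 0) (vec5 0 0 0 0 1) (vec5 0 0 0 (-1) 0)) $ i"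

lemmas gens_vals = gens_def[of 1, unfolded vec7_nth] gens_def[of 2, unfolded vec7_nth]
  gens_def[of 3, unfolded vec7_nth] gens_def[of 4, unfolded vec7_nth] gens_def[of 5, unfolded vec7_nth]
  gens_def[of 6, unfolded vec7_nth] gens_def[of 7, unfolded vec7_nth]

lemma gens_cube: "gens i ** gens i ** gens i = - gens i"
  and gens_skew: "transpose (gens i) = - gens i"
proof -
  have "\<forall>i. gens i ** gens i ** gens i = - gens i" "\<forall>i. transpose (gens i) = - gens i"
    unfolding forall_7 gens_vals vec5_matmul vec5_vecmat vec5_transpose
    by (simp_all add: vec5_linear vec5_matmul vec5_vecmat vec5_eq)
  then show "gens i ** gens i ** gens i = - gens i" "transpose (gens i) = - gens i" by auto
qed

text \<open>Rodrigues' formula for the exponential of \<open>t *\<^sub>R gens i\<close>, valid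
  because of \<open>gens_cube\<close>.\<close>

definition giv :: "7 \<Rightarrow> real \<Rightarrow> real^5^5" where
  "giv i t = mat 1 + sin t *\<^sub>R gens i + (1 - cos t) *\<^sub>R (gens i ** gens i)"

lemma giv_0: "giv i 0 = mat 1"
  by (simp add: giv_def)

lemma giv_add: "giv i s ** giv i t = giv i (s + t)"
proof -
  define E E2 where "E = gens i" and "E2 = gens i ** gens i"
  have E: "E ** E = E2" "E ** E2 = - E" "E2 ** E = - E" "E2 ** E2 = - E2"
    using gens_cube[of i] by (simp_all add: E_def E2_def matrix_mul_assoc matmul_simps)
  have "giv i s ** giv i t = (mat 1 + sin s *\<^sub>R E + (1 - cos s) *\<^sub>R E2) ** (mat 1 + sin t *\<^sub>R E + (1 - cos t) *\<^sub>R E2)"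
    by (simp add: giv_def E_def E2_def)
  also have "\<dots> = mat 1 + sin (s + t) *\<^sub>R E + (1 - cos (s + t)) *\<^sub>R E2"
    by (simp add: matmul_simps E) (simp add: vec_eq_iff sin_add cos_add algebra_simps)
  finally show ?thesis by (simp add: giv_def E_def E2_def)
qed

lemma giv_SO5: "giv i t \<in> SO5"
proof -
  have T: "transpose (giv i t) = giv i (- t)" for t
    by (simp add: giv_def transpose_simps gens_skew matrix_transpose_mul matmul_simps)
  have orth: "orthogonal_matrix (giv i t)" for t
    by (simp add: orthogonal_matrix T giv_add giv_0)
  \<comment> \<open>The half angle exhibits the determinant as the square of 1 or -1.\<close>
  have "det (giv i t) = det (giv i (t / 2)) * det (giv i (t / 2))"
    by (simp add: giv_add flip: det_mul)
  moreover have "det (giv i (t / 2)) = 1 \<or> det (giv i (t / 2)) = - 1"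
    by (rule det_orthogonal_matrix[OF orth])
  ultimately have "det (giv i t) = 1" by auto
  then show ?thesis using orth by (simp add: SO5_def rotation_matrix_def)
qed

section \<open>The chart around the base point and its translates\<close>

definition base :: "real^7 \<Rightarrow> real^5^5" where
  "base y = giv 1 (y $ 1) ** giv 2 (y $ 2) ** giv 3 (y $ 3) ** giv 4 (y $ 4) ** giv 5 (y $ 5) ** giv 6 (y $ 6) ** giv 7 (y $ 7)"

lemma base_SO5: "base y \<in> SO5"
  by (simp add: base_def SO5_mult giv_SO5)

lemma smooth_base: "smooth_on UNIV base"
proof -
  have "smooth_on UNIV (\<lambda>y::real^7. giv i (y $ i))" for i
  proof -
    have "giv i (y $ i) = (mat 1 + gens i ** gens i) + (sin (y $ i) *\<^sub>R gens i + cos (y $ i) *\<^sub>R (- (gens i ** gens i)))" for y :: "real^7"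
      by (simp add: giv_def algebra_simps scaleR_diff_left)
    then show ?thesis
      by (simp only:) (intro smooth_on_add smooth_on_const open_UNIV smooth_on_sin_nth smooth_on_cos_nth
          smooth_on_bounded_linear[OF open_UNIV bounded_linear_scaleR_left])
  qed
  then show ?thesis unfolding base_def[abs_def] by (intro smooth_on_matmul open_UNIV)
qed

interpretation base: lift UNIV base
  by unfold_locales (simp_all add: smooth_base base_SO5)

lemma base_0: "base 0 = mat 1"
  by (simp add: base_def giv_0)

lemma pd_base_0: "pd i base 0 = gens i"
proof -
  have g: "((\<lambda>y::real^7. giv i (y $ i)) has_derivative (\<lambda>v. v $ i *\<^sub>R gens i)) (at 0)" for i
  proof -
    have n: "((\<lambda>y::real^7. y $ i) has_derivative (\<lambda>v. v $ i)) (at 0)"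
      by (rule bounded_linear_imp_has_derivative[OF bounded_linear_vec_nth])
    have "(sin has_derivative (\<lambda>t. t)) (at (0 :: real))" "(cos has_derivative (\<lambda>t. 0)) (at (0 :: real))"
      by (rule has_derivative_eq_rhs[OF DERIV_sin[unfolded has_field_derivative_def]], simp add: fun_eq_iff)
        (rule has_derivative_eq_rhs[OF DERIV_cos[unfolded has_field_derivative_def]], simp add: fun_eq_iff)
    then have "(sin has_derivative (\<lambda>t. t)) (at ((0 :: real^7) $ i))" "(cos has_derivative (\<lambda>t. 0)) (at ((0 :: real^7) $ i))"
      by simp_all
    from this[THEN has_derivative_compose[OF n]]
    have s: "((\<lambda>y::real^7. sin (y $ i)) has_derivative (\<lambda>v. v $ i)) (at 0)"
      and c: "((\<lambda>y::real^7. cos (y $ i)) has_derivative (\<lambda>v. 0)) (at 0)" .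
    have "((\<lambda>y::real^7. giv i (y $ i)) has_derivative (\<lambda>v. 0 + v $ i *\<^sub>R gens i + (0 - 0) *\<^sub>R (gens i ** gens i))) (at 0)"
      unfolding giv_def
      by (intro has_derivative_add has_derivative_const has_derivative_scaleR_left has_derivative_diff s c)
    then show ?thesis by simp
  qed
  note b = bounded_bilinear.FDERIV[OF bounded_bilinear_matrix_mult]
  have "(base has_derivative (\<lambda>v. \<Sum>i\<in>UNIV. v $ i *\<^sub>R gens i)) (at 0)"
    unfolding base_def[abs_def]
    by (rule has_derivative_eq_rhs[OF b[OF b[OF b[OF b[OF b[OF b[OF g g] g] g] g] g] g]])
      (simp add: giv_0 sum_7 add_ac)
  then show ?thesis
    by (simp add: pd_eqI axis_def if_distrib if_distribR cong: if_cong)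
qed

definition base_frame :: "real^7 \<Rightarrow> real^7^7" where
  "base_frame y = (\<chi> a i. theta (base.X i y) $ a)"

lemma base_frame_mult: "base_frame y *v v = theta (\<Sum>i\<in>UNIV. v $ i *\<^sub>R base.X i y)"
  by (simp add: vec_eq_iff matrix_vector_mult_def base_frame_def linear_sum[OF theta_linear]
      linear_cmul[OF theta_linear] sum_component mult.commute)

lemma continuous_on_base_frame: "continuous_on UNIV base_frame"
proof -
  have "continuous_on UNIV (base.X i)" for i by (rule smooth_on_continuous_on[OF base.smooth_X])
  then have "continuous_on UNIV (\<lambda>y. theta (base.X i y))" for i
    by (rule bounded_linear.continuous_on[OF linear_conv_bounded_linear[THEN iffD1, OF theta_linear]])
  then show ?thesis unfolding base_frame_def
    by (intro continuous_on_vec_lambda continuous_on_component)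
qed

lemma base_frame_0: assumes "base_frame 0 *v v = 0" shows "v = 0"
proof -
  have "base.X i 0 = gens i" for i by (simp add: base.X_def base_0 pd_base_0)
  then have *: "theta (\<Sum>i\<in>UNIV. v $ i *\<^sub>R gens i) = 0" using assms by (simp add: base_frame_mult)
  have "mbas c \<bullet> (\<Sum>i\<in>UNIV. v $ i *\<^sub>R gens i) = 0" for c
    using arg_cong[OF *, of "\<lambda>x. x $ c"] nrm_pos[of c] by (simp add: theta_nth)
  then have "\<forall>c. (\<Sum>i\<in>UNIV. v $ i * (mbas c \<bullet> gens i)) = 0" by (simp add: inner_sum_right)
  then have "\<forall>i. v $ i = 0"
    unfolding forall_7 sum_7 mbas_vals gens_vals by (simp add: vec5_inner, auto)
  then show ?thesis by (simp add: vec_eq_iff)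
qed

text \<open>Injectivity modulo the subgroup is obtained from local injectivity of \<open>orb\<close>
  after \<open>base\<close>, which has an injective derivative at 0. A smaller radius also keeps the
  frame invertible.\<close>

lemma base_radius_exists:
  "\<exists>r>0. inj_on (\<lambda>y. orb (base y)) (ball 0 r) \<and> (\<forall>y\<in>ball 0 r. det (base_frame y) \<noteq> 0)"
proof -
  define f where "f y = orb (base y)" for y
  define f' where "f' y v = (\<Sum>i\<in>UNIV. v $ i *\<^sub>R pd i f y)" for y and v :: "real^7"
  have sf: "smooth_on UNIV f" unfolding f_def[abs_def] by (rule base.smooth_orb)
  have df: "(f has_derivative f' y) (at y)" for y
    unfolding f'_def[abs_def] by (rule has_derivative_pd[OF smooth_on_differentiable[OF sf UNIV_I]])
  have lin: "linear (f' 0)" using df has_derivative_linear by blast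
  have "inj (f' 0)"
    unfolding linear_injective_0[OF lin]
  proof (intro allI impI)
    fix v assume "f' 0 v = 0"
    then have "zmat (f' 0 v) (f 0) = 0" by (simp add: bounded_bilinear.zero_left[OF bounded_bilinear_zmat])
    moreover have "zmat (f' 0 v) (f 0) = (\<Sum>i\<in>UNIV. v $ i *\<^sub>R zmat (pd i f 0) (f 0))"
      by (simp add: f'_def bounded_bilinear.sum_left[OF bounded_bilinear_zmat] bounded_bilinear.scaleR_left[OF bounded_bilinear_zmat])
    moreover have "zmat (pd i f 0) (f 0) = prm (base.X i 0)" for i
      using base.zmat_orb[of 0 i] by (simp add: f_def[abs_def] base_0)
    ultimately have "prm (\<Sum>i\<in>UNIV. v $ i *\<^sub>R base.X i 0) = 0"
      by (simp add: linear_sum[OF prm_linear] linear_cmul[OF prm_linear])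
    then have "base_frame 0 *v v = 0" by (simp add: base_frame_mult prm_zero_iff)
    then show "v = 0" by (rule base_frame_0)
  qed
  then obtain g' where g': "linear g'" "g' \<circ> f' 0 = id" using linear_injective_left_inverse[OF lin] by blast
  obtain r1 where r1: "r1 > 0" "inj_on f (ball 0 r1)"
  proof (rule has_derivative_locally_injective[of 0 UNIV g' f' f])
    show "bounded_linear g'" using g'(1) linear_conv_bounded_linear by blast
    fix e :: real assume e: "e > 0"
    \<comment> \<open>A continuous bound for the operator norm of the change of the derivative, zero
      at the origin.\<close>
    define n where "n y = (\<Sum>i\<in>UNIV. norm (pd i f y - pd i f 0))" for y
    have "isCont (pd i f) 0" for i
      using smooth_on_continuous_on[OF smooth_on_pd[OF sf]] continuous_on_eq_continuous_at[OF open_UNIV] by blast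
    then have "isCont n 0" unfolding n_def by (intro continuous_intros)
    then obtain d where d: "d > 0" "\<And>y. dist y 0 < d \<Longrightarrow> dist (n y) (n 0) < e"
      using e unfolding continuous_at_eps_delta by blast
    show "\<exists>d>0. \<forall>x. dist 0 x < d \<longrightarrow> onorm (\<lambda>v. f' x v - f' 0 v) < e"
    proof (intro exI[of _ d] conjI allI impI d(1))
      fix x :: "real^7" assume "dist 0 x < d"
      then have "n x < e" using d(2)[of x] by (simp add: dist_commute n_def)
      moreover have "onorm (\<lambda>v. f' x v - f' 0 v) \<le> n x"
      proof (rule onorm_le)
        fix v
        have "f' x v - f' 0 v = (\<Sum>i\<in>UNIV. v $ i *\<^sub>R (pd i f x - pd i f 0))"
          by (simp add: f'_def sum_subtractf scaleR_diff_right)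
        also have "norm \<dots> \<le> (\<Sum>i\<in>UNIV. norm (v $ i *\<^sub>R (pd i f x - pd i f 0)))" by (rule norm_sum)
        also have "\<dots> \<le> (\<Sum>i\<in>UNIV. norm v * norm (pd i f x - pd i f 0))"
          by (intro sum_mono) (simp add: component_le_norm_cart mult_right_mono)
        finally show "norm (f' x v - f' 0 v) \<le> n x * norm v" by (simp add: n_def sum_distrib_left mult.commute)
      qed
      ultimately show "onorm (\<lambda>v. f' x v - f' 0 v) < e" by simp
    qed
  qed (use df g'(2) in auto)
  have "open {y. det (base_frame y) \<noteq> 0}"
  proof (intro open_Collect_neq continuous_on_const)
    show "continuous_on UNIV (\<lambda>y. det (base_frame y))"
      unfolding det_def by (intro continuous_intros continuous_on_component continuous_on_base_frame)
  qed
  moreover have "det (base_frame 0) \<noteq> 0"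
  proof -
    have "\<exists>B. B ** base_frame 0 = mat 1"
      unfolding matrix_left_invertible_ker using base_frame_0 by blast
    then show ?thesis using invertible_left_inverse invertible_det_nz by blast
  qed
  ultimately obtain r2 where r2: "r2 > 0" "ball 0 r2 \<subseteq> {y. det (base_frame y) \<noteq> 0}"
    using openE[of "{y. det (base_frame y) \<noteq> 0}" 0] by blast
  show ?thesis
    using r1 r2 by (intro exI[of _ "min r1 r2"]) (auto simp: f_def[abs_def] intro: inj_on_subset)
qed

definition base_radius :: real where
  "base_radius = (SOME r. r > 0 \<and> inj_on (\<lambda>y. orb (base y)) (ball 0 r) \<and> (\<forall>y\<in>ball 0 r. det (base_frame y) \<noteq> 0))"

lemma base_radius: "base_radius > 0" "inj_on (\<lambda>y. orb (base y)) (ball 0 base_radius)"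
  "y \<in> ball 0 base_radius \<Longrightarrow> det (base_frame y) \<noteq> 0"
  using someI_ex[OF base_radius_exists] unfolding base_radius_def by blast+

definition chart_at :: "real^5^5 \<Rightarrow> ((real^5^5) set, 7) chart" where
  "chart_at P = (ball 0 base_radius, \<lambda>y. left_coset (P ** base y))"

lemma chart_at_simps [simp]: "fst (chart_at P) = ball 0 base_radius" "snd (chart_at P) y = left_coset (P ** base y)"
  by (simp_all add: chart_at_def)

lemma chart_at_lift:
  assumes P: "P \<in> SO5"
  shows "chart_lift (ball 0 base_radius) (\<lambda>y. P ** base y) (chart_at P)"
proof
  show "smooth_on (ball 0 base_radius) (\<lambda>y. P ** base y)"
    using smooth_on_subset[OF smooth_base]
    by (intro smooth_on_bounded_linear[OF open_ball bounded_bilinear.bounded_linear_right[OF bounded_bilinear_matrix_mult]]) auto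
qed (auto simp: SO5_mult P base_SO5)

text \<open>The Maurer-Cartan form is left-invariant. Hence the metric has the same coefficients in
  all translated charts, and a single density \<open>dens\<close> serves for them.\<close>

lemma chart_at_X:
  assumes P: "P \<in> SO5" shows "lift.X (\<lambda>y. P ** base y) i y = base.X i y"
proof -
  have "pd i (\<lambda>y. P ** base y) y = P ** pd i base y"
    by (rule pd_bounded_linear[OF bounded_bilinear.bounded_linear_right[OF bounded_bilinear_matrix_mult] base.d\<sigma>[OF UNIV_I]])
  then show ?thesis
    by (simp add: lift.X_def[OF chart_lift.axioms(1)[OF chart_at_lift[OF P]]] base.X_def matrix_transpose_mul)
      (simp add: matrix_mul_assoc[symmetric], simp add: matrix_mul_assoc[of "transpose P"] SO5_orthogonal[OF P])
qed

text \<open>Equal cosets have equal values of \<open>orb\<close>, so injectivity follows from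
  \<open>base_radius\<close>; the immersion condition is invertibility of
  \<open>base_frame\<close>.\<close>

lemma chart_at_atlas: assumes P: "P \<in> SO5" shows "chart_at P \<in> berger_atlas"
proof -
  interpret chart_lift "ball 0 base_radius" "\<lambda>y. P ** base y" "chart_at P" by (rule chart_at_lift[OF P])
  have "inj_on (snd (chart_at P)) (ball 0 base_radius)"
  proof (rule inj_onI)
    fix y y' assume y: "y \<in> ball 0 base_radius" "y' \<in> ball 0 base_radius" "snd (chart_at P) y = snd (chart_at P) y'"
    then obtain k where k: "k \<in> SO3_irr" "P ** base y' = (P ** base y) ** k"
      using left_coset_eqE[of "P ** base y" "P ** base y'"] by auto
    then have "transpose P ** (P ** base y') = transpose P ** (P ** (base y ** k))" by (simp add: matrix_mul_assoc)
    then have "base y' = base y ** k" by (simp only: matrix_mul_assoc[of "transpose P"] SO5_orthogonal[OF P] matrix_mul_lid)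
    then have "orb (base y') = orb (base y)" by (simp add: orb_def orbv_mult[OF k(1)])
    then show "y = y'" using base_radius(2) y(1,2) by (simp add: inj_on_def)
  qed
  moreover have "inj (tangent_m (\<lambda>y. P ** base y) y)" if y: "y \<in> ball 0 base_radius" for y
  proof -
    have "v = 0" if "tangent_m (\<lambda>y. P ** base y) y v = 0" for v
    proof -
      have "base_frame y *v v = 0"
        using that by (simp add: tangent_m_eq[OF y] chart_at_X[OF P] base_frame_mult prm_zero_iff)
      moreover have "matrix_inv (base_frame y) ** base_frame y = mat 1"
        using matrix_inv_left[of "base_frame y"] base_radius(3)[OF y] by (simp add: invertible_det_nz)
      ultimately show ?thesis by (metis matrix_vector_mul_assoc matrix_vector_mul_lid matrix_vector_mult_0_right)
    qed
    then show ?thesis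
      unfolding inj_tangent_iff[OF y] sum_Zf[OF y] using inner_conj[OF SO5[OF y]] by (metis inner_eq_zero_iff)
  qed
  ultimately show ?thesis
    unfolding berger_atlas_def using local_lift
    by (intro CollectI conjI ballI exI[of _ "\<lambda>y. P ** base y"]) auto
qed

lemma chart_at_metric:
  assumes P: "P \<in> SO5" and y: "y \<in> ball 0 base_radius"
  shows "berger_metric (chart_at P) y = transpose (base_frame y) ** diag (\<lambda>a. 3 * nrm a) ** base_frame y"
proof -
  interpret berger_lift "ball 0 base_radius" "\<lambda>y. P ** base y" "chart_at P" 1
    by (intro berger_lift.intro berger_lift_axioms.intro chart_at_lift P chart_at_atlas) simp
  have "e y = base_frame y" by (simp add: e_def base_frame_def chart_at_X[OF P])
  then show ?thesis using metric_frame[OF y] by simp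
qed

lemma compact_SO5: "compact SO5"
proof -
  have "closed SO5"
  proof -
    have eq: "SO5 = {P. transpose P ** P = mat 1} \<inter> {P. det P = 1}"
      by (auto simp: SO5_def rotation_matrix_def orthogonal_matrix)
    have 1: "closed {P :: real^5^5. transpose P ** P = mat 1}"
      by (intro closed_Collect_eq continuous_on_const bounded_bilinear.continuous_on[OF bounded_bilinear_matrix_mult]
          continuous_on_id bounded_linear.continuous_on[OF bounded_linear_transpose])
    have 2: "closed {P :: real^5^5. det P = 1}"
      unfolding det_def by (intro closed_Collect_eq continuous_intros)
    show ?thesis unfolding eq by (rule closed_Int[OF 1 2])
  qed
  moreover have "bounded SO5"
  proof (rule boundedI)
    fix P assume P: "P \<in> SO5"
    have "P \<bullet> P = mat 1 \<bullet> (mat 1 :: real^5^5)"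
      using inner_matmul_left[of P "mat 1" P] SO5_orthogonal[OF P] by simp
    then show "norm P \<le> norm (mat 1 :: real^5^5)" by (simp add: norm_eq_sqrt_inner)
  qed
  ultimately show ?thesis by (simp add: compact_eq_bounded_closed)
qed

text \<open>The compactness argument takes place upstairs in SO(5), with the radii supplied by
  \<open>chart_openness\<close>.\<close>

lemma finite_chart_cover:
  obtains F where "finite F" "F \<subseteq> SO5" "berger_space = (\<Union>P\<in>F. snd (chart_at P) ` ball 0 base_radius)"
proof -
  have "\<exists>\<delta>>0. \<forall>Q\<in>SO5. dist Q P < \<delta> \<longrightarrow> left_coset Q \<in> snd (chart_at P) ` ball 0 base_radius" if P: "P \<in> SO5" for P
  proof -
    obtain \<delta> where "\<delta> > 0" "\<And>Q. Q \<in> SO5 \<Longrightarrow> dist Q P < \<delta> \<Longrightarrow> left_coset Q \<in> snd (chart_at P) ` ball 0 base_radius"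
      by (rule chart_openness[OF chart_at_atlas[OF P], of 0 "ball 0 base_radius" P])
        (use P base_radius(1) in \<open>auto simp: base_0\<close>)
    then show ?thesis by blast
  qed
  then obtain \<delta> where \<delta>: "\<And>P. P \<in> SO5 \<Longrightarrow> \<delta> P > 0"
    "\<And>P Q. P \<in> SO5 \<Longrightarrow> Q \<in> SO5 \<Longrightarrow> dist Q P < \<delta> P \<Longrightarrow> left_coset Q \<in> snd (chart_at P) ` ball 0 base_radius"
    by metis
  have "SO5 \<subseteq> (\<Union>P\<in>SO5. ball P (\<delta> P))" using \<delta>(1) by auto
  then obtain F where F: "F \<subseteq> SO5" "finite F" "SO5 \<subseteq> (\<Union>P\<in>F. ball P (\<delta> P))"
    using compactE_image[OF compact_SO5, of SO5 "\<lambda>P. ball P (\<delta> P)"] by auto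
  have "berger_space \<subseteq> (\<Union>P\<in>F. snd (chart_at P) ` ball 0 base_radius)"
  proof
    fix p assume "p \<in> berger_space"
    then obtain Q where Q: "Q \<in> SO5" "p = left_coset Q" by (auto simp: berger_space_def)
    then obtain P where "P \<in> F" "dist P Q < \<delta> P" using F(3) by auto
    then show "p \<in> (\<Union>P\<in>F. snd (chart_at P) ` ball 0 base_radius)"
      using \<delta>(2)[of P Q] F(1) Q by (auto simp: dist_commute)
  qed
  moreover have "snd (chart_at P) y \<in> berger_space" if "P \<in> F" for P y
    using F(1) that by (auto simp: berger_space_def SO5_mult base_SO5)
  ultimately show ?thesis using that[OF F(2,1)] by blast
qed

section \<open>The Riemannian measure\<close>

declare chart_at_simps(2) [simp del]

text \<open>The change of variables theorem is applied to \<open>f\<close> regarded as a map into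
  \<open>real^1\<close> and translated back to nonnegative integrals.\<close>

lemma nn_integral_change_of_variables:
  fixes f :: "real^'m::{finite,wellorder} \<Rightarrow> real" and g :: "real^'m::_ \<Rightarrow> real^'m::_"
  assumes S: "S \<in> sets lebesgue"
    and der: "\<And>x. x \<in> S \<Longrightarrow> (g has_derivative g' x) (at x within S)" and inj: "inj_on g S"
    and f: "f absolutely_integrable_on g ` S" "\<And>y. y \<in> g ` S \<Longrightarrow> 0 \<le> f y"
  shows "(\<integral>\<^sup>+x\<in>S. ennreal (\<bar>det (matrix (g' x))\<bar> * f (g x)) \<partial>lborel) = (\<integral>\<^sup>+y\<in>g ` S. ennreal (f y) \<partial>lborel)"
proof -
  define F :: "real^'m::{finite,wellorder} \<Rightarrow> real^1" where "F y = vec (f y)" for y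
  have F: "F absolutely_integrable_on g ` S \<and> integral (g ` S) F = vec (integral (g ` S) f)"
    using f(1) by (simp add: F_def absolutely_integrable_on_1_iff integral_on_1_eq set_lebesgue_integral_eq_integral)
  then have "(\<lambda>x. \<bar>det (matrix (g' x))\<bar> *\<^sub>R F (g x)) absolutely_integrable_on S \<and>
      integral S (\<lambda>x. \<bar>det (matrix (g' x))\<bar> *\<^sub>R F (g x)) = vec (integral (g ` S) f)"
    using has_absolute_integral_change_of_variables[OF S der inj, where f=F] by blast
  then have "(\<lambda>x. \<bar>det (matrix (g' x))\<bar> * f (g x)) absolutely_integrable_on S"
    "integral S (\<lambda>x. \<bar>det (matrix (g' x))\<bar> * f (g x)) = integral (g ` S) f"
    by (simp_all add: F_def absolutely_integrable_on_1_iff integral_on_1_eq vec_eq_iff)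
  then have "((\<lambda>x. \<bar>det (matrix (g' x))\<bar> * f (g x)) has_integral integral (g ` S) f) S"
    by (metis set_lebesgue_integral_eq_integral(1) has_integral_integral)
  moreover have "(f has_integral integral (g ` S) f) (g ` S)"
    using f(1) set_lebesgue_integral_eq_integral(1) has_integral_integral by blast
  ultimately show ?thesis
    using nn_integral_has_integral_lebesgue'[of S "\<lambda>x. \<bar>det (matrix (g' x))\<bar> * f (g x)" "integral (g ` S) f"]
      nn_integral_has_integral_lebesgue'[of "g ` S" f "integral (g ` S) f"] f(2) by simp
qed

lemma chart_in_space: "c \<in> berger_atlas \<Longrightarrow> x \<in> fst c \<Longrightarrow> snd c x \<in> berger_space"
proof -
  assume "c \<in> berger_atlas" "x \<in> fst c"
  then obtain W \<sigma> where x: "x \<in> W" and "chart_lift W \<sigma> c" using berger_atlas_lift by metis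
  then interpret chart_lift W \<sigma> c by simp
  show ?thesis using coset[OF x] SO5[OF x] by (auto simp: berger_space_def)
qed

text \<open>On the open overlap of the charts the set is a preimage under the continuous transition
  map.\<close>

lemma chart_preimage_borel:
  assumes c: "c \<in> berger_atlas" and d: "d \<in> berger_atlas" and S: "S \<in> sets borel" "S \<subseteq> fst d"
  shows "{x \<in> fst c. snd c x \<in> snd d ` S} \<in> sets borel"
proof -
  define U where "U = {x \<in> fst c. snd c x \<in> snd d ` fst d}"
  have "open U"
    unfolding open_dist
  proof
    fix x assume "x \<in> U"
    then obtain y where xy: "x \<in> fst c" "y \<in> fst d" "snd c x = snd d y" by (auto simp: U_def)
    obtain \<delta> where \<delta>: "\<delta> > 0" "\<And>x'. dist x' x < \<delta> \<Longrightarrow>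
        x' \<in> fst c \<and> transition c d x' \<in> fst d \<and> snd d (transition c d x') = snd c x'"
      using transition_near[OF c d xy atlas_open[OF d] xy(2) order_refl] by metis
    have "x' \<in> U" if "dist x' x < \<delta>" for x'
      using \<delta>(2)[OF that] by (auto simp: U_def intro: rev_image_eqI)
    then show "\<exists>e>0. \<forall>y. dist y x < e \<longrightarrow> y \<in> U" using \<delta>(1) by blast
  qed
  have "continuous_on U (transition c d)"
    using isCont_transition[OF c d] by (auto intro!: continuous_at_imp_continuous_on simp: U_def)
  then have "transition c d \<in> restrict_space borel U \<rightarrow>\<^sub>M borel"
    by (rule borel_measurable_continuous_on_restrict)
  then have "transition c d -` S \<inter> space (restrict_space borel U) \<in> sets (restrict_space borel U)"
    using S(1) by (rule measurable_sets)
  then have "transition c d -` S \<inter> U \<in> sets borel"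
    using \<open>open U\<close> by (auto simp: space_restrict_space sets_restrict_space_iff)
  moreover have "{x \<in> fst c. snd c x \<in> snd d ` S} = transition c d -` S \<inter> U"
    using S(2) transition_eq[OF c d] by (auto simp: U_def)
  ultimately show ?thesis by simp
qed

lemma chart_frame_invertible:
  assumes "c \<in> berger_atlas" "x \<in> fst c" "s > 0"
  shows "det (s *\<^sub>R berger_metric c x) > 0"
proof -
  obtain W \<sigma> where x: "x \<in> W" and "chart_lift W \<sigma> c" using assms berger_atlas_lift by metis
  then interpret berger_lift W \<sigma> c s
    by (intro berger_lift.intro berger_lift_axioms.intro assms)
  have "det (diag (\<lambda>a. s * 3 * nrm a)) = (\<Prod>a\<in>UNIV. s * 3 * nrm a)"
    by (subst det_diagonal) (auto simp: diag_def)
  moreover have "\<dots> > 0" using assms(3) nrm_pos by (intro prod_pos) simp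
  moreover have "det (e x) \<noteq> 0" using invertible_e[OF x] invertible_det_nz by blast
  moreover have "det (s *\<^sub>R berger_metric c x) = (det (e x))\<^sup>2 * det (diag (\<lambda>a. s * 3 * nrm a))"
    unfolding metric_frame[OF x] by (simp add: det_mul det_transpose power2_eq_square)
  ultimately show ?thesis by simp
qed

section \<open>Gluing the measure from a finite cover by translated charts\<close>

locale riemannian_construction =
  fixes s :: real and n :: nat and P :: "nat \<Rightarrow> real^5^5"
  assumes s: "s > 0" and P: "i < n \<Longrightarrow> P i \<in> SO5"
    and cover: "berger_space = (\<Union>i<n. snd (chart_at (P i)) ` ball 0 base_radius)"
begin

abbreviation "B \<equiv> ball (0 :: real^7) base_radius"
abbreviation "ch i \<equiv> chart_at (P i)"

definition dens :: "real^7 \<Rightarrow> real" where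
  "dens y = sqrt (det (s *\<^sub>R (transpose (base_frame y) ** diag (\<lambda>a. 3 * nrm a) ** base_frame y)))"

text \<open>Charts with smaller index take precedence, so the images of the sets \<open>D i\<close>
  partition the space.\<close>

definition D :: "nat \<Rightarrow> (real^7) set" where
  "D i = {y \<in> B. snd (ch i) y \<notin> (\<Union>j<i. snd (ch j) ` B)}"

definition gens_sets :: "(real^5^5) set set set" where
  "gens_sets = {snd c ` S | c S. c \<in> berger_atlas \<and> S \<in> sets borel \<and> S \<subseteq> fst c}"

definition mu_fun :: "(real^5^5) set set \<Rightarrow> ennreal" where
  "mu_fun A = (\<Sum>i<n. emeasure (density lborel dens) (D i \<inter> snd (ch i) -` A))"

definition mu :: "(real^5^5) set measure" where
  "mu = measure_of berger_space gens_sets mu_fun"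

lemma ch_atlas: "i < n \<Longrightarrow> ch i \<in> berger_atlas"
  by (simp add: chart_at_atlas P)

lemma dens_eq: "i < n \<Longrightarrow> y \<in> B \<Longrightarrow> dens y = sqrt (det (s *\<^sub>R berger_metric (ch i) y))"
  by (simp add: dens_def chart_at_metric P)

lemma continuous_dens: "continuous_on UNIV dens"
  unfolding dens_def[abs_def] det_def
  by (intro continuous_intros continuous_on_component bounded_bilinear.continuous_on[OF bounded_bilinear_matrix_mult]
      bounded_linear.continuous_on[OF bounded_linear_transpose] continuous_on_base_frame)

lemma dens_measurable [measurable]: "dens \<in> borel_measurable borel"
  by (rule borel_measurable_continuous_onI[OF continuous_dens])

lemma D_sub: "D i \<subseteq> B" and D_norm: "y \<in> D i \<Longrightarrow> norm y < base_radius" by (auto simp: D_def)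

lemma D_borel: assumes "i < n" shows "D i \<in> sets borel"
proof -
  have "D i = B - (\<Union>j<i. {y \<in> fst (ch i). snd (ch i) y \<in> snd (ch j) ` B})"
    by (auto simp: D_def)
  moreover have "{y \<in> fst (ch i). snd (ch i) y \<in> snd (ch j) ` B} \<in> sets borel" if "j < i" for j
    using assms that by (intro chart_preimage_borel ch_atlas) auto
  ultimately show ?thesis by auto
qed

lemma preimage_borel:
  assumes "i < n" "A \<in> sigma_sets berger_space gens_sets"
  shows "D i \<inter> snd (ch i) -` A \<in> sets borel"
  using assms(2)
proof induction
  case (Basic A)
  then obtain c S where A: "A = snd c ` S" "c \<in> berger_atlas" "S \<in> sets borel" "S \<subseteq> fst c" by (auto simp: gens_sets_def)
  have "D i \<inter> snd (ch i) -` A = D i \<inter> {y \<in> fst (ch i). snd (ch i) y \<in> snd c ` S}"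
    using D_norm by (auto simp: A(1))
  then show ?case
    using sets.Int[OF D_borel[OF assms(1)] chart_preimage_borel[OF ch_atlas[OF assms(1)] A(2-4)]] by (simp only:)
next
  case (Compl A)
  have "snd (ch i) y \<in> berger_space" if "y \<in> D i" for y
    by (rule chart_in_space[OF ch_atlas[OF assms(1)]]) (simp add: D_norm[OF that])
  then have "D i \<inter> snd (ch i) -` (berger_space - A) = D i - (D i \<inter> snd (ch i) -` A)"
    by blast
  then show ?case using D_borel[OF assms(1)] Compl.IH by simp
next
  case (Union A)
  have "(\<Union>k. D i \<inter> snd (ch i) -` A k) \<in> sets borel" using Union.IH by (intro sets.countable_UN) auto
  moreover have "D i \<inter> snd (ch i) -` \<Union> (range A) = (\<Union>k. D i \<inter> snd (ch i) -` A k)" by auto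
  ultimately show ?case by (simp only:)
qed simp

lemma gens_Pow: "gens_sets \<subseteq> Pow berger_space"
  using chart_in_space by (auto simp: gens_sets_def)

lemma gens_setsI: "c \<in> berger_atlas \<Longrightarrow> S \<in> sets borel \<Longrightarrow> S \<subseteq> fst c \<Longrightarrow> snd c ` S \<in> gens_sets"
  unfolding gens_sets_def by blast

lemma emeasure_mu:
  assumes "A \<in> sigma_sets berger_space gens_sets"
  shows "emeasure mu A = mu_fun A"
proof (rule emeasure_measure_of[OF mu_def gens_Pow])
  show "positive (sets mu) mu_fun" by (simp add: positive_def mu_fun_def)
  show "A \<in> sets mu" using assms by (simp add: mu_def gens_Pow)
  show "countably_additive (sets mu) mu_fun"
  proof (rule countably_additiveI)
    fix F :: "nat \<Rightarrow> _" assume F: "range F \<subseteq> sets mu" "disjoint_family F"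
    have "(\<Sum>k. emeasure (density lborel dens) (D i \<inter> snd (ch i) -` F k)) =
        emeasure (density lborel dens) (D i \<inter> snd (ch i) -` (\<Union>k. F k))" if "i < n" for i
    proof -
      have "(\<Sum>k. emeasure (density lborel dens) (D i \<inter> snd (ch i) -` F k)) =
        emeasure (density lborel dens) (\<Union>k. D i \<inter> snd (ch i) -` F k)"
        using F preimage_borel[OF that]
        by (intro suminf_emeasure) (auto simp: mu_def gens_Pow disjoint_family_on_def image_subset_iff)
      moreover have "(\<Union>k. D i \<inter> snd (ch i) -` F k) = D i \<inter> snd (ch i) -` (\<Union>k. F k)" by auto
      ultimately show ?thesis by simp
    qed
    then show "(\<Sum>k. mu_fun (F k)) = mu_fun (\<Union> (range F))"
      unfolding mu_fun_def by (subst suminf_sum) auto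
  qed
qed

lemma D_cover: assumes "p \<in> berger_space" shows "\<exists>!i. i < n \<and> p \<in> snd (ch i) ` D i"
proof -
  define i where "i = (LEAST i. p \<in> snd (ch i) ` B)"
  obtain i0 where i0: "i0 < n" "p \<in> snd (ch i0) ` B" using assms unfolding cover by blast
  have i: "p \<in> snd (ch i) ` B" unfolding i_def by (rule LeastI) (rule i0(2))
  have min: "p \<notin> snd (ch j) ` B" if "j < i" for j using not_less_Least that unfolding i_def by blast
  have "i \<le> i0" unfolding i_def by (rule Least_le) (rule i0(2))
  then have "i < n" using i0 by simp
  moreover have "p \<in> snd (ch i) ` D i" using i min by (auto simp: D_def)
  moreover have "j = i" if "p \<in> snd (ch j) ` D j" for j
  proof (rule linorder_cases[of i j])
    assume "i < j" then show ?thesis using that i unfolding D_def by blast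
  next
    assume "j < i" then show ?thesis using that min[of j] unfolding D_def by blast
  qed simp
  ultimately show ?thesis by (intro ex1I[of _ i] conjI) (blast, blast, elim conjE)
qed

lemma dens_integrable: "S \<in> sets borel \<Longrightarrow> S \<subseteq> B \<Longrightarrow> dens absolutely_integrable_on S"
proof -
  assume S: "S \<in> sets borel" "S \<subseteq> B"
  obtain a b :: "real^7" where ab: "B \<subseteq> cbox a b" using bounded_subset_cbox_symmetric[OF bounded_ball] by metis
  have "dens absolutely_integrable_on cbox a b"
    by (intro absolutely_integrable_continuous continuous_on_subset[OF continuous_dens]) auto
  then show ?thesis
    by (rule set_integrable_subset) (use S ab in auto)
qed

text \<open>\<open>S\<close> is cut into pieces \<open>T i\<close> that the transition maps carry
  into \<open>D i\<close>. The Jacobian is exactly the factor by which the square root of the metric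
  determinant changes, so the pieces add up to the integral in the chart \<open>c\<close>.\<close>

lemma emeasure_chart:
  assumes c: "c \<in> berger_atlas" and S: "S \<in> sets borel" "S \<subseteq> fst c"
  shows "mu_fun (snd c ` S) = (\<integral>\<^sup>+x\<in>S. ennreal (sqrt (det (s *\<^sub>R berger_metric c x))) \<partial>lborel)"
proof -
  define h where "h x = sqrt (det (s *\<^sub>R berger_metric c x))" for x
  define T where "T i = {y \<in> S. snd c y \<in> snd (ch i) ` D i}" for i
  have T_borel: "T i \<in> sets borel" if "i < n" for i
  proof -
    have "T i = S \<inter> {y \<in> fst c. snd c y \<in> snd (ch i) ` D i}" using S(2) by (auto simp: T_def)
    then show ?thesis using chart_preimage_borel[OF c ch_atlas[OF that] D_borel[OF that]] D_sub S(1) by simp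
  qed
  have one: "emeasure (density lborel dens) (D i \<inter> snd (ch i) -` snd c ` S) = (\<integral>\<^sup>+x\<in>T i. ennreal (h x) \<partial>lborel)"
    if i: "i < n" for i
  proof -
    note a = ch_atlas[OF i]
    define \<phi> where "\<phi> = transition c (ch i)"
    define J where "J x = (\<chi> a j. pd j \<phi> x $ a)" for x
    have tr: "\<exists>y. y \<in> D i \<and> y \<in> fst (ch i) \<and> snd c x = snd (ch i) y \<and> \<phi> x = y \<and> x \<in> fst c" if xT: "x \<in> T i" for x
    proof -
      obtain y where y: "y \<in> D i" "snd c x = snd (ch i) y" using xT by (auto simp: T_def)
      moreover have "y \<in> fst (ch i)" using D_norm[OF y(1)] by simp
      moreover have "x \<in> fst c" using xT S(2) by (auto simp: T_def)
      ultimately show ?thesis using transition_eq[OF c a, of x y] by (auto simp: \<phi>_def)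
    qed
    have image: "\<phi> ` T i = D i \<inter> snd (ch i) -` snd c ` S"
    proof (intro subset_antisym subsetI)
      fix y assume "y \<in> \<phi> ` T i"
      then obtain x where x: "x \<in> T i" "y = \<phi> x" by blast
      then show "y \<in> D i \<inter> snd (ch i) -` snd c ` S" using tr[OF x(1)] by (auto simp: T_def)
    next
      fix y assume y: "y \<in> D i \<inter> snd (ch i) -` snd c ` S"
      then obtain x where x: "x \<in> S" "snd c x = snd (ch i) y" by auto
      have "y \<in> fst (ch i)" "x \<in> fst c" using y D_norm x S(2) by auto
      then have "\<phi> x = y" using transition_eq[OF c a _ _ x(2)] by (simp add: \<phi>_def)
      moreover have "x \<in> T i" using x y by (auto simp: T_def)
      ultimately show "y \<in> \<phi> ` T i" by blast
    qed
    have inj: "inj_on \<phi> (T i)"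
    proof (rule inj_onI)
      fix x x' assume "x \<in> T i" "x' \<in> T i" "\<phi> x = \<phi> x'"
      then show "x = x'" using tr[of x] tr[of x'] atlas_inj[OF c] by (metis inj_onD)
    qed
    have der: "(\<phi> has_derivative frechet_derivative \<phi> (at x)) (at x within T i)" if "x \<in> T i" for x
      using tr[OF that] differentiable_transition[OF c a, of x] frechet_derivative_works
      by (auto simp: \<phi>_def intro: has_derivative_at_withinI)
    have M: "matrix (frechet_derivative \<phi> (at x)) = J x" for x
      by (simp add: matrix_def J_def pd_def)
    have img_borel: "\<phi> ` T i \<in> sets borel"
      unfolding image using c S by (intro preimage_borel[OF i] sigma_sets.Basic gens_setsI)
    have h_eq: "h x = \<bar>det (J x)\<bar> * dens (\<phi> x)" if xT: "x \<in> T i" for x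
    proof -
      obtain y where y: "y \<in> fst (ch i)" "snd c x = snd (ch i) y" "\<phi> x = y" "x \<in> fst c" using tr[OF xT] by blast
      have "s *\<^sub>R berger_metric c x = transpose (J x) ** (s *\<^sub>R berger_metric (ch i) y) ** J x"
        using metric_transition[OF c a y(4,1,2)] by (simp add: J_def \<phi>_def matmul_simps)
      then have "det (s *\<^sub>R berger_metric c x) = (det (J x))\<^sup>2 * det (s *\<^sub>R berger_metric (ch i) y)"
        by (simp add: det_mul det_transpose power2_eq_square mult_ac)
      then show ?thesis using dens_eq[OF i, of y] y by (simp add: h_def real_sqrt_mult)
    qed
    have "emeasure (density lborel dens) (\<phi> ` T i) = (\<integral>\<^sup>+y\<in>\<phi> ` T i. ennreal (dens y) \<partial>lborel)"
      using img_borel by (simp add: emeasure_density)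
    also have "\<dots> = (\<integral>\<^sup>+x\<in>T i. ennreal (\<bar>det (matrix (frechet_derivative \<phi> (at x)))\<bar> * dens (\<phi> x)) \<partial>lborel)"
    proof (rule nn_integral_change_of_variables[symmetric, OF _ der inj])
      show "T i \<in> sets lebesgue" using T_borel[OF i] by simp
      show "dens absolutely_integrable_on \<phi> ` T i"
        by (rule dens_integrable[OF img_borel]) (use D_sub image in auto)
      fix y assume "y \<in> \<phi> ` T i"
      then have "y \<in> B" using image D_norm by auto
      then show "0 \<le> dens y" using chart_frame_invertible[OF a _ s, of y] by (simp add: dens_eq[OF i])
    qed
    also have "\<dots> = (\<integral>\<^sup>+x\<in>T i. ennreal (h x) \<partial>lborel)"
      by (intro nn_integral_cong) (auto simp: indicator_def M h_eq)
    finally show ?thesis by (simp add: image)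
  qed
  have "continuous_on (fst c) h"
  proof -
    have cont: "continuous_on (fst c) (\<lambda>x. (s *\<^sub>R berger_metric c x) $ i $ j)" for i j
    proof -
      have "continuous_on (fst c) (\<lambda>x. s *\<^sub>R (3 * (Zf c x i \<bullet> Zf c x j)))"
        by (intro continuous_intros smooth_on_continuous_on[OF smooth_Zf[OF c]])
      then show ?thesis by (rule continuous_on_eq) (simp add: berger_metric_eq[OF c])
    qed
    show ?thesis unfolding h_def det_def
      by (intro continuous_on_real_sqrt continuous_on_sum continuous_on_mult continuous_on_const continuous_on_prod cont)
  qed
  then have meas: "(\<lambda>x. ennreal (h x) * indicator (T i) x) \<in> borel_measurable lborel" if "i < n" for i
  proof -
    have "continuous_on (T i) h" using \<open>continuous_on (fst c) h\<close>
      by (rule continuous_on_subset) (use S(2) in \<open>auto simp: T_def\<close>)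
    then have "(\<lambda>x. ennreal (indicator (T i) x *\<^sub>R h x)) \<in> borel_measurable borel"
      using borel_measurable_continuous_on_indicator[OF T_borel[OF that]] by measurable
    moreover have "ennreal (indicator (T i) x *\<^sub>R h x) = ennreal (h x) * indicator (T i) x" for x
      by (simp add: indicator_def)
    ultimately show ?thesis by simp
  qed
  have ind: "indicator S x = (\<Sum>i<n. indicator (T i) x :: ennreal)" for x
  proof (cases "x \<in> S")
    case True
    then obtain i where i: "i < n" "snd c x \<in> snd (ch i) ` D i" "\<And>j. j < n \<Longrightarrow> snd c x \<in> snd (ch j) ` D j \<Longrightarrow> j = i"
      using D_cover[OF chart_in_space[OF c, of x]] S(2) by blast
    have "(\<Sum>j<n. indicator (T j) x :: ennreal) = (\<Sum>j<n. if j = i then 1 else 0)"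
    proof (rule sum.cong)
      fix j assume "j \<in> {..<n}"
      then have "x \<in> T j \<longleftrightarrow> j = i" using i(1,2) i(3)[of j] True unfolding T_def by blast
      then show "indicator (T j) x = (if j = i then 1 else 0 :: ennreal)" by (simp add: indicator_def)
    qed simp
    then show ?thesis using i(1) True by simp
  qed (simp add: T_def)
  have "mu_fun (snd c ` S) = (\<Sum>i<n. \<integral>\<^sup>+x\<in>T i. ennreal (h x) \<partial>lborel)"
    by (simp add: mu_fun_def one)
  also have "\<dots> = (\<integral>\<^sup>+x. (\<Sum>i<n. ennreal (h x) * indicator (T i) x) \<partial>lborel)"
    by (rule nn_integral_sum[symmetric]) (use meas in auto)
  also have "\<dots> = (\<integral>\<^sup>+x\<in>S. ennreal (h x) \<partial>lborel)"
    by (simp add: ind sum_distrib_left)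
  finally show ?thesis by (simp add: h_def)
qed

lemma riemannian_measure_mu:
  "riemannian_measure berger_space berger_atlas (\<lambda>c x. s *\<^sub>R berger_metric c x) mu"
  unfolding riemannian_measure_def
proof (intro conjI ballI impI)
  show "space mu = berger_space" by (simp add: mu_def gens_Pow)
  have "sets mu = sigma_sets berger_space gens_sets" by (simp add: mu_def gens_Pow)
  then show "sets mu = sigma_sets berger_space {snd c ` S |c S. c \<in> berger_atlas \<and> S \<in> sets borel \<and> S \<subseteq> fst c}"
    unfolding gens_sets_def .
  fix c and S :: "(real^7) set" assume c: "c \<in> berger_atlas" and S: "S \<in> sets borel" "S \<subseteq> fst c"
  then have "snd c ` S \<in> sigma_sets berger_space gens_sets"
    by (intro sigma_sets.Basic gens_setsI)
  then show "emeasure mu (snd c ` S) = (\<integral>\<^sup>+x\<in>S. ennreal (sqrt (det (s *\<^sub>R berger_metric c x))) \<partial>lborel)"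
    by (simp add: emeasure_mu emeasure_chart[OF c S])
qed

text \<open>\<open>measure\<close> is 0 on sets of infinite measure, so finiteness and positivity
  are both at stake. The first follows from the finite cover by bounded charts; for the second, a
  null space would make a ball negligible, as the density is positive.\<close>

lemma measure_mu_pos: "measure mu berger_space > 0"
proof -
  have top: "berger_space \<in> sigma_sets berger_space gens_sets" by (rule sigma_sets_top)
  have "emeasure mu berger_space < \<infinity>"
  proof -
    have "emeasure (density lborel dens) (D i \<inter> snd (ch i) -` berger_space) < \<infinity>" if i: "i < n" for i
    proof -
      have "dens absolutely_integrable_on B" by (rule dens_integrable) auto
      then have "(dens has_integral integral B dens) B"
        using set_lebesgue_integral_eq_integral(1) has_integral_integral by blast
      then have "(\<integral>\<^sup>+y\<in>B. ennreal (dens y) \<partial>lborel) = ennreal (integral B dens)"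
        by (intro nn_integral_has_integral_lebesgue')
          (use chart_frame_invertible[OF ch_atlas[OF i] _ s] dens_eq[OF i] in \<open>auto simp: less_imp_le\<close>)
      then have "emeasure (density lborel dens) B < \<infinity>" by (simp add: emeasure_density)
      moreover have "emeasure (density lborel dens) (D i \<inter> snd (ch i) -` berger_space) \<le> emeasure (density lborel dens) B"
        by (rule emeasure_mono) (use D_sub in auto)
      ultimately show ?thesis by (rule le_less_trans[rotated])
    qed
    then show ?thesis by (simp add: emeasure_mu[OF top] mu_fun_def)
  qed
  moreover have "emeasure mu berger_space > 0"
  proof (rule ccontr)
    assume "\<not> emeasure mu berger_space > 0"
    then have 0: "emeasure mu berger_space = 0" by simp
    have "left_coset (mat 1) \<in> berger_space"
      by (auto simp: berger_space_def SO5_def rotation_matrix_def orthogonal_matrix_id)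
    then have n: "0 < n" using cover by auto
    have "snd (ch 0) ` B \<subseteq> berger_space" using cover n by auto
    moreover have "sets mu = sigma_sets berger_space gens_sets" by (simp add: mu_def gens_Pow)
    ultimately have "emeasure mu (snd (ch 0) ` B) = 0"
      using emeasure_mono[of "snd (ch 0) ` B" berger_space mu] top 0 by simp
    moreover have "snd (ch 0) ` B \<in> sigma_sets berger_space gens_sets"
      by (intro sigma_sets.Basic gens_setsI ch_atlas n) auto
    ultimately have "(\<integral>\<^sup>+x\<in>B. ennreal (sqrt (det (s *\<^sub>R berger_metric (ch 0) x))) \<partial>lborel) = 0"
      using emeasure_chart[OF ch_atlas[OF n], of B] by (simp add: emeasure_mu)
    moreover have "(\<integral>\<^sup>+x\<in>B. ennreal (sqrt (det (s *\<^sub>R berger_metric (ch 0) x))) \<partial>lborel) = (\<integral>\<^sup>+x\<in>B. ennreal (dens x) \<partial>lborel)"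
      by (intro nn_integral_cong) (auto simp: indicator_def dens_eq[OF n])
    ultimately have "(\<integral>\<^sup>+x\<in>B. ennreal (dens x) \<partial>lborel) = 0" by (simp only:)
    moreover have "(\<lambda>x. ennreal (dens x) * indicator B x) \<in> borel_measurable lborel"
      by (intro borel_measurable_times_ennreal borel_measurable_indicator) (auto intro: measurable_compose[OF dens_measurable])
    ultimately have "AE x in lborel. ennreal (dens x) * indicator B x = 0"
      by (simp add: nn_integral_0_iff_AE)
    then have "AE x in lborel. x \<notin> B"
    proof (rule AE_mp, intro AE_I2 impI)
      fix x assume x: "ennreal (dens x) * indicator B x = 0"
      show "x \<notin> B"
      proof
        assume "x \<in> B"
        then have "dens x > 0" using chart_frame_invertible[OF ch_atlas[OF n] _ s, of x] by (simp add: dens_eq[OF n])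
        then show False using x \<open>x \<in> B\<close> by (simp add: indicator_def)
      qed
    qed
    then have "emeasure lborel B = 0"
      by (subst (asm) AE_iff_measurable[of B lborel]) auto
    then have "negligible B" by (simp add: negligible_iff_emeasure0)
    then show False using open_not_negligible[of B] base_radius(1) by simp
  qed
  ultimately show ?thesis by (simp add: measure_def enn2real_positive_iff)
qed

end

section \<open>Linear instability\<close>

text \<open>All chart expressions have the one value \<open>K\<close>, so the definite description
  in \<open>glue\<close> is satisfied by \<open>K\<close> alone.\<close>

lemma glue_const:
  assumes "\<And>c x. c \<in> A \<Longrightarrow> x \<in> fst c \<Longrightarrow> f c x = K" and "c \<in> A" "x \<in> fst c" "snd c x = p"
  shows "glue A f p = K"
  unfolding glue_def using assms by (intro the_equality) blast+

theorem theorem1p4: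
  fixes s :: real
  assumes "s > 0"
  shows "linearly_unstable berger_space berger_atlas (\<lambda>c x. s *\<^sub>R berger_metric c x)"
proof -
  define g where "g c x = s *\<^sub>R berger_metric c x" for c x
  have local: "\<exists>W \<sigma>. x \<in> W \<and> berger_lift W \<sigma> c s" if "c \<in> berger_atlas" "x \<in> fst c" for c x
    using berger_atlas_lift[OF that] that(1) assms berger_lift.intro berger_lift_axioms.intro by metis
  obtain F where F: "finite F" "F \<subseteq> SO5" "berger_space = (\<Union>P\<in>F. snd (chart_at P) ` ball 0 base_radius)"
    by (rule finite_chart_cover)
  obtain n P where nP: "F = P ` {i::nat. i < n}"
    using F(1) finite_imp_nat_seg_image_inj_on by metis
  have "berger_space = (\<Union>i<n. snd (chart_at (P i)) ` ball 0 base_radius)"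
    unfolding F(3) nP by blast
  then interpret riemannian_construction s n P
    by unfold_locales (use assms F(2) nP in auto)
  \<comment> \<open>Any nonzero vector serves; the density depends on it only through its
    length.\<close>
  define u :: "real^5" where "u = axis 1 1"
  define K where "K = - (112 / (3375 * s ^ 3)) * (u \<bullet> u)"
  have u: "u \<noteq> 0" "K < 0" using assms by (simp_all add: u_def K_def axis_eq_0_iff inner_axis_axis)
  have ein: "einstein berger_atlas g (9 / (20 * s))"
    unfolding einstein_def
  proof (intro ballI)
    fix c x assume "c \<in> berger_atlas" "x \<in> fst c"
    then obtain W \<sigma> where W: "x \<in> W" "berger_lift W \<sigma> c s" using local by blast
    show "ricci (g c) x = (9 / (20 * s)) *\<^sub>R g c x"
      unfolding g_def by (rule berger_lift.ricci_eq[OF W(2,1)])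
  qed
  have tt: "tt_tensor berger_atlas g (destab u)"
    unfolding tt_tensor_def
  proof (intro conjI ballI)
    show "smooth_sym_tensor2 berger_atlas (destab u)" by (rule destab_smooth_sym_tensor2)
    fix c x assume "c \<in> berger_atlas" "x \<in> fst c"
    then obtain W \<sigma> where W: "x \<in> W" "berger_lift W \<sigma> c s" using local by blast
    show "tr_metric (g c) (destab u c) x = 0" "divergence (g c) (destab u c) x = 0"
      unfolding g_def by (rule berger_lift.destab_tt[OF W(2,1)])+
  qed
  have nz: "\<exists>c\<in>berger_atlas. \<exists>x\<in>fst c. destab u c x \<noteq> 0"
  proof -
    have "mat 1 \<in> SO5" by (simp add: SO5_def rotation_matrix_def orthogonal_matrix_id)
    then have c: "chart_at (mat 1) \<in> berger_atlas" "0 \<in> fst (chart_at (mat 1))"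
      using base_radius(1) by (simp_all add: chart_at_atlas)
    then obtain W \<sigma> where W: "0 \<in> W" "berger_lift W \<sigma> (chart_at (mat 1)) s" using local by blast
    from berger_lift.destab_nonzero[OF W(2,1) u(1)] c show ?thesis by blast
  qed
  have neg: "(\<integral>p. glue berger_atlas (\<lambda>c. inner_metric (g c)
      (\<lambda>x. rough_laplacian (g c) (destab u c) x - 2 *\<^sub>R curv_action (g c) (destab u c) x) (destab u c)) p \<partial>mu) < 0"
  proof -
    have "inner_metric (g c) (\<lambda>x. rough_laplacian (g c) (destab u c) x - 2 *\<^sub>R curv_action (g c) (destab u c) x) (destab u c) x = K"
      if cx: "c \<in> berger_atlas" "x \<in> fst c" for c x
    proof -
      obtain W \<sigma> where W: "x \<in> W" "berger_lift W \<sigma> c s" using local cx by blast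
      show ?thesis unfolding g_def K_def by (rule berger_lift.stability_density[OF W(2,1)])
    qed
    note glue = glue_const[of berger_atlas, OF this]
    have "(\<integral>p. glue berger_atlas (\<lambda>c. inner_metric (g c)
      (\<lambda>x. rough_laplacian (g c) (destab u c) x - 2 *\<^sub>R curv_action (g c) (destab u c) x) (destab u c)) p \<partial>mu) = (\<integral>p. K \<partial>mu)"
    proof (rule Bochner_Integration.integral_cong[OF refl])
      fix p assume "p \<in> space mu"
      then have "p \<in> berger_space" using riemannian_measure_mu by (simp add: riemannian_measure_def)
      then obtain i y where "i < n" "y \<in> B" "snd (ch i) y = p" using \<open>p \<in> berger_space\<close> unfolding cover by blast
      then show "glue berger_atlas (\<lambda>c. inner_metric (g c)
        (\<lambda>x. rough_laplacian (g c) (destab u c) x - 2 *\<^sub>R curv_action (g c) (destab u c) x) (destab u c)) p = K"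
        using ch_atlas[of i] by (intro glue) auto
    qed
    also have "\<dots> = measure mu berger_space * K"
      using riemannian_measure_mu by (simp add: riemannian_measure_def)
    also have "\<dots> < 0" using measure_mu_pos u(2) by (simp add: mult_pos_neg)
    finally show ?thesis .
  qed
  have "riemannian_measure berger_space berger_atlas g mu"
    unfolding g_def by (rule riemannian_measure_mu)
  with ein tt nz neg have "linearly_unstable berger_space berger_atlas g"
    unfolding linearly_unstable_def by blast
  then show ?thesis by (simp add: g_def[abs_def])
qed

end
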